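(* Let $\Sigma\subset\mathbb{C}$ be a simply connected domain with basepoint $z_0$. The dressing action of $\Lambda^+_PG^{\mathbb{C}}_\sigma$ on normalized potentials of minimal surfaces gives a well-defined group action on the space of minimal immersions $f:\Sigma\to\mathbb{R}^3$.
   Context: Notation. $\mathbb{R}^3=\mathbb{E}^3$ is identified with $\mathfrak{su}(2)$ via the orthonormal basis $e_1=\begin{pmatrix}0&-i\\ -i&0\end{pmatrix}$, $e_2=\begin{pmatrix}0&1\\ -1&0\end{pmatrix}$, $e_3=\begin{pmatrix}i&0\\ 0&-i\end{pmatrix}$ for $\langle X,Y\rangle=-\frac12\mathrm{Trace}(XY)$. Twisted loops are maps $\mathbb{S}^1\to SL(2,\mathbb{C})$ with diagonal entries even and off-diagonal entries odd in $\lambda$. $\Lambda G_\sigma$ is the group of $SU(2)$-valued twisted loops. $\Lambda^+G^{\mathbb{C}}_\sigma$ is the group of twisted loops extending holomorphically to $|\lambda|<1$. $\Lambda^+_PG^{\mathbb{C}}_\sigma$ is its subgroup of loops equal to $\mathrm{diag}(\rho,\rho^{-1})$, $\rho>0$, at $\lambda=0$. $\Lambda^-_*G^{\mathbb{C}}_\sigma$ is the group of twisted loops extending holomorphically to $|\lambda|>1$ with value $I$ at $\infty$. Minimal surfaces and their potentials. A conformal minimal immersion $f$ with metric $4e^{2u}(dx^2+dy^2)$, unit normal $N$ and Hopf differential $Q\,dz^2$, $Q=\langle N,f_{zz}\rangle$, has coordinate frame $F:\Sigma\to SU(2)$ defined by $\mathrm{Ad}_Fe_1=f_x/|f_x|$,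 $\mathrm{Ad}_Fe_2=f_y/|f_y|$, $\mathrm{Ad}_Fe_3=N$, and coordinates of $\mathbb{R}^3$ are chosen so that $F(z_0)=I$. Its extended frame $\hat F:\Sigma\to\Lambda G_\sigma$ solves $\hat F^{-1}d\hat F=\frac12\begin{pmatrix}u_z&0\\ Q e^{-u}\lambda^{-1}&-u_z\end{pmatrix}dz+\frac12\begin{pmatrix}-u_{\bar z}&-\bar Q e^{-u}\lambda\\ 0&u_{\bar z}\end{pmatrix}d\bar z$, $\hat F(z_0)=I$. Its normalized potential is $\hat\eta=\hat\Phi^{-1}d\hat\Phi=\begin{pmatrix}0&0\\ p&0\end{pmatrix}\lambda^{-1}dz$, where $\hat F=\hat\Phi\hat G_+$ with $\hat\Phi\in\Lambda^-_*G^{\mathbb{C}}_\sigma$, $\hat G_+\in\Lambda^+G^{\mathbb{C}}_\sigma$. Different minimal surfaces may have the same normalized potential. If $f$ has classical Weierstrass data $(\mu\,dz,\nu)$, meaning $f_z=\mu(1-\nu^2)e_1-i\mu(1+\nu^2)e_2-2\mu\nu e_3$ and $f=f(z_0)+2\,\mathrm{Re}\int_{z_0}^zf_z\,dz$, with $\nu(z_0)=0$, $\mu(z_0)>0$, then $p=-\nu_z$, $Q=-2\mu\nu_z$, and one puts $a=2\mu$, so that $p=Q/a$. Dressing action on normalized potentials. For $h_+\in\Lambda^+_PG^{\mathbb{C}}_\sigma$, the Iwasawa decomposition $h_+\hat F(z)=\widetilde F(z)\widetilde G_+(z)$, $\widetilde F(z)\in\Lambda G_\sigma$, $\widetilde G_+(z)\in\Lambda^+_PG^{\mathbb{C}}_\sigma$,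 gives a new extended frame $\widetilde F$, hence a new normalized potential of the same form. Equivalently $\widetilde\eta=\hat W_+^{-1}\hat\eta\hat W_++\hat W_+^{-1}d\hat W_+$ with $\hat W_+$ taking values in $\Lambda^+G^{\mathbb{C}}_\sigma$ and $\hat W_+(z_0)=h_+^{-1}$. For potentials of minimal surfaces only the $\lambda^0$ coefficient and the upper-right $\lambda^1$ coefficient of $h_+$ are relevant, so one may take $h_+=\begin{pmatrix}a_0(z_0)^{-1}&-b_1(z_0)\lambda\\ 0&a_0(z_0)\end{pmatrix}$. Induced action on minimal immersions. For such $h_+$, the new immersion $\tilde f$ obtained from $f$, with data $(a,Q)$, has the same Hopf differential $Q\,dz^2$ and data $(\tilde a,Q)$, where $\tilde a$ is determined, together with $a_0(z)$ and $b_1$, by $\hat W_+=\begin{pmatrix}a_0&b_1\lambda\\ 0&a_0^{-1}\end{pmatrix}$, $a_0=\sqrt{a/\tilde a}$, $b_1=\frac{\tilde a}{Q}\frac{d}{dz}\sqrt{a/\tilde a}$, $\frac{db_1}{dz}=0$, $\hat W_+(z_0)=h_+^{-1}$. The Weierstrass data of $\tilde f$ are $\tilde\mu=\tilde a/2$, $\tilde\nu=-\int_{z_0}^zQ/\tilde a\,d\tau$, with $\tilde f(z_0)=f(z_0)$ and the same coordinate frame at $z_0$. *)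

theory Defs
  imports "HOL-Complex_Analysis.Complex_Analysis" "HOL-Algebra.Group_Action"
begin

(* "$" is left ambiguous by the power series library; here it is always a vector component. *)
no_notation fps_nth (infixl \<open>$\<close> 75)

section \<open>Twisted loop groups\<close>

type_synonym mat2 = "complex^2^2"
type_synonym loop = "complex \<Rightarrow> mat2"

abbreviation mat22 :: "complex \<Rightarrow> complex \<Rightarrow> complex \<Rightarrow> complex \<Rightarrow> mat2" where
  "mat22 a b c d \<equiv> vector [vector [a, b], vector [c, d]]"

abbreviation circle :: "complex set" where
  "circle \<equiv> sphere 0 1"

definition special_unitary :: "mat2 set" where
  "special_unitary = {A. (\<chi> i j. cnj (A $ j $ i)) ** A = mat 1 \<and> det A = 1}"

text \<open>
  Loops are taken to be continuous. Like all functions with a restricted domain below they are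
  extensional, so that loops that agree on the circle are equal.
\<close>

definition twisted_loops :: "loop set" where
  "twisted_loops = {g \<in> extensional circle. continuous_on circle g \<and>
     (\<forall>l\<in>circle. det (g l) = 1 \<and>
        g (- l) $ 1 $ 1 = g l $ 1 $ 1 \<and> g (- l) $ 2 $ 2 = g l $ 2 $ 2 \<and>
        g (- l) $ 1 $ 2 = - g l $ 1 $ 2 \<and> g (- l) $ 2 $ 1 = - g l $ 2 $ 1)}"

definition mat_holomorphic_on :: "(complex \<Rightarrow> mat2) \<Rightarrow> complex set \<Rightarrow> bool" where
  "mat_holomorphic_on H A \<longleftrightarrow> (\<forall>i j. (\<lambda>l. H l $ i $ j) holomorphic_on A)"

definition extends_inside :: "loop \<Rightarrow> (complex \<Rightarrow> mat2) \<Rightarrow> bool" where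
  "extends_inside g H \<longleftrightarrow> continuous_on (cball 0 1) H \<and> mat_holomorphic_on H (ball 0 1) \<and>
     (\<forall>l\<in>circle. H l = g l)"

definition extends_outside :: "loop \<Rightarrow> (complex \<Rightarrow> mat2) \<Rightarrow> bool" where
  "extends_outside g H \<longleftrightarrow> continuous_on {l. 1 \<le> norm l} H \<and>
     mat_holomorphic_on H {l. 1 < norm l} \<and> (\<forall>l\<in>circle. H l = g l)"

definition LG :: "loop set" where
  "LG = {g \<in> twisted_loops. \<forall>l\<in>circle. g l \<in> special_unitary}"

definition Lplus :: "loop set" where
  "Lplus = {g \<in> twisted_loops. \<exists>H. extends_inside g H}"

definition LplusP :: "loop set" where
  "LplusP = {g \<in> twisted_loops. \<exists>H. extends_inside g H \<and>
     (\<exists>r::real. r > 0 \<and> H 0 = mat22 (of_real r) 0 0 (of_real (inverse r)))}"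

definition Lminus_star :: "loop set" where
  "Lminus_star = {g \<in> twisted_loops. \<exists>H. extends_outside g H \<and> (H \<longlongrightarrow> mat 1) at_infinity}"

definition loop_mult :: "loop \<Rightarrow> loop \<Rightarrow> loop" where
  "loop_mult g h = (\<lambda>l\<in>circle. g l ** h l)"

definition loop_one :: loop where
  "loop_one = (\<lambda>l\<in>circle. mat 1)"

definition LplusP_group :: "loop monoid" where
  "LplusP_group = \<lparr>carrier = LplusP, mult = loop_mult, one = loop_one\<rparr>"

text \<open>The coefficient of \<open>l^k\<close> in the Fourier expansion of a matrix entry.\<close>

definition loop_coeff :: "loop \<Rightarrow> nat \<Rightarrow> 2 \<Rightarrow> 2 \<Rightarrow> complex" where
  "loop_coeff g k i j =
     contour_integral (circlepath 0 1) (\<lambda>l. g l $ i $ j / l ^ Suc k) / (2 * of_real pi * \<i>)"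

text \<open>
  The part of an element of \<open>LplusP\<close> that matters for potentials of minimal surfaces: the
  \<open>l^0\<close> coefficient (which is diagonal) and the upper right \<open>l^1\<close> coefficient.
\<close>

definition relevant_part :: "loop \<Rightarrow> loop" where
  "relevant_part h = (\<lambda>l\<in>circle.
     mat22 (loop_coeff h 0 1 1) (loop_coeff h 1 1 2 * l) 0 (loop_coeff h 0 2 2))"

section \<open>Derivatives on a plane domain\<close>

definition dx :: "(complex \<Rightarrow> 'a::real_normed_vector) \<Rightarrow> complex \<Rightarrow> 'a" where
  "dx f z = vector_derivative (\<lambda>t::real. f (z + of_real t)) (at 0)"

definition dy :: "(complex \<Rightarrow> 'a::real_normed_vector) \<Rightarrow> complex \<Rightarrow> 'a" where
  "dy f z = vector_derivative (\<lambda>t::real. f (z + \<i> * of_real t)) (at 0)"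

definition C1_on :: "complex set \<Rightarrow> (complex \<Rightarrow> 'a::real_normed_vector) \<Rightarrow> bool" where
  "C1_on S f \<longleftrightarrow> (\<forall>z\<in>S. f differentiable (at z)) \<and> continuous_on S (dx f) \<and> continuous_on S (dy f)"

definition C2_on :: "complex set \<Rightarrow> (complex \<Rightarrow> 'a::real_normed_vector) \<Rightarrow> bool" where
  "C2_on S f \<longleftrightarrow> C1_on S f \<and> C1_on S (dx f) \<and> C1_on S (dy f)"

definition d_z :: "(complex \<Rightarrow> complex) \<Rightarrow> complex \<Rightarrow> complex" where
  "d_z g z = (dx g z - \<i> * dy g z) / 2"

definition d_zbar :: "(complex \<Rightarrow> complex) \<Rightarrow> complex \<Rightarrow> complex" where
  "d_zbar g z = (dx g z + \<i> * dy g z) / 2"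

section \<open>Conformal minimal immersions\<close>

definition unit_normal :: "(complex \<Rightarrow> real^3) \<Rightarrow> complex \<Rightarrow> real^3" where
  "unit_normal f z = (let n = cross3 (dx f z) (dy f z) in n /\<^sub>R norm n)"

definition mean_curvature :: "(complex \<Rightarrow> real^3) \<Rightarrow> complex \<Rightarrow> real" where
  "mean_curvature f z =
     (let E = dx f z \<bullet> dx f z; F = dx f z \<bullet> dy f z; G = dy f z \<bullet> dy f z;
          L = dx (dx f) z \<bullet> unit_normal f z;
          M = dx (dy f) z \<bullet> unit_normal f z;
          N = dy (dy f) z \<bullet> unit_normal f z
      in (E * N - 2 * F * M + G * L) / (2 * (E * G - F\<^sup>2)))"

text \<open>
  A \<open>C^2\<close> conformal immersion with vanishing mean curvature is real analytic, so
  requiring more differentiability would give the same set.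
\<close>

definition minimal_immersions :: "complex set \<Rightarrow> (complex \<Rightarrow> real^3) set" where
  "minimal_immersions S = {f \<in> extensional S. C2_on S f \<and>
     (\<forall>z\<in>S. inj (frechet_derivative f (at z)) \<and>
        norm (dx f z) = norm (dy f z) \<and> dx f z \<bullet> dy f z = 0 \<and>
        mean_curvature f z = 0)}"

text \<open>The metric is \<open>4 e^(2u) (dx^2 + dy^2)\<close>.\<close>

definition conf_u :: "(complex \<Rightarrow> real^3) \<Rightarrow> complex \<Rightarrow> real" where
  "conf_u f z = ln (norm (dx f z) / 2)"

definition f_z :: "(complex \<Rightarrow> real^3) \<Rightarrow> complex \<Rightarrow> complex^3" where
  "f_z f z = (\<chi> k. d_z (\<lambda>w. of_real (f w $ k)) z)"

definition hopf :: "(complex \<Rightarrow> real^3) \<Rightarrow> complex \<Rightarrow> complex" where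
  "hopf f z = (\<Sum>k\<in>UNIV. of_real (unit_normal f z $ k) * d_z (\<lambda>w. f_z f w $ k) z)"

text \<open>
  The coordinate frame at \<open>z\<close>, as a rotation of \<open>real^3\<close>: its columns are
  \<open>f_x / |f_x|\<close>, \<open>f_y / |f_y|\<close> and the normal. It is the image under \<open>Ad\<close> of the
  \<open>SU(2)\<close>-valued frame, which is determined by it up to sign.
  Passing from \<open>f\<close> to \<open>in_adapted_coords z0 f\<close> is the choice of coordinates for which the frame
  is the identity at \<open>z0\<close>.
\<close>

definition coord_frame :: "(complex \<Rightarrow> real^3) \<Rightarrow> complex \<Rightarrow> real^3^3" where
  "coord_frame f z = transpose (vector
     [dx f z /\<^sub>R norm (dx f z), dy f z /\<^sub>R norm (dy f z), unit_normal f z])"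

definition in_adapted_coords :: "complex \<Rightarrow> (complex \<Rightarrow> real^3) \<Rightarrow> complex \<Rightarrow> real^3" where
  "in_adapted_coords z0 f = (\<lambda>z. transpose (coord_frame f z0) *v f z)"

text \<open>
  Classical Weierstrass data, normalized at \<open>z0\<close>. The Gauss map \<open>\<nu>\<close> may have poles
  (where \<open>\<mu>\<close> vanishes), hence the formula for \<open>f_z\<close> is required off a discrete set. The
  integral representation of \<open>f\<close> follows, as \<open>f_z\<close> is by definition the
  \<open>z\<close>-derivative of \<open>f\<close>.
\<close>

definition weierstrass_data ::
  "complex set \<Rightarrow> complex \<Rightarrow> (complex \<Rightarrow> real^3) \<Rightarrow> (complex \<Rightarrow> complex) \<Rightarrow> (complex \<Rightarrow> complex) \<Rightarrow> bool" where
  "weierstrass_data S z0 f \<mu> \<nu> \<longleftrightarrow>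
     \<mu> holomorphic_on S \<and> \<nu> meromorphic_on S \<and> \<nu> analytic_on {z0} \<and>
     \<nu> z0 = 0 \<and> (\<exists>m::real. m > 0 \<and> \<mu> z0 = of_real m) \<and>
     (\<forall>\<^sub>\<approx>z\<in>S. f_z f z =
        vector [\<mu> z * (1 - (\<nu> z)\<^sup>2), - \<i> * \<mu> z * (1 + (\<nu> z)\<^sup>2), - 2 * \<mu> z * \<nu> z])"

section \<open>Extended frames and normalized potentials\<close>

definition mat_entrywise ::
  "((complex \<Rightarrow> complex) \<Rightarrow> complex \<Rightarrow> complex) \<Rightarrow> (complex \<Rightarrow> mat2) \<Rightarrow> complex \<Rightarrow> mat2" where
  "mat_entrywise D A z = (\<chi> i j. D (\<lambda>w. A w $ i $ j) z)"

text \<open>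
  The Maurer-Cartan form involves only the metric and the Hopf differential, so it is
  unaffected by the choice of coordinates of \<open>real^3\<close>.
\<close>

definition extended_frame ::
  "complex set \<Rightarrow> complex \<Rightarrow> (complex \<Rightarrow> real^3) \<Rightarrow> (complex \<Rightarrow> loop) \<Rightarrow> bool" where
  "extended_frame S z0 f F \<longleftrightarrow>
     (\<forall>z\<in>S. F z \<in> LG) \<and> F z0 = loop_one \<and>
     (\<forall>l\<in>circle. C1_on S (\<lambda>z. F z l) \<and> (\<forall>z\<in>S.
        let uz = d_z (\<lambda>w. of_real (conf_u f w)) z;
            uzbar = d_zbar (\<lambda>w. of_real (conf_u f w)) z;
            e = complex_of_real (exp (- conf_u f z)); Q = hopf f z
        in matrix_inv (F z l) ** mat_entrywise d_z (\<lambda>w. F w l) z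
             = mat22 (uz / 2) 0 (Q * e * inverse l / 2) (- uz / 2) \<and>
           matrix_inv (F z l) ** mat_entrywise d_zbar (\<lambda>w. F w l) z
             = mat22 (- uzbar / 2) (- cnj Q * e * l / 2) 0 (uzbar / 2)))"

text \<open>
  The function \<open>p\<close> of the normalized potential of a frame. The Birkhoff decomposition exists
  off a discrete set, at which \<open>p\<close> may have poles; \<open>nicely_meromorphic_on\<close> fixes the values there.
\<close>

definition frame_potential ::
  "complex set \<Rightarrow> (complex \<Rightarrow> loop) \<Rightarrow> (complex \<Rightarrow> complex) \<Rightarrow> bool" where
  "frame_potential S F p \<longleftrightarrow> p nicely_meromorphic_on S \<and>
     (\<exists>X \<Phi> G. X sparse_in S \<and>
        (\<forall>z\<in>S - X. \<Phi> z \<in> Lminus_star \<and> G z \<in> Lplus \<and> F z = loop_mult (\<Phi> z) (G z)) \<and>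
        (\<forall>l\<in>circle. mat_holomorphic_on (\<lambda>z. \<Phi> z l) (S - X)) \<and>
        (\<forall>z\<in>S - X. \<forall>l\<in>circle.
           matrix_inv (\<Phi> z l) ** mat_entrywise deriv (\<lambda>w. \<Phi> w l) z
             = mat22 0 0 (p z * inverse l) 0))"

definition normalized_potential ::
  "complex set \<Rightarrow> complex \<Rightarrow> (complex \<Rightarrow> real^3) \<Rightarrow> (complex \<Rightarrow> complex) \<Rightarrow> bool" where
  "normalized_potential S z0 f p \<longleftrightarrow> (\<exists>F. extended_frame S z0 f F \<and> frame_potential S F p)"

section \<open>Dressing\<close>

definition frame_dressing ::
  "complex set \<Rightarrow> loop \<Rightarrow> (complex \<Rightarrow> loop) \<Rightarrow> (complex \<Rightarrow> loop) \<Rightarrow> bool" where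
  "frame_dressing S h F F' \<longleftrightarrow>
     (\<forall>z\<in>S. F' z \<in> LG \<and> (\<exists>G\<in>LplusP. loop_mult h (F z) = loop_mult (F' z) G))"

text \<open>
  \<open>q\<close> is the result of dressing the normalized potential \<open>p\<close> by \<open>h\<close>. The frame \<open>F\<close> belongs to
  some minimal immersion with potential \<open>p\<close>; different choices give the same \<open>q\<close>.
\<close>

definition potential_dressing ::
  "complex set \<Rightarrow> complex \<Rightarrow> loop \<Rightarrow> (complex \<Rightarrow> complex) \<Rightarrow> (complex \<Rightarrow> complex) \<Rightarrow> bool" where
  "potential_dressing S z0 h p q \<longleftrightarrow>
     (\<exists>f F F'. f \<in> minimal_immersions S \<and> extended_frame S z0 f F \<and> frame_potential S F p \<and>
        frame_dressing S h F F' \<and> frame_potential S F' q)"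

text \<open>
  The induced relation between immersions \<open>f\<close> and \<open>g\<close>. With \<open>a = 2\<mu>\<close> and \<open>a' = 2\<mu>'\<close>, the system
  for \<open>W = (a0, b1 l; 0, 1/a0)\<close> is \<open>a0 = sqrt (a/a')\<close>, \<open>b1 = (a'/Q) (d a0/dz)\<close>, \<open>d b1/dz = 0\<close>,
  \<open>W(z0) = h^(-1)\<close>. The square root is rendered as a meromorphic function \<open>a0\<close> with \<open>a0^2 = a/a'\<close>,
  its sign being fixed by the value at \<open>z0\<close>, and the equation for \<open>b1\<close> is multiplied by \<open>Q\<close> so
  that it also makes sense for planes, where \<open>Q = 0\<close>. The integral defining \<open>\<nu>'\<close>
  is expressed through its derivative, together with \<open>\<nu>'(z0) = 0\<close> in \<open>weierstrass_data\<close>.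
\<close>

definition immersion_dressing ::
  "complex set \<Rightarrow> complex \<Rightarrow> loop \<Rightarrow> (complex \<Rightarrow> real^3) \<Rightarrow> (complex \<Rightarrow> real^3) \<Rightarrow> bool" where
  "immersion_dressing S z0 h f g \<longleftrightarrow>
     g z0 = f z0 \<and> coord_frame g z0 = coord_frame f z0 \<and> (\<forall>z\<in>S. hopf g z = hopf f z) \<and>
     (\<exists>\<mu> \<nu> \<mu>' \<nu>' a a' a0 b1.
        weierstrass_data S z0 (in_adapted_coords z0 f) \<mu> \<nu> \<and>
        weierstrass_data S z0 (in_adapted_coords z0 g) \<mu>' \<nu>' \<and>
        a = (\<lambda>z. 2 * \<mu> z) \<and> a' = (\<lambda>z. 2 * \<mu>' z) \<and>
        a0 meromorphic_on S \<and> a0 analytic_on {z0} \<and> b1 holomorphic_on S \<and>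
        (\<forall>\<^sub>\<approx>z\<in>S. (a0 z)\<^sup>2 = a z / a' z) \<and>
        (\<forall>\<^sub>\<approx>z\<in>S. b1 z * hopf f z = a' z * deriv a0 z) \<and>
        (\<forall>z\<in>S. deriv b1 z = 0) \<and>
        (\<forall>l\<in>circle. mat22 (a0 z0) (b1 z0 * l) 0 (inverse (a0 z0)) = matrix_inv (relevant_part h l)) \<and>
        (\<forall>\<^sub>\<approx>z\<in>S. deriv \<nu>' z = - hopf f z / a' z))"

definition dress :: "complex set \<Rightarrow> complex \<Rightarrow> loop \<Rightarrow> (complex \<Rightarrow> real^3) \<Rightarrow> complex \<Rightarrow> real^3" where
  "dress S z0 h = (\<lambda>f\<in>minimal_immersions S.
     THE g. g \<in> minimal_immersions S \<and> immersion_dressing S z0 h f g)"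

end

theory Submission
  imports Defs
begin

text \<open>
  A conformal minimal immersion \<open>f\<close> is the real part of a holomorphic isotropic curve, and on a
  simply connected domain \<open>f_z\<close> is quadratic in a pair \<open>(a, b)\<close> of holomorphic functions without
  common zeros: \<open>\<mu> = a\<^sup>2\<close> and \<open>\<nu> = b / a\<close>. In terms of this pair the extended frame is
  \<open>(a, cnj b l; - b / l, cnj a) / sqrt (|a|\<^sup>2 + |b|\<^sup>2)\<close>, and dressing by a loop with relevant part
  \<open>(r, \<beta> l; 0, 1 / r)\<close> is the linear map \<open>(a, b) \<mapsto> (r a - \<beta> b, b / r)\<close>. So the immersions,
  which the system for \<open>a0\<close> and \<open>b1\<close> determines uniquely, are acted on by the group of these
  matrices, and the Iwasawa decomposition of the dressed frame is explicit.
\<close>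

section \<open>Minimal immersions and holomorphic isotropic curves\<close>


text \<open>The Weierstrass pair itself transforms badly: dressing acts on \<open>\<nu>\<close> by a
  Moebius map, so its poles move, and with them the zeros of \<open>\<mu>\<close>. On
  \<open>(a, b)\<close> the action is linear of determinant 1. An invertible linear map creates no
  common zeros, so the dressed surface is immersed on all of \<open>S\<close>; determinant 1
  preserves the Wronskian \<open>b * deriv a - a * deriv b\<close>, which is half the Hopf
  differential. The price is a global square root of \<open>\<mu>\<close>. The sign of
  \<open>\<beta>\<close> in the linear map is harmless: passing from
  \<open>(r, \<beta>; 0, 1 / r)\<close> to \<open>(r, - \<beta>; 0, 1 / r)\<close> is conjugation by
  \<open>diag (1, -1)\<close>, hence multiplicative. The system is imposed only off sparse sets.
  Continuity extends its consequences to all of \<open>S\<close>, which makes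
  \<open>immersion_dressing\<close> a function and gives the description in \<open>dress\<close> a
  meaning. Potentials enter only through frames: a frame of a given immersion is unique, so an
  arbitrary one may be replaced by the explicit one.\<close>

lemma has_derivative_vec_lambda:
  fixes f :: "'a::real_normed_vector \<Rightarrow> 'n::finite \<Rightarrow> 'b::real_normed_vector"
  assumes "\<And>k. ((\<lambda>x. f x k) has_derivative D k) F"
  shows "((\<lambda>x. \<chi> k. f x k) has_derivative (\<lambda>h. \<chi> k. D k h)) F"
proof -
  have axis: "bounded_linear (axis k :: 'b \<Rightarrow> 'b^'n)" for k :: 'n
  proof (rule bounded_linear_intro[where K = 1])
    fix x :: 'b
    have "norm (axis k x) \<le> (\<Sum>i\<in>UNIV. norm (axis k x $ i))"
      unfolding norm_vec_def by (rule L2_set_le_sum) simp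
    also have "\<dots> = (\<Sum>i\<in>UNIV. if i = k then norm x else 0)"
      by (intro sum.cong) (auto simp: axis_def)
    finally show "norm (axis k x) \<le> norm x * 1" by simp
  qed (auto simp: vec_eq_iff axis_def)
  have eq: "(\<Sum>k\<in>UNIV. axis k (g k)) = (\<chi> k. g k)" for g :: "'n \<Rightarrow> 'b"
    by (simp add: vec_eq_iff axis_def if_distrib cong: if_cong)
  have "((\<lambda>x. \<Sum>k\<in>UNIV. axis k (f x k)) has_derivative (\<lambda>h. \<Sum>k\<in>UNIV. axis k (D k h))) F"
    by (intro has_derivative_sum bounded_linear.has_derivative[OF axis] assms)
  then show ?thesis by (simp add: eq)
qed

lemma dx_dy_if_has_derivative:
  assumes "(f has_derivative D) (at z)"
  shows "dx f z = D 1" "dy f z = D \<i>"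
proof -
  interpret D: bounded_linear D using assms by (rule has_derivative_bounded_linear)
  have "((\<lambda>t::real. f (z + c * of_real t)) has_vector_derivative D c) (at 0)" for c
  proof -
    have "((\<lambda>t::real. z + c * of_real t) has_derivative (\<lambda>t. c * of_real t)) (at 0)"
      by (auto intro!: derivative_eq_intros)
    from has_derivative_compose[OF this, of f D] assms
    have "((\<lambda>t::real. f (z + c * of_real t)) has_derivative (\<lambda>t. D (c * of_real t))) (at 0)"
      by simp
    moreover have "D (c * of_real t) = t *\<^sub>R D c" for t
      by (metis D.scaleR mult.commute scaleR_conv_of_real)
    ultimately show ?thesis by (simp add: has_vector_derivative_def)
  qed
  from this[of 1] this[of \<i>] show "dx f z = D 1" "dy f z = D \<i>"
    by (simp_all add: dx_def dy_def vector_derivative_at)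
qed

lemma has_derivative_dx_dy:
  assumes "f differentiable (at z)"
  shows "(f has_derivative (\<lambda>h. Re h *\<^sub>R dx f z + Im h *\<^sub>R dy f z)) (at z)"
proof -
  obtain D where D: "(f has_derivative D) (at z)" using assms by (auto simp: differentiable_def)
  interpret D: bounded_linear D using D by (rule has_derivative_bounded_linear)
  have "D h = Re h *\<^sub>R dx f z + Im h *\<^sub>R dy f z" for h
  proof -
    have "h = Re h *\<^sub>R 1 + Im h *\<^sub>R \<i>" by (simp add: complex_eq_iff)
    from arg_cong[OF this, of D] have "D h = Re h *\<^sub>R D 1 + Im h *\<^sub>R D \<i>"
      by (simp only: D.add D.scaleR)
    then show ?thesis using dx_dy_if_has_derivative[OF D] by simp
  qed
  then have "D = (\<lambda>h. Re h *\<^sub>R dx f z + Im h *\<^sub>R dy f z)" by (rule ext)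
  then show ?thesis using D by simp
qed

lemma dx_dy_linear_comp:
  assumes "f differentiable (at z)" "bounded_linear L"
  shows "dx (\<lambda>w. L (f w)) z = L (dx f z)" "dy (\<lambda>w. L (f w)) z = L (dy f z)"
proof -
  interpret bounded_linear L by fact
  show "dx (\<lambda>w. L (f w)) z = L (dx f z)" "dy (\<lambda>w. L (f w)) z = L (dy f z)"
    using dx_dy_if_has_derivative[OF has_derivative[OF has_derivative_dx_dy[OF assms(1)]]]
    by (simp_all add: add scaleR zero)
qed

text \<open>Immersions are extensional and most formulas hold only on \<open>S\<close>. The partial
  derivatives see only values on short segments through \<open>z\<close>, and these stay in the open
  set \<open>S\<close>.\<close>

lemma dx_dy_cong:
  assumes "open S" "z \<in> S" "\<And>w. w \<in> S \<Longrightarrow> f w = g w"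
  shows "dx f z = dx g z" "dy f z = dy g z"
proof -
  have *: "\<forall>\<^sub>F t in nhds (0::real). f (z + c * of_real t) = g (z + c * of_real t)" for c
  proof -
    have "((\<lambda>t::real. z + c * of_real t) \<longlongrightarrow> z + c * of_real 0) (nhds 0)"
      by (rule filterlim_compose[OF _ filterlim_ident, of "\<lambda>t. z + c * of_real t"])
         (intro tendsto_intros filterlim_ident)
    then have "\<forall>\<^sub>F t in nhds (0::real). z + c * of_real t \<in> S"
      using assms(1,2) by (auto elim!: topological_tendstoD)
    then show ?thesis by eventually_elim (use assms(3) in auto)
  qed
  show "dx f z = dx g z" "dy f z = dy g z"
    unfolding dx_def dy_def
    using *[of 1] *[of \<i>] by (auto intro!: vector_derivative_cong_eq elim: eventually_mono)
qed

lemma d_z_cong: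
  assumes "open S" "z \<in> S" "\<And>w. w \<in> S \<Longrightarrow> f w = g w"
  shows "d_z f z = d_z g z" "d_zbar f z = d_zbar g z"
  unfolding d_z_def d_zbar_def using dx_dy_cong[OF assms] by auto

lemma dx_dy_if_has_field_derivative:
  assumes "(f has_field_derivative c) (at z)"
  shows "dx f z = c" "dy f z = \<i> * c"
  using dx_dy_if_has_derivative[OF assms[unfolded has_field_derivative_def]] by simp_all

lemma d_z_if_has_field_derivative:
  assumes "(f has_field_derivative c) (at z)"
  shows "d_z f z = c" "d_zbar f z = 0"
  using dx_dy_if_has_field_derivative[OF assms] by (simp_all add: d_z_def d_zbar_def field_simps)

text \<open>Both orders of differentiation approximate the same second difference.\<close>

lemma second_difference_estimate:
  fixes f :: "'a::real_normed_vector \<Rightarrow> real"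
  assumes "open S" "z \<in> S" and F: "\<And>w. w \<in> S \<Longrightarrow> (f has_derivative F w) (at w)"
    and P: "((\<lambda>w. F w u) has_derivative P) (at z)" and "\<epsilon> > 0"
  shows "\<exists>\<delta>>0. \<forall>t. 0 < t \<and> t < \<delta> \<longrightarrow>
    \<bar>f (z + t *\<^sub>R u + t *\<^sub>R v) - f (z + t *\<^sub>R u) - f (z + t *\<^sub>R v) + f z - t\<^sup>2 * P v\<bar> \<le> \<epsilon> * t\<^sup>2"
proof -
  interpret P: bounded_linear P using P by (rule has_derivative_bounded_linear)
  obtain r where r: "r > 0" "ball z r \<subseteq> S" using assms(1,2) openE by blast
  \<comment> \<open>The summand 1 keeps \<open>C\<close> positive when \<open>u\<close> and
    \<open>v\<close> both vanish; \<open>t * C\<close> bounds every displacement from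
    \<open>z\<close> that occurs below.\<close>
  define C where "C = norm u + norm v + 1"
  have C: "C > 0" unfolding C_def by (simp add: add_nonneg_pos)
  have "\<epsilon> / (2 * C) > 0" using \<open>\<epsilon> > 0\<close> C by simp
  then obtain d where d: "d > 0" and
    est: "\<And>y. norm (y - z) < d \<Longrightarrow> norm (F y u - F z u - P (y - z)) \<le> \<epsilon> / (2 * C) * norm (y - z)"
    using P unfolding has_derivative_at_alt by blast
  show ?thesis
  proof (intro exI[of _ "min r d / C"] conjI allI impI)
    show "min r d / C > 0" using r d C by simp
    fix t assume t: "0 < t \<and> t < min r d / C"
    have small: "norm (s *\<^sub>R u + s' *\<^sub>R v) \<le> t * C" if "0 \<le> s" "s \<le> t" "0 \<le> s'" "s' \<le> t" for s s'
    proof -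
      have "norm (s *\<^sub>R u + s' *\<^sub>R v) \<le> s * norm u + s' * norm v"
        using that norm_triangle_ineq[of "s *\<^sub>R u" "s' *\<^sub>R v"] by simp
      also have "\<dots> \<le> t * norm u + t * norm v"
        using that by (intro add_mono mult_right_mono) auto
      also have "\<dots> \<le> t * C" using t by (simp add: C_def algebra_simps)
      finally show ?thesis .
    qed
    have tC: "t * C < min r d" using t C by (simp add: field_simps)
    \<comment> \<open>The second difference is \<open>g t - g 0\<close>. The mean value theorem in
      direction \<open>u\<close> turns it into \<open>t\<close> times a difference of two first
      derivatives, to which the differentiability of \<open>F _ u\<close> at \<open>z\<close>
      applies.\<close>
    define g where "g s = f (z + s *\<^sub>R u + t *\<^sub>R v) - f (z + s *\<^sub>R u)" for s
    define g' where "g' s = F (z + s *\<^sub>R u + t *\<^sub>R v) u - F (z + s *\<^sub>R u) u" for s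
    have "(g has_real_derivative g' s) (at s)" if s: "0 \<le> s" "s \<le> t" for s
    proof -
      have D: "((\<lambda>s. f (z + s *\<^sub>R u + s' *\<^sub>R v)) has_real_derivative F (z + s *\<^sub>R u + s' *\<^sub>R v) u) (at s)"
        if "0 \<le> s'" "s' \<le> t" for s'
      proof -
        have "z + s *\<^sub>R u + s' *\<^sub>R v \<in> ball z r"
          using small[OF s that] tC norm_minus_cancel[of "s *\<^sub>R u + s' *\<^sub>R v"]
          by (simp add: dist_norm add.assoc del: norm_minus_cancel)
        then have in_S: "z + s *\<^sub>R u + s' *\<^sub>R v \<in> S" using r by auto
        have "((\<lambda>s. z + s *\<^sub>R u + s' *\<^sub>R v) has_derivative (\<lambda>h. h *\<^sub>R u)) (at s)"
          by (auto intro!: derivative_eq_intros)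
        from has_derivative_compose[OF this F[OF in_S]]
        have "((\<lambda>s. f (z + s *\<^sub>R u + s' *\<^sub>R v)) has_derivative
                (\<lambda>h. F (z + s *\<^sub>R u + s' *\<^sub>R v) (h *\<^sub>R u))) (at s)" .
        moreover have "F (z + s *\<^sub>R u + s' *\<^sub>R v) (h *\<^sub>R u) = h * F (z + s *\<^sub>R u + s' *\<^sub>R v) u" for h
          using linear_scale[OF has_derivative_linear[OF F[OF in_S]]] by simp
        ultimately show ?thesis
          by (simp add: has_field_derivative_def mult.commute[of _ "F _ _"])
      qed
      show ?thesis
        unfolding g_def[abs_def] g'_def using D[of t] D[of 0] t
        by (auto intro!: derivative_eq_intros)
    qed
    with t obtain \<xi> where \<xi>: "0 < \<xi>" "\<xi> < t" "g t - g 0 = t * g' \<xi>"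
      using MVT2[of 0 t g g'] by auto
    define E1 where "E1 = F (z + \<xi> *\<^sub>R u + t *\<^sub>R v) u - F z u - P (\<xi> *\<^sub>R u + t *\<^sub>R v)"
    define E2 where "E2 = F (z + \<xi> *\<^sub>R u) u - F z u - P (\<xi> *\<^sub>R u)"
    have s1: "norm (\<xi> *\<^sub>R u + t *\<^sub>R v) \<le> t * C" using small[of \<xi> t] \<xi> by simp
    have s2: "norm (\<xi> *\<^sub>R u) \<le> t * C" using small[of \<xi> 0] \<xi> by simp
    have "\<bar>E1\<bar> \<le> \<epsilon> / (2 * C) * norm (\<xi> *\<^sub>R u + t *\<^sub>R v)"
      unfolding E1_def using est[of "z + \<xi> *\<^sub>R u + t *\<^sub>R v"] s1 tC by (simp add: add.assoc)
    also have "\<dots> \<le> \<epsilon> / (2 * C) * (t * C)"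
      using s1 \<open>\<epsilon> / (2 * C) > 0\<close> by (intro mult_left_mono) auto
    finally have E1: "\<bar>E1\<bar> \<le> \<epsilon> * t / 2" using C by (simp add: field_simps)
    have "\<bar>E2\<bar> \<le> \<epsilon> / (2 * C) * norm (\<xi> *\<^sub>R u)"
      unfolding E2_def using est[of "z + \<xi> *\<^sub>R u"] s2 tC by simp
    also have "\<dots> \<le> \<epsilon> / (2 * C) * (t * C)"
      using s2 \<open>\<epsilon> / (2 * C) > 0\<close> by (intro mult_left_mono) auto
    finally have E2: "\<bar>E2\<bar> \<le> \<epsilon> * t / 2" using C by (simp add: field_simps)
    \<comment> \<open>The unknown point \<open>\<xi>\<close> survives only in the error terms,
      because the two contributions \<open>P (\<xi> *\<^sub>R u)\<close> cancel.\<close>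
    have g': "g' \<xi> = t * P v + E1 - E2"
      unfolding g'_def E1_def E2_def by (simp add: P.add P.scaleR)
    have "g t - g 0 - t\<^sup>2 * P v = t * (E1 - E2)"
      unfolding \<xi>(3) g' by (simp add: power2_eq_square algebra_simps)
    moreover have "\<bar>E1 - E2\<bar> \<le> \<epsilon> * t" using E1 E2 by linarith
    then have "\<bar>t * (E1 - E2)\<bar> \<le> \<epsilon> * t\<^sup>2"
      using t by (simp add: abs_mult power2_eq_square mult.commute mult.left_commute)
    ultimately show "\<bar>f (z + t *\<^sub>R u + t *\<^sub>R v) - f (z + t *\<^sub>R u) - f (z + t *\<^sub>R v) + f z - t\<^sup>2 * P v\<bar> \<le> \<epsilon> * t\<^sup>2"
      by (simp add: g_def algebra_simps)
  qed
qed

lemma second_derivative_symmetric: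
  fixes f :: "'a::real_normed_vector \<Rightarrow> real"
  assumes "open S" "z \<in> S" and F: "\<And>w. w \<in> S \<Longrightarrow> (f has_derivative F w) (at w)"
    and P: "((\<lambda>w. F w u) has_derivative P) (at z)" and Q: "((\<lambda>w. F w v) has_derivative Q) (at z)"
  shows "P v = Q u"
proof (rule ccontr)
  assume ne: "P v \<noteq> Q u"
  \<comment> \<open>A third of the gap: the two estimates together leave room for at most two thirds
    of it.\<close>
  define \<epsilon> where "\<epsilon> = \<bar>P v - Q u\<bar> / 3"
  have \<epsilon>: "\<epsilon> > 0" using ne by (simp add: \<epsilon>_def)
  obtain \<delta>1 where 1: "\<delta>1 > 0" "\<And>t. 0 < t \<and> t < \<delta>1 \<Longrightarrow>
    \<bar>f (z + t *\<^sub>R u + t *\<^sub>R v) - f (z + t *\<^sub>R u) - f (z + t *\<^sub>R v) + f z - t\<^sup>2 * P v\<bar> \<le> \<epsilon> * t\<^sup>2"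
    using second_difference_estimate[OF assms(1,2) F P \<epsilon>] by blast
  obtain \<delta>2 where 2: "\<delta>2 > 0" "\<And>t. 0 < t \<and> t < \<delta>2 \<Longrightarrow>
    \<bar>f (z + t *\<^sub>R v + t *\<^sub>R u) - f (z + t *\<^sub>R v) - f (z + t *\<^sub>R u) + f z - t\<^sup>2 * Q u\<bar> \<le> \<epsilon> * t\<^sup>2"
    using second_difference_estimate[OF assms(1,2) F Q \<epsilon>] by blast
  define t where "t = min \<delta>1 \<delta>2 / 2"
  have t: "0 < t" "t < \<delta>1" "t < \<delta>2" using 1(1) 2(1) by (auto simp: t_def)
  have "z + t *\<^sub>R v + t *\<^sub>R u = z + t *\<^sub>R u + t *\<^sub>R v" by simp
  then have "\<bar>t\<^sup>2 * P v - t\<^sup>2 * Q u\<bar> \<le> 2 * (\<epsilon> * t\<^sup>2)"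
    using 1(2)[of t] 2(2)[of t] t unfolding \<open>z + t *\<^sub>R v + t *\<^sub>R u = _\<close> by linarith
  then have "t\<^sup>2 * \<bar>P v - Q u\<bar> \<le> t\<^sup>2 * (2 * \<epsilon>)"
    unfolding right_diff_distrib[symmetric] by (simp add: abs_mult ac_simps)
  then have "\<bar>P v - Q u\<bar> \<le> 2 * \<epsilon>" using t by simp
  then show False using ne by (simp add: \<epsilon>_def)
qed

lemma dx_dy_commute:
  fixes f :: "complex \<Rightarrow> real^'n"
  assumes "open S" "z \<in> S" "C2_on S f"
  shows "dx (dy f) z = dy (dx f) z"
proof -
  have diff: "f differentiable (at w)" "dx f differentiable (at w)" "dy f differentiable (at w)"
    if "w \<in> S" for w using assms(3) that by (auto simp: C2_on_def C1_on_def)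
  have "dx (dy f) z $ k = dy (dx f) z $ k" for k
  proof -
    note D = has_derivative_dx_dy[THEN bounded_linear.has_derivative[OF bounded_linear_vec_nth[of k]]]
    have "(\<lambda>h. (Re h *\<^sub>R dx (dx f) z + Im h *\<^sub>R dy (dx f) z) $ k) \<i>
        = (\<lambda>h. (Re h *\<^sub>R dx (dy f) z + Im h *\<^sub>R dy (dy f) z) $ k) 1"
      using D[OF diff(1)] D[OF diff(2)[OF assms(2)]] D[OF diff(3)[OF assms(2)]]
      by (intro second_derivative_symmetric[OF assms(1,2), where f = "\<lambda>w. f w $ k" and
          F = "\<lambda>w h. (Re h *\<^sub>R dx f w + Im h *\<^sub>R dy f w) $ k"]) auto
    then show ?thesis by simp
  qed
  then show ?thesis by (simp add: vec_eq_iff)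
qed

lemma f_z_nth:
  assumes "f differentiable (at z)"
  shows "f_z f z $ k = (of_real (dx f z $ k) - \<i> * of_real (dy f z $ k)) / 2"
proof -
  have "bounded_linear (\<lambda>v::real^3. complex_of_real (v $ k))"
    by (intro bounded_linear_compose[OF bounded_linear_of_real] bounded_linear_vec_nth)
  from dx_dy_linear_comp[OF assms this] show ?thesis
    by (simp add: f_z_def d_z_def)
qed

lemma dx_dy_eq_f_z:
  assumes "f differentiable (at z)"
  shows "dx f z = (\<chi> k. 2 * Re (f_z f z $ k))" "dy f z = (\<chi> k. - 2 * Im (f_z f z $ k))"
  by (simp_all add: f_z_nth[OF assms] vec_eq_iff)

text \<open>Orthogonality to \<open>a\<close> and \<open>b\<close> makes the Lagrange expansion of
  \<open>cross3 v (cross3 a b)\<close> vanish, so \<open>v\<close> is parallel to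
  \<open>cross3 a b\<close>, to which it is also orthogonal.\<close>

lemma cross_eq_0_orthogonal:
  fixes a b v :: "real^3"
  assumes "v \<bullet> a = 0" "v \<bullet> b = 0" "v \<bullet> (cross3 a b) = 0" "cross3 a b \<noteq> 0"
  shows "v = 0"
proof -
  have "cross3 v (cross3 a b) = (v \<bullet> b) *\<^sub>R a - (v \<bullet> a) *\<^sub>R b"
    by (rule Lagrange)
  then show ?thesis using assms norm_and_cross_eq_0[of v "cross3 a b"] by simp
qed

lemma cross_orthogonal_norm:
  fixes a b :: "real^3"
  assumes "a \<bullet> b = 0"
  shows "norm (cross3 a b) = norm a * norm b"
  using norm_cross_dot[of a b] assms by (simp add: power2_eq_iff_nonneg)

section \<open>Conformality and minimality as isotropy and holomorphy of the complex
  derivative\<close>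

context
  fixes S :: "complex set" and f :: "complex \<Rightarrow> real^3"
  assumes S: "open S" and f: "f \<in> minimal_immersions S"
begin

lemma minimal_differentiable:
  assumes "z \<in> S"
  shows "f differentiable (at z)" "dx f differentiable (at z)" "dy f differentiable (at z)"
  using f assms by (auto simp: minimal_immersions_def C2_on_def C1_on_def)

lemma minimal_conformal:
  assumes "z \<in> S"
  shows "dx f z \<bullet> dx f z = dy f z \<bullet> dy f z" "dx f z \<bullet> dy f z = 0" "dx f z \<noteq> 0"
proof -
  show "dx f z \<bullet> dx f z = dy f z \<bullet> dy f z" "dx f z \<bullet> dy f z = 0"
    using f assms by (auto simp: minimal_immersions_def dot_square_norm)
  have "frechet_derivative f (at z) = (\<lambda>h. Re h *\<^sub>R dx f z + Im h *\<^sub>R dy f z)"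
    by (rule frechet_derivative_at[OF has_derivative_dx_dy[OF minimal_differentiable(1)[OF assms]], symmetric])
  moreover have "inj (frechet_derivative f (at z))"
    using f assms by (auto simp: minimal_immersions_def)
  ultimately have "Re 1 *\<^sub>R dx f z + Im 1 *\<^sub>R dy f z \<noteq> Re 0 *\<^sub>R dx f z + Im 0 *\<^sub>R dy f z"
    by (auto dest: injD[where x = 1 and y = 0])
  then show "dx f z \<noteq> 0" by auto
qed

text \<open>Differentiating the two conformality equations shows that the Laplacian of
  \<open>f\<close> is orthogonal to both tangent vectors; vanishing mean curvature says that it is
  orthogonal to the normal as well.\<close>

lemma minimal_harmonic:
  assumes z: "z \<in> S"
  shows "dx (dx f) z + dy (dy f) z = 0"
proof -
  define A B where "A = dx f z" and "B = dy f z"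
  define Ax Ay Bx By where "Ax = dx (dx f) z" "Ay = dy (dx f) z" "Bx = dx (dy f) z" "By = dy (dy f) z"
  note defs = A_def B_def Ax_Ay_Bx_By_def
  have A: "(dx f has_derivative (\<lambda>h. Re h *\<^sub>R Ax + Im h *\<^sub>R Ay)) (at z)"
   and B: "(dy f has_derivative (\<lambda>h. Re h *\<^sub>R Bx + Im h *\<^sub>R By)) (at z)"
    using minimal_differentiable[OF z] unfolding defs by (auto intro: has_derivative_dx_dy)
  have zero: "D = (\<lambda>_. 0)" if "(g has_derivative D) (at z)" "\<And>w. w \<in> S \<Longrightarrow> g w = 0"
    for g :: "complex \<Rightarrow> real" and D
  proof (rule has_derivative_unique[OF that(1)])
    show "(g has_derivative (\<lambda>_. 0)) (at z)"
      by (rule has_derivative_transform_within_open[OF has_derivative_const[of 0] S z]) (use that in auto)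
  qed
  have "(\<lambda>h. 2 * (A \<bullet> (Re h *\<^sub>R Ax + Im h *\<^sub>R Ay)) - 2 * (B \<bullet> (Re h *\<^sub>R Bx + Im h *\<^sub>R By))) = (\<lambda>_. 0)"
    by (rule zero[where g = "\<lambda>w. dx f w \<bullet> dx f w - dy f w \<bullet> dy f w"])
       (use A B minimal_conformal in \<open>auto intro!: derivative_eq_intros simp: defs inner_commute\<close>)
  from fun_cong[OF this, of 1] fun_cong[OF this, of \<i>]
  have 1: "A \<bullet> Ax = B \<bullet> Bx" "A \<bullet> Ay = B \<bullet> By" by simp_all
  have "(\<lambda>h. A \<bullet> (Re h *\<^sub>R Bx + Im h *\<^sub>R By) + (Re h *\<^sub>R Ax + Im h *\<^sub>R Ay) \<bullet> B) = (\<lambda>_. 0)"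
    by (rule zero[where g = "\<lambda>w. dx f w \<bullet> dy f w"])
       (use A B minimal_conformal in \<open>auto intro!: derivative_eq_intros simp: defs\<close>)
  from fun_cong[OF this, of 1] fun_cong[OF this, of \<i>]
  have 2: "A \<bullet> Bx + Ax \<bullet> B = 0" "A \<bullet> By + Ay \<bullet> B = 0" by simp_all
  have "C2_on S f" using f by (auto simp: minimal_immersions_def)
  \<comment> \<open>Equality of the mixed partials is what lets the terms coming from the two
    conformality equations cancel against each other.\<close>
  from dx_dy_commute[OF S z this] have comm: "Bx = Ay" by (simp add: defs)
  have AB: "A \<bullet> A = B \<bullet> B" "A \<bullet> B = 0" "A \<noteq> 0"
    using minimal_conformal[OF z] by (simp_all add: defs)
  then have "B \<noteq> 0" by auto
  have cr: "norm (cross3 A B) = norm A * norm B" using AB(2) by (rule cross_orthogonal_norm)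
  with AB \<open>B \<noteq> 0\<close> have cr0: "cross3 A B \<noteq> 0" by force
  have "mean_curvature f z = 0" using f z by (auto simp: minimal_immersions_def)
  \<comment> \<open>In conformal coordinates \<open>E = G\<close> and \<open>F = 0\<close>, so the
    numerator of the mean curvature is \<open>E * (L + N)\<close>.\<close>
  then have "(B \<bullet> B) * (By \<bullet> unit_normal f z + Ax \<bullet> unit_normal f z) = 0"
    using AB \<open>B \<noteq> 0\<close> by (simp add: mean_curvature_def Let_def distrib_left flip: defs)
  then have "By \<bullet> unit_normal f z + Ax \<bullet> unit_normal f z = 0" using \<open>B \<noteq> 0\<close> by simp
  then have "inverse (norm (cross3 A B)) * ((Ax + By) \<bullet> cross3 A B) = 0"
    by (simp add: unit_normal_def Let_def inner_add_left distrib_left add.commute flip: defs)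
  then have "(Ax + By) \<bullet> cross3 A B = 0" using cr0 by simp
  moreover have "(Ax + By) \<bullet> A = 0" "(Ax + By) \<bullet> B = 0"
    using 1 2 comm by (simp_all add: inner_add_left inner_add_right inner_commute)
  ultimately have "Ax + By = 0" using cr0 cross_eq_0_orthogonal by blast
  then show ?thesis by (simp add: defs)
qed

text \<open>The Cauchy-Riemann equations for \<open>f_z\<close> are harmonicity of \<open>f\<close>
  together with the symmetry of its second derivatives.\<close>

lemma f_z_minimal_holomorphic: "(\<lambda>z. f_z f z $ k) holomorphic_on S"
  unfolding holomorphic_on_open[OF S]
proof
  fix z assume z: "z \<in> S"
  define Ax Ay By where "Ax = dx (dx f) z $ k" "Ay = dy (dx f) z $ k" "By = dy (dy f) z $ k"
  note defs = Ax_Ay_By_def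
  have "C2_on S f" using f by (simp add: minimal_immersions_def)
  from dx_dy_commute[OF S z this] have comm: "dx (dy f) z $ k = Ay"
    by (simp add: defs)
  have "((\<lambda>w. dx f w $ k) has_derivative (\<lambda>h. Re h * Ax + Im h * Ay)) (at z)"
    using bounded_linear.has_derivative[OF bounded_linear_vec_nth[of k]
      has_derivative_dx_dy[OF minimal_differentiable(2)[OF z]]] by (simp add: defs)
  moreover have "((\<lambda>w. dy f w $ k) has_derivative (\<lambda>h. Re h * Ay + Im h * By)) (at z)"
    using bounded_linear.has_derivative[OF bounded_linear_vec_nth[of k]
      has_derivative_dx_dy[OF minimal_differentiable(3)[OF z]]] by (simp add: defs comm[unfolded defs])
  ultimately have "((\<lambda>w. (complex_of_real (dx f w $ k) - \<i> * of_real (dy f w $ k)) / 2) has_derivative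
      (\<lambda>h. (of_real (Re h * Ax + Im h * Ay) - \<i> * of_real (Re h * Ay + Im h * By)) / 2)) (at z)"
    by (auto intro!: derivative_eq_intros)
  then have "((\<lambda>w. f_z f w $ k) has_derivative
      (\<lambda>h. (of_real (Re h * Ax + Im h * Ay) - \<i> * of_real (Re h * Ay + Im h * By)) / 2)) (at z)"
    by (rule has_derivative_transform_within_open[OF _ S z]) (simp add: f_z_nth minimal_differentiable)
  moreover have "Ax + By = 0"
    using minimal_harmonic[OF z] by (metis defs(1,3) vector_add_component zero_index)
  then have "By = - Ax" by simp
  \<comment> \<open>With \<open>By = - Ax\<close> the real-linear derivative becomes multiplication
    by one complex number.\<close>
  then have "(\<lambda>h. (of_real (Re h * Ax + Im h * Ay) - \<i> * of_real (Re h * Ay + Im h * By)) / 2)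
      = (*) ((of_real Ax - \<i> * of_real Ay) / 2)"
    by (intro ext) (simp add: complex_eq_iff algebra_simps)
  ultimately show "\<exists>f'. ((\<lambda>z. f_z f z $ k) has_field_derivative f') (at z)"
    unfolding has_field_derivative_def by auto
qed

text \<open>The real and imaginary parts of the bilinear square of \<open>f_z\<close> are
  \<open>(|f_x|^2 - |f_y|^2) / 4\<close> and \<open>- f_x \<bullet> f_y / 2\<close>, so isotropy is
  conformality.\<close>

lemma f_z_minimal_isotropic:
  assumes z: "z \<in> S"
  shows "(\<Sum>k\<in>UNIV. (f_z f z $ k)\<^sup>2) = 0" "f_z f z \<noteq> 0"
proof -
  have "dx f z $ 1 ^ 2 + dx f z $ 2 ^ 2 + dx f z $ 3 ^ 2 = dy f z $ 1 ^ 2 + dy f z $ 2 ^ 2 + dy f z $ 3 ^ 2"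
    "dx f z $ 1 * dy f z $ 1 + dx f z $ 2 * dy f z $ 2 + dx f z $ 3 * dy f z $ 3 = 0"
    using minimal_conformal(1,2)[OF z] by (simp_all add: inner_vec_def sum_3 power2_eq_square)
  then show "(\<Sum>k\<in>UNIV. (f_z f z $ k)\<^sup>2) = 0"
    by (simp add: sum_3 f_z_nth[OF minimal_differentiable(1)[OF z]] complex_eq_iff
        power2_eq_square field_simps)
  show "f_z f z \<noteq> 0"
  proof
    assume "f_z f z = 0"
    then have "dx f z = 0"
      using dx_dy_eq_f_z(1)[OF minimal_differentiable(1)[OF z]] by (simp add: vec_eq_iff)
    then show False using minimal_conformal(3)[OF z] by simp
  qed
qed

end

text \<open>All second derivatives of \<open>f\<close> are real or imaginary parts of the derivative
  of the holomorphic \<open>f_z\<close>, which gives their continuity and the cancellation of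
  \<open>f_xx\<close> against \<open>f_yy\<close>. Isotropy and nonvanishing of \<open>f_z\<close>
  supply conformality and injectivity of the differential.\<close>

lemma minimal_immersionI:
  assumes S: "open S" and ext: "f \<in> extensional S"
    and diff: "\<And>z. z \<in> S \<Longrightarrow> f differentiable (at z)"
    and hol: "\<And>k. (\<lambda>z. f_z f z $ k) holomorphic_on S"
    and iso: "\<And>z. z \<in> S \<Longrightarrow> (\<Sum>k\<in>UNIV. (f_z f z $ k)\<^sup>2) = 0"
    and nz: "\<And>z. z \<in> S \<Longrightarrow> f_z f z \<noteq> 0"
  shows "f \<in> minimal_immersions S"
proof -
  define \<phi> where "\<phi> = f_z f"
  define \<phi>' where "\<phi>' z k = deriv (\<lambda>w. \<phi> w $ k) z" for z k
  have D\<phi>: "((\<lambda>w. \<phi> w $ k) has_field_derivative \<phi>' z k) (at z)" if "z \<in> S" for z k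
    using hol that S unfolding \<phi>_def \<phi>'_def by (auto intro: holomorphic_derivI)
  have dx: "dx f z = (\<chi> k. 2 * Re (\<phi> z $ k))" and dy: "dy f z = (\<chi> k. - 2 * Im (\<phi> z $ k))" if "z \<in> S" for z
    using dx_dy_eq_f_z[OF diff[OF that]] by (simp_all add: \<phi>_def)
  have D: "(dx f has_derivative (\<lambda>h. \<chi> k. 2 * Re (\<phi>' z k * h))) (at z)"
          "(dy f has_derivative (\<lambda>h. \<chi> k. - 2 * Im (\<phi>' z k * h))) (at z)" if z: "z \<in> S" for z
  proof -
    have *: "((\<lambda>w. \<phi> w $ k) has_derivative (\<lambda>h. \<phi>' z k * h)) (at z)" for k
      using D\<phi>[OF z] by (simp add: has_field_derivative_def)
    have "((\<lambda>w. \<chi> k. 2 * Re (\<phi> w $ k)) has_derivative (\<lambda>h. \<chi> k. 2 * Re (\<phi>' z k * h))) (at z)"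
         "((\<lambda>w. \<chi> k. - 2 * Im (\<phi> w $ k)) has_derivative (\<lambda>h. \<chi> k. - 2 * Im (\<phi>' z k * h))) (at z)"
      by (intro has_derivative_vec_lambda has_derivative_mult_right has_derivative_Re has_derivative_Im *)+
    then show "(dx f has_derivative (\<lambda>h. \<chi> k. 2 * Re (\<phi>' z k * h))) (at z)"
          "(dy f has_derivative (\<lambda>h. \<chi> k. - 2 * Im (\<phi>' z k * h))) (at z)"
      by - (rule has_derivative_transform_within_open[OF _ S z], assumption, simp add: dx dy)+
  qed
  have D2: "dx (dx f) z = (\<chi> k. 2 * Re (\<phi>' z k))" "dy (dx f) z = (\<chi> k. - 2 * Im (\<phi>' z k))"
    "dx (dy f) z = (\<chi> k. - 2 * Im (\<phi>' z k))" "dy (dy f) z = (\<chi> k. - 2 * Re (\<phi>' z k))" if "z \<in> S" for z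
    using dx_dy_if_has_derivative[OF D(1)[OF that]] dx_dy_if_has_derivative[OF D(2)[OF that]] by simp_all
  have cont: "continuous_on S (\<lambda>z. \<phi> z $ k)" "continuous_on S (\<lambda>z. \<phi>' z k)" for k
    using hol[of k] S unfolding \<phi>_def \<phi>'_def
    by (auto intro!: holomorphic_on_imp_continuous_on holomorphic_deriv)
  have vec: "continuous_on S (\<lambda>z. \<chi> k. c * Re (h z k))" "continuous_on S (\<lambda>z. \<chi> k. - (c * Re (h z k)))"
      "continuous_on S (\<lambda>z. \<chi> k. - (c * Im (h z k)))"
    if "\<And>k. continuous_on S (\<lambda>z. h z k)" for c and h :: "complex \<Rightarrow> 3 \<Rightarrow> complex"
    by (intro continuous_on_vec_lambda continuous_intros that)+
  have cont': "continuous_on S (dx f)" "continuous_on S (dy f)" "continuous_on S (dx (dx f))"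
     "continuous_on S (dy (dx f))" "continuous_on S (dx (dy f))" "continuous_on S (dy (dy f))"
    by (simp_all add: dx dy D2 cont vec cong: continuous_on_cong)
  have "C2_on S f"
    unfolding C2_on_def C1_on_def using diff D cont' by (auto simp: differentiable_def)
  moreover have "inj (frechet_derivative f (at z)) \<and>
        norm (dx f z) = norm (dy f z) \<and> dx f z \<bullet> dy f z = 0 \<and> mean_curvature f z = 0" if z: "z \<in> S" for z
  proof -
    have "(\<Sum>k\<in>UNIV. (\<phi> z $ k)\<^sup>2) = 0" using iso[OF z] by (simp add: \<phi>_def)
    then have inner: "dx f z \<bullet> dx f z = dy f z \<bullet> dy f z" "dx f z \<bullet> dy f z = 0"
      by (simp_all add: dx[OF z] dy[OF z] inner_vec_def sum_3 complex_eq_iff power2_eq_square algebra_simps)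
    have nz: "dx f z \<noteq> 0"
    proof
      assume "dx f z = 0"
      then have "dx f z = 0" "dy f z = 0" using inner by simp_all
      then have "\<phi> z = 0" using dx[OF z] dy[OF z] by (simp add: vec_eq_iff complex_eq_iff)
      then show False using nz[OF z] by (simp add: \<phi>_def)
    qed
    then have nz': "dy f z \<noteq> 0" using inner(1) by auto
    have "inj (\<lambda>h. Re h *\<^sub>R dx f z + Im h *\<^sub>R dy f z)"
    proof (rule injI)
      fix g h assume "Re g *\<^sub>R dx f z + Im g *\<^sub>R dy f z = Re h *\<^sub>R dx f z + Im h *\<^sub>R dy f z"
      then have "(Re g *\<^sub>R dx f z + Im g *\<^sub>R dy f z) \<bullet> v = (Re h *\<^sub>R dx f z + Im h *\<^sub>R dy f z) \<bullet> v" for v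
        by simp
      from this[of "dx f z"] this[of "dy f z"] inner nz nz' show "g = h"
        by (simp add: inner_add_left inner_add_right inner_commute complex_eq_iff)
    qed
    then have "inj (frechet_derivative f (at z))"
      using has_derivative_dx_dy[OF diff[OF z]] by (simp add: frechet_derivative_at[symmetric])
    moreover have "norm (dx f z) = norm (dy f z)"
      using inner(1) by (simp add: norm_eq)
    moreover have "dx (dx f) z + dy (dy f) z = 0"
      by (simp add: D2[OF z] vec_eq_iff)
    then have "mean_curvature f z = 0"
      using inner by (simp add: mean_curvature_def Let_def eq_neg_iff_add_eq_0[symmetric])
    ultimately show ?thesis using inner(2) by simp
  qed
  ultimately show ?thesis using ext by (auto simp: minimal_immersions_def)
qed

text \<open>Simple connectivity yields primitives of the components of \<open>\<phi>\<close>. Twice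
  their real part has complex derivative \<open>\<phi>\<close>, since \<open>f_z\<close> halves
  \<open>f_x - \<i> f_y\<close>; restricting to \<open>S\<close> makes the result
  extensional.\<close>

lemma exists_f_z:
  assumes S: "open S" "simply_connected S" "z0 \<in> S"
    and hol: "\<And>k. (\<lambda>z. \<phi> z $ k) holomorphic_on S"
  shows "\<exists>f. f \<in> extensional S \<and> f z0 = c \<and>
    (\<forall>z\<in>S. f differentiable (at z) \<and> f_z f z = \<phi> z)"
proof -
  have "\<exists>\<Phi>. \<forall>z\<in>S. (\<Phi> has_field_derivative \<phi> z $ k) (at z)" for k
    using S hol[of k] simply_connected_eq_global_primitive[OF S(1)] by blast
  then obtain \<Phi> where \<Phi>: "(\<Phi> k has_field_derivative \<phi> z $ k) (at z)" if "z \<in> S" for k z by metis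
  define g where "g z = c + (\<chi> k. 2 * Re (\<Phi> k z - \<Phi> k z0))" for z
  have Dg: "(g has_derivative (\<lambda>h. \<chi> k. 2 * Re (\<phi> z $ k * h))) (at z)" if "z \<in> S" for z
  proof -
    have *: "(\<Phi> k has_derivative (\<lambda>h. \<phi> z $ k * h)) (at z)" for k
      using \<Phi>[OF that] by (simp add: has_field_derivative_def)
    have "((\<lambda>w. \<chi> k. 2 * Re (\<Phi> k w - \<Phi> k z0)) has_derivative (\<lambda>h. \<chi> k. 2 * Re (\<phi> z $ k * h - 0))) (at z)"
      by (intro has_derivative_vec_lambda has_derivative_mult_right has_derivative_Re has_derivative_diff * has_derivative_const)
    from has_derivative_add[OF has_derivative_const[of c] this] show ?thesis by (simp add: g_def[abs_def])
  qed
  have D: "(restrict g S has_derivative (\<lambda>h. \<chi> k. 2 * Re (\<phi> z $ k * h))) (at z)" if "z \<in> S" for z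
    by (rule has_derivative_transform_within_open[OF Dg[OF that] S(1) that]) auto
  have "f_z (restrict g S) z = \<phi> z" if "z \<in> S" for z
  proof -
    have "restrict g S differentiable (at z)" using D[OF that] by (auto simp: differentiable_def)
    then show ?thesis
      using dx_dy_if_has_derivative[OF D[OF that]]
      by (simp add: vec_eq_iff f_z_nth complex_eq_iff)
  qed
  moreover have "restrict g S z0 = c" using S(3) by (simp add: g_def vec_eq_iff)
  ultimately show ?thesis using D by (intro exI[of _ "restrict g S"]) (auto simp: differentiable_def)
qed

text \<open>Because \<open>f\<close> and \<open>g\<close> are real, \<open>f_z\<close> carries both
  partial derivatives, so the difference has derivative zero on a connected set.\<close>

lemma eq_if_f_z_eq:
  assumes S: "open S" "connected S" "z0 \<in> S"
    and fg: "\<And>z. z \<in> S \<Longrightarrow> f differentiable (at z)" "\<And>z. z \<in> S \<Longrightarrow> g differentiable (at z)"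
    and eq: "\<And>z. z \<in> S \<Longrightarrow> f_z f z = f_z g z" "f z0 = g z0" and z: "z \<in> S"
  shows "f z = g z"
proof -
  have "f z - g z = f z0 - g z0"
  proof (rule has_derivative_zero_unique_connected[OF S(1,2) _ z S(3)])
    fix w assume w: "w \<in> S"
    then have eqs: "dx f w = dx g w" "dy f w = dy g w"
      using fg[of w] eq(1)[of w] by (simp_all add: dx_dy_eq_f_z)
    have "((\<lambda>w. f w - g w) has_derivative (\<lambda>h. (Re h *\<^sub>R dx f w + Im h *\<^sub>R dy f w) -
        (Re h *\<^sub>R dx g w + Im h *\<^sub>R dy g w))) (at w)"
      using w by (intro has_derivative_diff has_derivative_dx_dy fg)
    then show "((\<lambda>w. f w - g w) has_derivative (\<lambda>h. 0)) (at w)"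
      unfolding eqs by simp
  qed
  then show ?thesis using eq(2) by simp
qed

section \<open>Square roots on simply connected domains\<close>


text \<open>This is the quotient map of the punctured plane \<open>C^2 - {0}\<close> by the sign
  change \<open>w \<mapsto> - w\<close>; its image is the quadric cone \<open>s^2 = m * t\<close>
  without the apex. Lifting through it takes square roots of two functions at once with compatible
  signs, even where one of them vanishes.\<close>

definition veronese :: "complex \<times> complex \<Rightarrow> complex \<times> complex \<times> complex" where
  "veronese w = ((fst w)\<^sup>2, fst w * snd w, (snd w)\<^sup>2)"

definition veronese_cone :: "(complex \<times> complex \<times> complex) set" where
  "veronese_cone = {x. (fst (snd x))\<^sup>2 = fst x * snd (snd x) \<and> x \<noteq> 0}"

lemma veronese_image: "veronese ` (- {0}) = veronese_cone"
proof
  show "veronese ` (- {0}) \<subseteq> veronese_cone"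
    by (auto simp: veronese_def veronese_cone_def prod_eq_iff power_mult_distrib)
  show "veronese_cone \<subseteq> veronese ` (- {0})"
  proof
    fix x assume x: "x \<in> veronese_cone"
    obtain m s t where xmst: "x = (m, s, t)" by (metis surj_pair)
    have st: "s\<^sup>2 = m * t" "x \<noteq> 0" using x by (auto simp: veronese_cone_def xmst)
    show "x \<in> veronese ` (- {0})"
    proof (cases "m = 0")
      case True
      then have "x = veronese (0, csqrt t)" "(0, csqrt t) \<noteq> 0"
        using st by (auto simp: xmst veronese_def prod_eq_iff)
      then show ?thesis by blast
    next
      case False
      then have "x = veronese (csqrt m, s / csqrt m)" "(csqrt m, s / csqrt m) \<noteq> 0"
        using st by (auto simp: xmst veronese_def prod_eq_iff power_divide)
      then show ?thesis by blast
    qed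
  qed
qed

lemma continuous_on_veronese: "continuous_on A veronese"
  unfolding veronese_def by (intro continuous_intros)

lemma Re_pos_sqrt_sector:
  assumes "Re (w\<^sup>2) > 0"
  shows "\<bar>Im w\<bar> < Re w \<or> \<bar>Im w\<bar> < - Re w"
proof -
  have "\<bar>Im w\<bar>\<^sup>2 < \<bar>Re w\<bar>\<^sup>2" using assms by (simp add: Re_power2)
  then have "\<bar>Im w\<bar> < \<bar>Re w\<bar>" by (rule power_less_imp_less_base) simp
  then show ?thesis by linarith
qed

lemma sector_Re_pos_square:
  assumes "\<bar>Im w\<bar> < Re w"
  shows "Re (w\<^sup>2) > 0"
proof -
  have "\<bar>Im w\<bar>\<^sup>2 < (Re w)\<^sup>2" using assms by (intro power_strict_mono) auto
  then show ?thesis by (simp add: Re_power2)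
qed

text \<open>The open quarter-plane sector around the ray through \<open>c\<close>. Squaring maps it
  bijectively onto the half plane centred on \<open>c^2\<close>, and the sector of
  \<open>- c\<close> is the other branch over the same half plane.\<close>

definition sheet :: "complex \<Rightarrow> complex set" where
  "sheet c = {a. \<bar>Im (a / c)\<bar> < Re (a / c)}"

lemma open_sheet: "open (sheet c)"
  unfolding sheet_def divide_inverse by (intro open_Collect_less continuous_intros)

text \<open>Over the half plane centred on \<open>c^2\<close> the principal root gives a continuous
  first coordinate. It is nonzero there, so the second coordinate is recovered by division from the
  product of the two.\<close>

lemma homeomorphism_sheet:
  assumes "c \<noteq> 0"
  shows "homeomorphism {w. fst w \<in> sheet c} {x \<in> veronese_cone. 0 < Re (fst x / c\<^sup>2)} veronese
    (\<lambda>x. (c * csqrt (fst x / c\<^sup>2), fst (snd x) / (c * csqrt (fst x / c\<^sup>2))))"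
    (is "homeomorphism ?U ?T _ ?q")
proof (rule homeomorphismI)
  show "continuous_on ?U veronese" by (rule continuous_on_veronese)
  have nonpos: "y \<notin> \<real>\<^sub>\<le>\<^sub>0" if "Re y > 0" for y using that complex_nonpos_Reals_iff by auto
  have "continuous_on ?T (\<lambda>x. csqrt (fst x / c\<^sup>2))"
    by (rule continuous_on_compose2[OF continuous_on_csqrt])
       (use assms nonpos in \<open>auto intro!: continuous_intros\<close>)
  then show "continuous_on ?T ?q"
    by (intro continuous_intros) (use assms in auto)
  have q_sheet: "fst x \<noteq> 0 \<and> c * csqrt (fst x / c\<^sup>2) \<in> sheet c" if "x \<in> ?T" for x
  proof -
    have "0 < Re (fst x / c\<^sup>2)" using that by blast
    then have "Re ((csqrt (fst x / c\<^sup>2))\<^sup>2) > 0" by simp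
    from Re_pos_sqrt_sector[OF this] csqrt_principal[of "fst x / c\<^sup>2"]
    have "\<bar>Im (csqrt (fst x / c\<^sup>2))\<bar> < Re (csqrt (fst x / c\<^sup>2))" by linarith
    then show ?thesis using that assms by (auto simp: sheet_def)
  qed
  then show "?q ` ?T \<subseteq> ?U" by auto
  have sq: "0 < Re ((a / c)\<^sup>2)" "csqrt ((a / c)\<^sup>2) = a / c" "a \<noteq> 0" if "a \<in> sheet c" for a
    using that sector_Re_pos_square[of "a / c"] by (auto simp: sheet_def intro!: csqrt_square)
  show "veronese ` ?U \<subseteq> ?T"
  proof (clarsimp, intro conjI)
    fix a b :: complex assume a: "a \<in> sheet c"
    with sq(3) have "(a, b) \<in> - {0}" by (auto simp: zero_prod_def)
    then show "veronese (a, b) \<in> veronese_cone" unfolding veronese_image[symmetric] by (rule imageI)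
    show "0 < Re (fst (veronese (a, b)) / c\<^sup>2)" using sq(1)[OF a] by (simp add: veronese_def power_divide)
  qed
  show "?q (veronese w) = w" if "w \<in> ?U" for w
    using sq[of "fst w"] that assms by (simp add: veronese_def power_divide prod_eq_iff)
  show "veronese (?q x) = x" if "x \<in> ?T" for x
    using that q_sheet[OF that] assms
    by (auto simp: veronese_def prod_eq_iff veronese_cone_def power_mult_distrib power_divide)
qed

definition swap3 :: "complex \<times> complex \<times> complex \<Rightarrow> complex \<times> complex \<times> complex" where
  "swap3 x = (snd (snd x), fst (snd x), fst x)"

text \<open>Points with vanishing first coordinate need charts that take the root of the third
  coordinate of the cone. Exchanging the two coordinates of the plane corresponds to
  \<open>swap3\<close> on the cone and reduces these charts to the previous ones.\<close>

lemma homeomorphism_sheet':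
  assumes "c \<noteq> 0"
  shows "\<exists>q. homeomorphism {w. snd w \<in> sheet c} {x \<in> veronese_cone. 0 < Re (snd (snd x) / c\<^sup>2)} veronese q"
proof -
  define U T where "U = {w :: complex \<times> complex. fst w \<in> sheet c}" and "T = {x \<in> veronese_cone. 0 < Re (fst x / c\<^sup>2)}"
  obtain q where "homeomorphism U T veronese q"
    using homeomorphism_sheet[OF assms] unfolding U_def T_def by blast
  moreover have "homeomorphism {w. snd w \<in> sheet c} U prod.swap prod.swap"
    by (rule homeomorphismI) (auto simp: U_def intro!: continuous_intros)
  moreover have "homeomorphism T {x \<in> veronese_cone. 0 < Re (snd (snd x) / c\<^sup>2)} swap3 swap3"
    by (rule homeomorphismI)
       (auto simp: T_def swap3_def[abs_def] veronese_cone_def prod_eq_iff mult.commute intro!: continuous_intros)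
  ultimately have "homeomorphism {w. snd w \<in> sheet c} {x \<in> veronese_cone. 0 < Re (snd (snd x) / c\<^sup>2)}
      (swap3 \<circ> (veronese \<circ> prod.swap)) ((prod.swap \<circ> q) \<circ> swap3)"
    by (meson homeomorphism_compose)
  moreover have "swap3 \<circ> (veronese \<circ> prod.swap) = veronese"
    by (auto simp: swap3_def veronese_def fun_eq_iff)
  ultimately show ?thesis by auto
qed

lemma sheet_disjoint: "c \<noteq> 0 \<Longrightarrow> sheet c \<inter> sheet (- c) = {}"
  by (auto simp: sheet_def)

text \<open>An evenly covered neighbourhood of \<open>veronese (a, b)\<close> is cut out by a half
  plane in whichever of the coordinates \<open>a^2\<close>, \<open>b^2\<close> is nonzero; the
  sheets above it are the two opposite sectors.\<close>

lemma covering_space_veronese: "covering_space (- {0}) veronese veronese_cone"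
proof
  show "continuous_on (- {0}) veronese" by (rule continuous_on_veronese)
  show "veronese ` (- {0}) = veronese_cone" by (rule veronese_image)
  fix x assume x: "x \<in> veronese_cone"
  then obtain a b where ab: "x = veronese (a, b)" "(a, b) \<noteq> 0" by (auto simp flip: veronese_image)
  \<comment> \<open>One argument serves both coordinates: \<open>l\<close> is the coordinate of the
    plane whose square is the coordinate \<open>L\<close> of the cone, and \<open>c\<close> is a
    nonzero value of \<open>l\<close> over \<open>x\<close>.\<close>
  have *: "\<exists>T. x \<in> T \<and> openin (top_of_set veronese_cone) T \<and>
                (\<exists>v. \<Union>v = - {0} \<inter> veronese -` T \<and> (\<forall>u\<in>v. openin (top_of_set (- {0})) u) \<and>
                     pairwise disjnt v \<and> (\<forall>u\<in>v. \<exists>q. homeomorphism u T veronese q))"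
    if c: "c \<noteq> 0" and "\<And>w. L (veronese w) = (l w)\<^sup>2" "L x = c\<^sup>2"
      and cont: "continuous_on UNIV l" "continuous_on UNIV L" "l 0 = 0"
      and hom: "\<And>c. c \<noteq> 0 \<Longrightarrow> \<exists>q. homeomorphism {w. l w \<in> sheet c} {x \<in> veronese_cone. 0 < Re (L x / c\<^sup>2)} veronese q"
    for c and L :: "complex \<times> complex \<times> complex \<Rightarrow> complex" and l :: "complex \<times> complex \<Rightarrow> complex"
  proof (intro exI[of _ "{x \<in> veronese_cone. 0 < Re (L x / c\<^sup>2)}"] conjI)
    let ?T = "{x \<in> veronese_cone. 0 < Re (L x / c\<^sup>2)}"
    let ?v = "{{w. l w \<in> sheet c}, {w. l w \<in> sheet (- c)}}"
    show "x \<in> ?T" using that x by auto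
    have "open {x. 0 < Re (L x / c\<^sup>2)}"
      using c cont by (intro open_Collect_less continuous_intros) auto
    then show "openin (top_of_set veronese_cone) ?T" by (auto simp: openin_open)
    have 0: "(0::complex) \<notin> sheet d" for d by (simp add: sheet_def)
    have "0 < Re ((l w)\<^sup>2 / c\<^sup>2) \<longleftrightarrow> l w \<in> sheet c \<or> l w \<in> sheet (- c)" for w
      using Re_pos_sqrt_sector[of "l w / c"] sector_Re_pos_square[of "l w / c"]
        sector_Re_pos_square[of "- (l w / c)"] by (auto simp: sheet_def power_divide)
    then have "\<Union>?v = - {0} \<inter> veronese -` ?T"
      using 0 that(2) \<open>l 0 = 0\<close> by (auto simp flip: veronese_image)
    moreover have "open {w. l w \<in> sheet d} \<and> {w. l w \<in> sheet d} \<subseteq> - {0}" for d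
      using open_vimage[OF open_sheet cont(1)] 0 \<open>l 0 = 0\<close> by (auto simp: vimage_def)
    then have "\<forall>u\<in>?v. openin (top_of_set (- {0})) u"
      by (simp add: openin_open_eq[OF open_Compl[OF closed_singleton]])
    moreover have "pairwise disjnt ?v"
      using sheet_disjoint[OF c] by (auto simp: pairwise_def disjnt_def)
    moreover have "\<forall>u\<in>?v. \<exists>q. homeomorphism u ?T veronese q"
      using hom[OF c] hom[of "- c"] c by auto
    ultimately show "\<exists>v. \<Union>v = - {0} \<inter> veronese -` ?T \<and> (\<forall>u\<in>v. openin (top_of_set (- {0})) u) \<and>
                     pairwise disjnt v \<and> (\<forall>u\<in>v. \<exists>q. homeomorphism u ?T veronese q)" by blast
  qed
  show "\<exists>T. x \<in> T \<and> openin (top_of_set veronese_cone) T \<and>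
                (\<exists>v. \<Union>v = - {0} \<inter> veronese -` T \<and> (\<forall>u\<in>v. openin (top_of_set (- {0})) u) \<and>
                     pairwise disjnt v \<and> (\<forall>u\<in>v. \<exists>q. homeomorphism u T veronese q))"
  proof (cases "a = 0")
    case False
    then show ?thesis
      using homeomorphism_sheet ab
      by (intro *[of a fst fst]) (auto simp: veronese_def intro!: continuous_intros)
  next
    case True
    then show ?thesis
      using homeomorphism_sheet' ab
      by (intro *[of b "\<lambda>x. snd (snd x)" snd]) (auto simp: veronese_def zero_prod_def intro!: continuous_intros)
  qed
qed

text \<open>A continuous square root without zeros is a lift through the squaring map of the
  punctured plane, a holomorphic covering.\<close>

lemma holomorphic_on_sqrt:
  assumes "open S" "f holomorphic_on S" "continuous_on S g" "\<And>z. z \<in> S \<Longrightarrow> g z \<noteq> 0"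
    "\<And>z. z \<in> S \<Longrightarrow> (g z)\<^sup>2 = f z"
  shows "g holomorphic_on S"
proof (rule covering_space_lift_is_holomorphic[OF covering_space_square_punctured_plane])
  show "f \<in> S \<rightarrow> - {0}" using assms(4,5) by fastforce
qed (use assms in \<open>auto intro!: holomorphic_intros\<close>)

text \<open>
  The zeros of \<open>\<mu>\<close> have even order because \<open>\<mu> t = s\<^sup>2\<close> without common zeros, so square roots
  exist locally; simple connectivity makes them global.
\<close>

lemma exists_holomorphic_veronese_lift:
  assumes S: "open S" "simply_connected S"
    and hol: "\<mu> holomorphic_on S" "s holomorphic_on S" "t holomorphic_on S"
    and rel: "\<And>z. z \<in> S \<Longrightarrow> (s z)\<^sup>2 = \<mu> z * t z" "\<And>z. z \<in> S \<Longrightarrow> \<mu> z \<noteq> 0 \<or> t z \<noteq> 0"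
  obtains a b where "a holomorphic_on S" "b holomorphic_on S"
    "\<And>z. z \<in> S \<Longrightarrow> (a z)\<^sup>2 = \<mu> z \<and> a z * b z = s z \<and> (b z)\<^sup>2 = t z"
proof -
  note cont = hol[THEN holomorphic_on_imp_continuous_on]
  have lift1: "continuous_on S (\<lambda>z. (\<mu> z, s z, t z))" by (intro continuous_intros cont)
  have lift2: "(\<lambda>z. (\<mu> z, s z, t z)) \<in> S \<rightarrow> veronese_cone"
    using rel by (auto simp: veronese_cone_def zero_prod_def)
  obtain g where g: "continuous_on S g" "g \<in> S \<rightarrow> - {0}"
      "\<And>z. z \<in> S \<Longrightarrow> veronese (g z) = (\<mu> z, s z, t z)"
    using covering_space_lift[OF covering_space_veronese S(2) open_imp_locally_path_connected[OF S(1)]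
      lift1 lift2] by blast
  define a b where "a z = fst (g z)" and "b z = snd (g z)" for z
  have contab: "continuous_on S a" "continuous_on S b"
    unfolding a_def[abs_def] b_def[abs_def] by (intro continuous_intros g)+
  have ab: "(a z)\<^sup>2 = \<mu> z \<and> a z * b z = s z \<and> (b z)\<^sup>2 = t z" if "z \<in> S" for z
    using g(3)[OF that] by (simp add: veronese_def a_def b_def)
  \<comment> \<open>The lift is only known to be continuous. Where \<open>a\<close> is nonzero it is
    holomorphic as a root of \<open>\<mu>\<close>, and where \<open>b\<close> is nonzero as the
    quotient \<open>s / b\<close>; the roles are symmetric, and one of the two is nonzero at every
    point.\<close>
  define A B where "A = {z\<in>S. a z \<noteq> 0}" and "B = {z\<in>S. b z \<noteq> 0}"
  have "open A" "open B"
    unfolding A_def B_def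
    using continuous_open_preimage[OF contab(1) S(1) open_Compl[OF closed_singleton[of 0]]]
      continuous_open_preimage[OF contab(2) S(1) open_Compl[OF closed_singleton[of 0]]]
    by (simp_all add: vimage_def Int_def)
  have SAB: "S = A \<union> B"
    using ab rel(2) by (force simp: A_def B_def)
  have sub: "A \<subseteq> S" "B \<subseteq> S" by (auto simp: A_def B_def)
  have "a holomorphic_on A"
    by (rule holomorphic_on_sqrt[OF \<open>open A\<close> holomorphic_on_subset[OF hol(1) sub(1)]
      continuous_on_subset[OF contab(1) sub(1)]]) (use ab in \<open>auto simp: A_def\<close>)
  moreover have "b holomorphic_on B"
    by (rule holomorphic_on_sqrt[OF \<open>open B\<close> holomorphic_on_subset[OF hol(3) sub(2)]
      continuous_on_subset[OF contab(2) sub(2)]]) (use ab in \<open>auto simp: B_def\<close>)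
  moreover have "a holomorphic_on B"
  proof -
    have "(\<lambda>z. s z / b z) holomorphic_on B"
      using \<open>b holomorphic_on B\<close> hol(2) sub by (auto intro!: holomorphic_intros simp: B_def intro: holomorphic_on_subset)
    then show ?thesis by (rule holomorphic_transform) (use ab in \<open>auto simp: B_def field_simps\<close>)
  qed
  moreover have "b holomorphic_on A"
  proof -
    have "(\<lambda>z. s z / a z) holomorphic_on A"
      using \<open>a holomorphic_on A\<close> hol(2) sub by (auto intro!: holomorphic_intros simp: A_def intro: holomorphic_on_subset)
    then show ?thesis by (rule holomorphic_transform) (use ab in \<open>auto simp: A_def field_simps\<close>)
  qed
  ultimately have "a holomorphic_on S" "b holomorphic_on S"
    unfolding SAB using \<open>open A\<close> \<open>open B\<close> by (auto intro: holomorphic_on_Un)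
  with ab that show ?thesis by blast
qed

section \<open>Spinor representation\<close>


definition cmat :: "real^3^3 \<Rightarrow> complex^3^3" where
  "cmat A = (\<chi> i j. of_real (A $ i $ j))"

definition Re_vec :: "complex^3 \<Rightarrow> real^3" where "Re_vec v = (\<chi> k. Re (v $ k))"
definition Im_vec :: "complex^3 \<Rightarrow> real^3" where "Im_vec v = (\<chi> k. Im (v $ k))"
definition cvec :: "real^3 \<Rightarrow> complex^3" where "cvec v = (\<chi> k. of_real (v $ k))"

lemma Re_vec_cmat: "Re_vec (cmat A *v v) = A *v Re_vec v"
  and Im_vec_cmat: "Im_vec (cmat A *v v) = A *v Im_vec v"
  by (simp_all add: vec_eq_iff Re_vec_def Im_vec_def cmat_def matrix_vector_mult_def Re_sum Im_sum)

lemma cmat_cvec: "cmat A *v cvec v = cvec (A *v v)"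
  by (simp add: vec_eq_iff cvec_def cmat_def matrix_vector_mult_def)

lemma cmat_inverse:
  assumes "orthogonal_matrix A"
  shows "cmat A *v (cmat (transpose A) *v v) = v" "cmat (transpose A) *v (cmat A *v v) = v"
proof -
  have eqI: "u = v" if "Re_vec u = Re_vec v" "Im_vec u = Im_vec v" for u v
    using that by (simp add: vec_eq_iff Re_vec_def Im_vec_def complex_eq_iff)
  have "A *v (transpose A *v x) = x" "transpose A *v (A *v x) = x" for x
    using assms by (simp_all only: matrix_vector_mul_assoc orthogonal_matrix_def matrix_vector_mul_lid)
  then show "cmat A *v (cmat (transpose A) *v v) = v" "cmat (transpose A) *v (cmat A *v v) = v"
    by (auto intro!: eqI simp: Re_vec_cmat Im_vec_cmat simp del: transpose_matrix_vector)
qed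

text \<open>The form is bilinear, not Hermitian, because that is the form in which isotropy and the
  Hopf differential are written. A real matrix acts on real and imaginary parts separately, so real
  orthogonality suffices.\<close>

lemma cmat_orthogonal_dot:
  assumes "orthogonal_matrix A"
  shows "(\<Sum>k\<in>UNIV. (cmat A *v u) $ k * (cmat A *v v) $ k) = (\<Sum>k\<in>UNIV. u $ k * v $ k)"
proof -
  have dot: "(\<Sum>k\<in>UNIV. u $ k * v $ k) = Complex (Re_vec u \<bullet> Re_vec v - Im_vec u \<bullet> Im_vec v)
      (Re_vec u \<bullet> Im_vec v + Im_vec u \<bullet> Re_vec v)" for u v
    by (simp add: Re_vec_def Im_vec_def inner_vec_def sum_3 complex_eq_iff)
  have "(A *v x) \<bullet> (A *v y) = x \<bullet> y" for x y
    using assms by (metis orthogonal_transformation_def orthogonal_transformation_matrix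
        matrix_of_matrix_vector_mul matrix_vector_mul_linear)
  then show ?thesis by (simp only: dot Re_vec_cmat Im_vec_cmat)
qed

lemma f_z_linear:
  assumes "f differentiable (at z)"
  shows "f_z (\<lambda>w. A *v f w) z = cmat A *v f_z f z"
proof -
  have bl: "bounded_linear ((*v) A)" by (simp add: matrix_vector_mul_bounded_linear)
  have "(\<lambda>w. A *v f w) differentiable (at z)"
    using assms bounded_linear.has_derivative[OF bl] unfolding differentiable_def by blast
  note nth = f_z_nth[OF this, unfolded dx_dy_linear_comp[OF assms bl]]
  show ?thesis
    unfolding vec_eq_iff nth
    by (simp add: f_z_nth[OF assms] cmat_def matrix_vector_mult_def sum_3 field_simps)
qed

text \<open>The third column is the cross product of the first two, which forces determinant 1.
  Orientation matters because the unit normal is a cross product and has to commute with the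
  rotation.\<close>

lemma rotation_matrix_frame:
  fixes a b :: "real^3"
  assumes "a \<bullet> a = b \<bullet> b" "a \<bullet> b = 0" "a \<noteq> 0"
  shows "rotation_matrix (transpose (vector
     [a /\<^sub>R norm a, b /\<^sub>R norm b, cross3 a b /\<^sub>R norm (cross3 a b)]))"
proof -
  have nz: "norm a \<noteq> 0" "norm b = norm a" using assms by (auto simp: norm_eq)
  define u v w where "u = a /\<^sub>R norm a" and "v = b /\<^sub>R norm b" and "w = cross3 a b /\<^sub>R norm (cross3 a b)"
  have w: "w = cross3 u v"
    using nz cross_orthogonal_norm[OF assms(2)]
    by (simp add: w_def u_def v_def cross_mult_left cross_mult_right)
  have uv: "u \<bullet> u = 1" "v \<bullet> v = 1" "u \<bullet> v = 0"
    using nz assms by (simp_all add: u_def v_def dot_square_norm power2_eq_square)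
  have "norm w = norm u * norm v" unfolding w by (rule cross_orthogonal_norm[OF uv(3)])
  moreover have "norm u = 1" "norm v = 1" using uv by (simp_all only: norm_eq_1)
  ultimately have ww: "w \<bullet> w = 1" by (simp add: dot_square_norm)
  have uw: "u \<bullet> w = 0" "v \<bullet> w = 0" by (simp_all add: w dot_cross_self)
  define M :: "real^3^3" where "M = vector [u, v, w]"
  have "M ** transpose M = mat 1"
    using uv ww uw
    by (simp add: M_def matrix_matrix_mult_def transpose_def mat_def vec_eq_iff forall_3 sum_3
        inner_vec_def mult.commute)
  then have "orthogonal_matrix M"
    by (metis orthogonal_matrix orthogonal_matrix_transpose transpose_transpose)
  moreover have "cross3 v w = u" using uv by (simp add: w Lagrange inner_commute)
  then have "det M = 1" using uv by (simp add: M_def flip: dot_cross_det)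
  ultimately show ?thesis
    by (simp add: rotation_matrix_def orthogonal_matrix_transpose det_transpose
      flip: u_def v_def w_def M_def)
qed

definition spin :: "complex \<Rightarrow> complex \<Rightarrow> complex^3" where
  "spin a b = vector [a\<^sup>2 - b\<^sup>2, - \<i> * (a\<^sup>2 + b\<^sup>2), - 2 * a * b]"

lemma spin_isotropic: "(\<Sum>k\<in>UNIV. (spin a b $ k)\<^sup>2) = 0"
  by (simp add: spin_def sum_3 power2_eq_square algebra_simps)

lemma spin_eq_0_iff: "spin a b = 0 \<longleftrightarrow> a = 0 \<and> b = 0"
proof
  assume "spin a b = 0"
  then have *: "a\<^sup>2 - b\<^sup>2 = 0" "a\<^sup>2 + b\<^sup>2 = 0" by (auto simp: spin_def vec_eq_iff forall_3)
  then have "a\<^sup>2 = 0" "b\<^sup>2 = 0" by algebra+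
  then show "a = 0 \<and> b = 0" by simp
qed (simp add: spin_def vec_eq_iff forall_3)

text \<open>With \<open>\<nu> = b / a\<close> this is \<open>|a|^2 + |b|^2\<close> times the point
  \<open>(2 Re \<nu>, - 2 Im \<nu>, 1 - |\<nu>|^2) / (1 + |\<nu>|^2)\<close> of the sphere: the
  Gauss map, in a form that remains meaningful where \<open>a\<close> vanishes.\<close>

definition spin_normal :: "complex \<Rightarrow> complex \<Rightarrow> real^3" where
  "spin_normal a b = vector [2 * Re (a * cnj b), 2 * Im (a * cnj b), (norm a)\<^sup>2 - (norm b)\<^sup>2]"

lemma norm_spin_normal: "norm (spin_normal a b) = (norm a)\<^sup>2 + (norm b)\<^sup>2"
proof -
  have "spin_normal a b \<bullet> spin_normal a b = ((norm a)\<^sup>2 + (norm b)\<^sup>2)\<^sup>2"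
    unfolding spin_normal_def cmod_power2
    by (simp add: inner_vec_def sum_3) (simp add: power2_eq_square algebra_simps)
  then show ?thesis by (simp add: norm_eq_square)
qed

lemma norm_Re_spin: "norm (2 *\<^sub>R Re_vec (spin a b)) = 2 * ((norm a)\<^sup>2 + (norm b)\<^sup>2)"
proof -
  have "(2 *\<^sub>R Re_vec (spin a b)) \<bullet> (2 *\<^sub>R Re_vec (spin a b)) = (2 * ((norm a)\<^sup>2 + (norm b)\<^sup>2))\<^sup>2"
    unfolding spin_def Re_vec_def cmod_power2
    by (simp add: inner_vec_def sum_3 power2_eq_square algebra_simps)
  then show ?thesis by (simp only: norm_eq_square) simp
qed

lemma cross_spin: "cross3 (2 *\<^sub>R Re_vec (spin a b)) (- 2 *\<^sub>R Im_vec (spin a b))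
    = (4 * ((norm a)\<^sup>2 + (norm b)\<^sup>2)) *\<^sub>R spin_normal a b"
  unfolding spin_def spin_normal_def Re_vec_def Im_vec_def cmod_power2
  by (simp add: vec_eq_iff forall_3 cross3_def power2_eq_square algebra_simps)

text \<open>
  The spinor representation \<open>f_z = R (a\<^sup>2 - b\<^sup>2, - \<i> (a\<^sup>2 + b\<^sup>2), - 2 a b)\<close>: in classical terms
  \<open>\<mu> = a\<^sup>2\<close> and \<open>\<nu> = b / a\<close>, relative to coordinates rotated by \<open>R\<close>.
\<close>

definition spinor_rep ::
  "complex set \<Rightarrow> real^3^3 \<Rightarrow> (complex \<Rightarrow> real^3) \<Rightarrow> (complex \<Rightarrow> complex) \<Rightarrow> (complex \<Rightarrow> complex) \<Rightarrow> bool" where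
  "spinor_rep S R f a b \<longleftrightarrow> f \<in> minimal_immersions S \<and> rotation_matrix R \<and>
     a holomorphic_on S \<and> b holomorphic_on S \<and> (\<forall>z\<in>S. f_z f z = cmat R *v spin (a z) (b z))"

text \<open>The spinor form of \<open>\<nu> z0 = 0\<close> and \<open>\<mu> z0 > 0\<close>.
  Positivity of \<open>a z0\<close> also removes the ambiguity of a common sign, which
  \<open>spin\<close> does not see.\<close>

definition normalized_at :: "complex \<Rightarrow> (complex \<Rightarrow> complex) \<Rightarrow> (complex \<Rightarrow> complex) \<Rightarrow> bool" where
  "normalized_at z0 a b \<longleftrightarrow> b z0 = 0 \<and> (\<exists>m::real. m > 0 \<and> a z0 = of_real m)"

definition spin_norm2 :: "(complex \<Rightarrow> complex) \<Rightarrow> (complex \<Rightarrow> complex) \<Rightarrow> complex \<Rightarrow> real" where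
  "spin_norm2 a b z = (norm (a z))\<^sup>2 + (norm (b z))\<^sup>2"

section \<open>Metric, normal and Hopf differential in terms of the spinor\<close>

context
  fixes S R f a b
  assumes S: "open S" and rep: "spinor_rep S R f a b"
begin

lemma spinor_rep_minimal: "f \<in> minimal_immersions S"
  and spinor_rep_rotation: "rotation_matrix R"
  and spinor_rep_holomorphic: "a holomorphic_on S" "b holomorphic_on S"
  and spinor_rep_f_z: "z \<in> S \<Longrightarrow> f_z f z = cmat R *v spin (a z) (b z)"
  using rep by (auto simp: spinor_rep_def)

lemma spinor_rep_orthogonal: "orthogonal_matrix R"
  using spinor_rep_rotation by (simp add: rotation_matrix_def)

lemma spinor_rep_nonzero:
  assumes "z \<in> S"
  shows "a z \<noteq> 0 \<or> b z \<noteq> 0"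
proof (rule ccontr)
  assume "\<not> ?thesis"
  then have "spin (a z) (b z) = 0" by (simp add: spin_eq_0_iff)
  then have "f_z f z = 0" using spinor_rep_f_z[OF assms] by simp
  then show False using f_z_minimal_isotropic(2)[OF S spinor_rep_minimal assms] by simp
qed

lemma spin_norm2_pos: "z \<in> S \<Longrightarrow> spin_norm2 a b z > 0"
  using spinor_rep_nonzero[of z] by (auto simp: spin_norm2_def add_pos_nonneg add_nonneg_pos)

lemma spinor_rep_dx_dy:
  assumes z: "z \<in> S"
  shows "dx f z = R *v (2 *\<^sub>R Re_vec (spin (a z) (b z)))" "dy f z = R *v (- 2 *\<^sub>R Im_vec (spin (a z) (b z)))"
proof -
  note d = dx_dy_eq_f_z[OF minimal_differentiable(1)[OF S spinor_rep_minimal z]]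
  have "dx f z = 2 *\<^sub>R Re_vec (f_z f z)" "dy f z = - 2 *\<^sub>R Im_vec (f_z f z)"
    by (simp_all add: d vec_eq_iff Re_vec_def Im_vec_def)
  then show "dx f z = R *v (2 *\<^sub>R Re_vec (spin (a z) (b z)))" "dy f z = R *v (- 2 *\<^sub>R Im_vec (spin (a z) (b z)))"
    by (simp_all only: spinor_rep_f_z[OF z] Re_vec_cmat Im_vec_cmat matrix_vector_mult_scaleR)
qed

lemma norm_rotated: "norm (R *v v) = norm v"
  using spinor_rep_orthogonal
  by (metis orthogonal_transformation_matrix orthogonal_transformation_norm
      matrix_of_matrix_vector_mul matrix_vector_mul_linear)

text \<open>The factor 4 in the metric makes \<open>exp u\<close> equal to
  \<open>|a|^2 + |b|^2\<close> with no further constant.\<close>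

lemma spinor_rep_conf_u:
  assumes z: "z \<in> S"
  shows "conf_u f z = ln (spin_norm2 a b z)"
  unfolding conf_u_def spinor_rep_dx_dy(1)[OF z] norm_rotated norm_Re_spin
    spin_norm2_def[symmetric] by simp

lemma spinor_rep_unit_normal:
  assumes z: "z \<in> S"
  shows "unit_normal f z = R *v (spin_normal (a z) (b z) /\<^sub>R spin_norm2 a b z)"
proof -
  have "cross3 (dx f z) (dy f z) = (4 * spin_norm2 a b z) *\<^sub>R (R *v spin_normal (a z) (b z))"
    unfolding spinor_rep_dx_dy[OF z] cross_rotation_matrix[OF spinor_rep_rotation] cross_spin
    by (simp only: matrix_vector_mult_scaleR spin_norm2_def)
  then show ?thesis
    using spin_norm2_pos[OF z]
    by (simp add: unit_normal_def norm_rotated norm_spin_normal matrix_vector_mult_scaleR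
        flip: spin_norm2_def)
qed

text \<open>Rotation invariance of the bilinear form removes \<open>R\<close>, and what remains is
  twice the Wronskian of the spinor. Hence every linear change of \<open>(a, b)\<close> with
  determinant 1 keeps the Hopf differential.\<close>

lemma spinor_rep_hopf:
  assumes z: "z \<in> S"
  shows "hopf f z = 2 * (b z * deriv a z - a z * deriv b z)"
proof -
  define a' b' where "a' = deriv a z" and "b' = deriv b z"
  have D: "(a has_field_derivative a') (at z)" "(b has_field_derivative b') (at z)"
    using spinor_rep_holomorphic S z by (auto intro: holomorphic_derivI simp: a'_def b'_def)
  define \<sigma>' :: "complex^3" where
    "\<sigma>' = vector [2 * a z * a' - 2 * b z * b', - \<i> * (2 * a z * a' + 2 * b z * b'), - 2 * (a' * b z + a z * b')]"
  have D\<sigma>: "((\<lambda>w. spin (a w) (b w) $ k) has_field_derivative \<sigma>' $ k) (at z)" for k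
  proof -
    have "((\<lambda>w. spin (a w) (b w) $ 1) has_field_derivative \<sigma>' $ 1) (at z)"
         "((\<lambda>w. spin (a w) (b w) $ 2) has_field_derivative \<sigma>' $ 2) (at z)"
         "((\<lambda>w. spin (a w) (b w) $ 3) has_field_derivative \<sigma>' $ 3) (at z)"
      unfolding spin_def \<sigma>'_def vector_3 by (auto intro!: derivative_eq_intros D simp: algebra_simps)
    then show ?thesis using exhaust_3[of k] by auto
  qed
  have "d_z (\<lambda>w. f_z f w $ k) z = (cmat R *v \<sigma>') $ k" for k
  proof -
    have "d_z (\<lambda>w. f_z f w $ k) z = d_z (\<lambda>w. (cmat R *v spin (a w) (b w)) $ k) z"
      by (rule d_z_cong[OF S z]) (simp add: spinor_rep_f_z)
    also have "((\<lambda>w. (cmat R *v spin (a w) (b w)) $ k) has_field_derivative (cmat R *v \<sigma>') $ k) (at z)"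
      unfolding matrix_vector_mult_def by (auto intro!: derivative_eq_intros D\<sigma> simp: mult.commute)
    note d_z_if_has_field_derivative(1)[OF this]
    finally show ?thesis .
  qed
  then have "hopf f z = (\<Sum>k\<in>UNIV. (cmat R *v cvec (spin_normal (a z) (b z) /\<^sub>R spin_norm2 a b z)) $ k * (cmat R *v \<sigma>') $ k)"
    by (simp add: hopf_def spinor_rep_unit_normal[OF z] cmat_cvec) (simp add: cvec_def)
  also have "\<dots> = (\<Sum>k\<in>UNIV. cvec (spin_normal (a z) (b z) /\<^sub>R spin_norm2 a b z) $ k * \<sigma>' $ k)"
    by (rule cmat_orthogonal_dot[OF spinor_rep_orthogonal])
  also have "\<dots> = (\<Sum>k\<in>UNIV. of_real (spin_normal (a z) (b z) $ k) * \<sigma>' $ k) / of_real (spin_norm2 a b z)"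
    by (simp add: cvec_def sum_distrib_left divide_inverse mult_ac)
  also have "(\<Sum>k\<in>UNIV. of_real (spin_normal (a z) (b z) $ k) * \<sigma>' $ k)
      = of_real (spin_norm2 a b z) * (2 * (b z * a' - a z * b'))"
    unfolding spin_normal_def \<sigma>'_def spin_norm2_def cmod_power2
    by (simp add: sum_3 complex_eq_iff power2_eq_square algebra_simps)
  finally show ?thesis using spin_norm2_pos[OF z] by (simp add: a'_def b'_def)
qed

text \<open>A spinor \<open>(m, 0)\<close> with \<open>m > 0\<close> gives tangent vectors and
  normal along the coordinate axes. Consequently immersions with normalized spinors and the same
  \<open>R\<close> share their frame at \<open>z0\<close>.\<close>

lemma spinor_rep_coord_frame:
  assumes z0: "z0 \<in> S" and norm: "normalized_at z0 a b"
  shows "coord_frame f z0 = R"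
proof -
  obtain m :: real where m: "m > 0" "a z0 = of_real m" "b z0 = 0"
    using norm by (auto simp: normalized_at_def)
  have "2 *\<^sub>R Re_vec (spin (a z0) (b z0)) = (2 * m\<^sup>2) *\<^sub>R axis 1 1"
       "- 2 *\<^sub>R Im_vec (spin (a z0) (b z0)) = (2 * m\<^sup>2) *\<^sub>R axis 2 1"
       "spin_normal (a z0) (b z0) /\<^sub>R spin_norm2 a b z0 = axis 3 1"
    using m by (simp_all add: vec_eq_iff forall_3 axis_def Re_vec_def Im_vec_def spin_def
        spin_normal_def spin_norm2_def)
  then have "dx f z0 = (2 * m\<^sup>2) *\<^sub>R (R *v axis 1 1)" "dy f z0 = (2 * m\<^sup>2) *\<^sub>R (R *v axis 2 1)"
    and n: "unit_normal f z0 = R *v axis 3 1"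
    using spinor_rep_dx_dy[OF z0] spinor_rep_unit_normal[OF z0]
    by (simp_all add: matrix_vector_mult_scaleR)
  then have "dx f z0 /\<^sub>R norm (dx f z0) = R *v axis 1 1" "dy f z0 /\<^sub>R norm (dy f z0) = R *v axis 2 1"
    using m(1) by (simp_all add: norm_rotated)
  then show ?thesis
    by (simp add: coord_frame_def n vec_eq_iff forall_3 transpose_def matrix_vector_mult_def sum_3 axis_def)
qed

end

text \<open>Undoing the frame at \<open>z0\<close> turns \<open>f_z\<close> there into a positive
  multiple of \<open>(1, - \<i>, 0)\<close>, so \<open>b z0 = 0\<close> and
  \<open>(a z0)\<^sup>2 > 0\<close>. The lift is determined up to a common sign, and one of the two
  choices is normalized.\<close>

lemma exists_spinor_rep:
  assumes S: "open S" "simply_connected S" "z0 \<in> S" and f: "f \<in> minimal_immersions S"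
  obtains a b where "spinor_rep S (coord_frame f z0) f a b" "normalized_at z0 a b"
proof -
  define R where "R = coord_frame f z0"
  have rot: "rotation_matrix R"
    unfolding R_def coord_frame_def unit_normal_def Let_def
    using minimal_conformal[OF S(1) f S(3)] by (rule rotation_matrix_frame)
  then have orth: "orthogonal_matrix R" by (simp add: rotation_matrix_def)
  define \<sigma> where "\<sigma> z = cmat (transpose R) *v f_z f z" for z
  have f_z: "f_z f z = cmat R *v \<sigma> z" for z by (simp add: \<sigma>_def cmat_inverse[OF orth])
  have hol: "(\<lambda>z. \<sigma> z $ k) holomorphic_on S" for k
    unfolding \<sigma>_def matrix_vector_mult_def
    by (auto intro!: holomorphic_intros f_z_minimal_holomorphic[OF S(1) f])
  have iso: "(\<sigma> z $ 1)\<^sup>2 + (\<sigma> z $ 2)\<^sup>2 + (\<sigma> z $ 3)\<^sup>2 = 0" if "z \<in> S" for z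
    using f_z_minimal_isotropic(1)[OF S(1) f that] cmat_orthogonal_dot[OF orth, of "\<sigma> z" "\<sigma> z"]
    by (simp add: f_z power2_eq_square sum_3)
  have nz: "\<sigma> z \<noteq> 0" if "z \<in> S" for z
    using f_z_minimal_isotropic(2)[OF S(1) f that] by (auto simp: f_z)
  \<comment> \<open>The unique solution of the linear equations
    \<open>spin = (\<mu> - t, - \<i> (\<mu> + t), - 2 s)\<close>; in these coordinates isotropy is
    the equation of the cone.\<close>
  define \<mu> s t where "\<mu> z = (\<sigma> z $ 1 + \<i> * \<sigma> z $ 2) / 2" and "s z = - \<sigma> z $ 3 / 2"
    and "t z = (- \<sigma> z $ 1 + \<i> * \<sigma> z $ 2) / 2" for z
  have \<sigma>_eq: "\<sigma> z $ 1 = \<mu> z - t z" "\<sigma> z $ 2 = - \<i> * (\<mu> z + t z)" "\<sigma> z $ 3 = - 2 * s z" for z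
    by (simp_all add: \<mu>_def s_def t_def field_simps)
  have st: "(s z)\<^sup>2 = \<mu> z * t z" if "z \<in> S" for z
  proof -
    have "4 * ((s z)\<^sup>2 - \<mu> z * t z) = (\<sigma> z $ 1)\<^sup>2 + (\<sigma> z $ 2)\<^sup>2 + (\<sigma> z $ 3)\<^sup>2"
      unfolding \<sigma>_eq by (simp add: power2_eq_square algebra_simps)
    then show ?thesis using iso[OF that] by simp
  qed
  have mt: "\<mu> z \<noteq> 0 \<or> t z \<noteq> 0" if "z \<in> S" for z
    using nz[OF that] st[OF that] \<sigma>_eq[of z] by (auto simp: vec_eq_iff forall_3)
  have mst: "\<mu> holomorphic_on S" "s holomorphic_on S" "t holomorphic_on S"
    unfolding \<mu>_def[abs_def] s_def[abs_def] t_def[abs_def] by (intro holomorphic_intros hol; simp)+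
  obtain a b where ab: "a holomorphic_on S" "b holomorphic_on S"
     "\<And>z. z \<in> S \<Longrightarrow> (a z)\<^sup>2 = \<mu> z \<and> a z * b z = s z \<and> (b z)\<^sup>2 = t z"
    using exists_holomorphic_veronese_lift[OF S(1,2) mst st mt] by blast
  have "\<sigma> z = spin (a z) (b z)" if "z \<in> S" for z
    using ab(3)[OF that] by (simp add: vec_eq_iff forall_3 spin_def \<sigma>_eq mult.assoc)
  then have rep: "spinor_rep S R f a b" "spinor_rep S R f (\<lambda>z. - a z) (\<lambda>z. - b z)"
    using f rot ab(1,2) by (auto simp: spinor_rep_def f_z spin_def intro!: holomorphic_intros)
  define x y where "x = dx f z0" and "y = dy f z0"
  have xy: "x \<bullet> x = y \<bullet> y" "x \<bullet> y = 0" "x \<noteq> 0"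
    using minimal_conformal[OF S(1) f S(3)] by (auto simp: x_def y_def)
  have R: "R = transpose (vector [x /\<^sub>R norm x, y /\<^sub>R norm y, cross3 x y /\<^sub>R norm (cross3 x y)])"
    by (simp add: R_def coord_frame_def unit_normal_def Let_def x_def y_def)
  have nn: "norm y = norm x" "norm x \<noteq> 0" using xy by (simp_all add: norm_eq)
  have "x \<bullet> x = norm x * norm x" "y \<bullet> y = norm x * norm x"
    using nn by (simp_all add: dot_square_norm power2_eq_square)
  then have "transpose R *v x = vector [norm x, 0, 0]" "transpose R *v y = vector [0, norm y, 0]"
    using nn xy(2) dot_cross_self[of x y]
    by (simp_all add: R transpose_transpose vec_eq_iff[where x = "_ *v _"] forall_3
        matrix_vector_mul_component inner_commute field_simps del: norm_eq_zero)
  moreover note nn(1)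
  moreover have nth: "f_z f z0 $ k = (of_real (x $ k) - \<i> * of_real (y $ k)) / 2" for k
    using f_z_nth[OF minimal_differentiable(1)[OF S(1) f S(3)]] by (simp add: x_def y_def)
  have "\<sigma> z0 = cvec ((transpose R *v x) /\<^sub>R 2) - (\<chi> k. \<i> * cvec ((transpose R *v y) /\<^sub>R 2) $ k)"
    by (simp add: \<sigma>_def vec_eq_iff nth cvec_def cmat_def matrix_vector_mult_def sum_3 field_simps)
  ultimately have "\<mu> z0 = of_real (norm x / 2)" "s z0 = 0"
    by (simp_all add: \<mu>_def s_def cvec_def)
  then have a2: "(a z0)\<^sup>2 = (of_real (sqrt (norm x / 2)))\<^sup>2" "b z0 = 0"
    using ab(3)[OF S(3)] xy(3) by (auto simp flip: of_real_power)
  have pos: "sqrt (norm x / 2) > 0" using xy(3) by simp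
  show ?thesis
  proof (cases "a z0 = of_real (sqrt (norm x / 2))")
    case True
    then have "normalized_at z0 a b" using a2 pos unfolding normalized_at_def by blast
    then show ?thesis using that rep(1) by (simp add: R_def)
  next
    case False
    then have "- a z0 = of_real (sqrt (norm x / 2))" using a2(1) by (auto simp: power2_eq_iff)
    then have "normalized_at z0 (\<lambda>z. - a z) (\<lambda>z. - b z)" using a2 pos unfolding normalized_at_def by auto
    then show ?thesis using that rep(2) by (simp add: R_def)
  qed
qed

lemma exists_spinor_immersion:
  assumes S: "open S" "simply_connected S" "z0 \<in> S" and R: "rotation_matrix R"
    and ab: "a holomorphic_on S" "b holomorphic_on S" "\<And>z. z \<in> S \<Longrightarrow> a z \<noteq> 0 \<or> b z \<noteq> 0"
  obtains f where "spinor_rep S R f a b" "f z0 = c"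
proof -
  have orth: "orthogonal_matrix R" using R by (simp add: rotation_matrix_def)
  have spin_hol: "(\<lambda>z. spin (a z) (b z) $ k) holomorphic_on S" for k
    using exhaust_3[of k] ab(1,2) by (auto simp: spin_def intro!: holomorphic_intros)
  have hol: "(\<lambda>z. (cmat R *v spin (a z) (b z)) $ k) holomorphic_on S" for k
    unfolding matrix_vector_mult_def by (auto intro!: holomorphic_intros spin_hol)
  obtain f where f: "f \<in> extensional S" "f z0 = c" "\<And>z. z \<in> S \<Longrightarrow> f differentiable (at z)"
    "\<And>z. z \<in> S \<Longrightarrow> f_z f z = cmat R *v spin (a z) (b z)"
    using exists_f_z[OF S hol, of c] by blast
  have "f \<in> minimal_immersions S"
  proof (rule minimal_immersionI[OF S(1) f(1,3)])
    show "(\<lambda>z. f_z f z $ k) holomorphic_on S" for k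
      by (rule holomorphic_transform[OF hol[of k]]) (simp add: f(4))
    fix z assume z: "z \<in> S"
    show "(\<Sum>k\<in>UNIV. (f_z f z $ k)\<^sup>2) = 0"
      using cmat_orthogonal_dot[OF orth, of "spin (a z) (b z)" "spin (a z) (b z)"] spin_isotropic[of "a z" "b z"]
      by (simp add: f(4)[OF z] power2_eq_square)
    show "f_z f z \<noteq> 0"
    proof
      assume "f_z f z = 0"
      then have "cmat (transpose R) *v (cmat R *v spin (a z) (b z)) = 0" by (simp add: f(4)[OF z])
      then have "spin (a z) (b z) = 0" by (simp add: cmat_inverse[OF orth])
      then show False using ab(3)[OF z] by (simp add: spin_eq_0_iff)
    qed
  qed
  then have "spinor_rep S R f a b" using f R ab by (simp add: spinor_rep_def)
  then show ?thesis using that f(2) by blast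
qed

section \<open>Dressing of immersions in terms of spinors\<close>


text \<open>Near any point of \<open>S\<close> the exceptional set of a sparse condition contains at
  most the point itself, so both functions have the same limit there.\<close>

lemma cosparse_eq_imp_eq:
  fixes f g :: "complex \<Rightarrow> 'a::t2_space"
  assumes "open S" "continuous_on S f" "continuous_on S g" "\<forall>\<^sub>\<approx>z\<in>S. f z = g z" "z \<in> S"
  shows "f z = g z"
proof (rule tendsto_unique)
  have "isCont f z" "isCont g z" using assms by (simp_all add: continuous_on_eq_continuous_at)
  then show "(f \<longlongrightarrow> f z) (at z)" by (simp add: isCont_def)
  show "(f \<longlongrightarrow> g z) (at z)"
    using \<open>isCont g z\<close> eventually_cosparse_imp_eventually_at[OF assms(4,5), of UNIV]
    by (subst tendsto_cong) (auto simp: isCont_def)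
qed simp

text \<open>Removing a sparse set from a connected open subset of the plane leaves it open and
  connected. Prescribing a limit at \<open>z0\<close> identifies the constant even if
  \<open>z0\<close> is exceptional.\<close>

lemma cosparse_constant:
  fixes k :: "complex \<Rightarrow> complex"
  assumes S: "open S" "connected S" "z0 \<in> S"
    and D: "\<forall>\<^sub>\<approx>z\<in>S. (k has_field_derivative 0) (at z)" and lim: "(k \<longlongrightarrow> c) (at z0)"
  shows "\<forall>\<^sub>\<approx>z\<in>S. k z = c"
proof -
  define T where "T = {z. \<not> (k has_field_derivative 0) (at z)}"
  have T: "T sparse_in S" using D by (simp add: eventually_cosparse T_def)
  have opn: "open (S - T)" and con: "connected (S - T)"
    using T S by (auto intro!: open_diff_sparse_pts sparse_imp_connected)
  have ev: "\<forall>\<^sub>\<approx>z\<in>S. z \<in> S - T"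
    using eventually_in_cosparse[OF subset_refl S(1)] D by eventually_elim (auto simp: T_def)
  have ev_at: "eventually (\<lambda>z. z \<in> S - T) (at z0)"
    using eventually_cosparse_imp_eventually_at[OF ev S(3)] .
  then obtain w where w: "w \<in> S - T" using eventually_happens'[OF at_neq_bot] by blast
  have const: "k z = k w" if "z \<in> S - T" for z
    by (rule has_derivative_zero_unique_connected[OF opn con _ that w])
       (auto simp: T_def has_field_derivative_def lambda_zero)
  have "((\<lambda>_. k w) \<longlongrightarrow> c) (at z0)"
    by (rule Lim_transform_eventually[OF lim]) (use ev_at const in \<open>auto elim: eventually_mono\<close>)
  then have "k w = c" by (simp add: tendsto_const_iff)
  with ev const show ?thesis by (auto elim: eventually_mono)
qed

lemma nonzero_cosparse:
  assumes "open S" "connected S" "z0 \<in> S" "f holomorphic_on S" "f z0 \<noteq> 0"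
  shows "\<forall>\<^sub>\<approx>z\<in>S. f z \<noteq> 0"
  unfolding eventually_cosparse_open_eq[OF assms(1)]
proof
  fix z assume "z \<in> S"
  from non_zero_neighbour_alt[OF assms(4,1,2) this assms(3,5)]
  show "\<forall>\<^sub>F z in at z. f z \<noteq> 0" by (rule eventually_mono) simp
qed

section \<open>Two by two matrices and the relevant part of a loop\<close>

lemma mat22_eq_iff:
  "mat22 a b c d = mat22 a' b' c' d' \<longleftrightarrow> a = a' \<and> b = b' \<and> c = c' \<and> d = d'"
  by (auto simp: vec_eq_iff forall_2)

lemma mat22_eqI:
  fixes A :: mat2
  assumes "A $ 1 $ 1 = a" "A $ 1 $ 2 = b" "A $ 2 $ 1 = c" "A $ 2 $ 2 = d"
  shows "A = mat22 a b c d"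
  using assms by (auto simp: vec_eq_iff forall_2)

lemma mat22_mult:
  "mat22 a b c d ** mat22 a' b' c' d' = mat22 (a * a' + b * c') (a * b' + b * d') (c * a' + d * c') (c * b' + d * d')"
  by (simp add: vec_eq_iff forall_2 matrix_matrix_mult_def sum_2)

lemma mat22_one: "mat 1 = mat22 1 0 0 1"
  by (simp add: vec_eq_iff forall_2 mat_def)

lemma matrix_inv_eqI:
  fixes A B :: "'a::field^'n^'n"
  assumes "A ** B = mat 1"
  shows "matrix_inv A = B"
proof -
  have BA: "B ** A = mat 1" using assms matrix_left_right_inverse by blast
  have "A ** matrix_inv A = mat 1 \<and> matrix_inv A ** A = mat 1"
    unfolding matrix_inv_def by (rule someI[of _ B]) (use assms BA in blast)
  then show ?thesis by (metis assms BA matrix_mul_assoc matrix_mul_lid matrix_mul_rid)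
qed

lemma matrix_inv_mat22:
  assumes "a * d - b * c = 1"
  shows "matrix_inv (mat22 a b c d) = mat22 d (- b) (- c) a"
  by (rule matrix_inv_eqI) (use assms in \<open>simp add: mat22_mult mat22_one mult.commute\<close>)

text \<open>The pair \<open>(r, \<beta>)\<close> is everything that dressing of immersions sees of
  \<open>h\<close>. That \<open>r\<close> is real and positive reflects the normalization of
  \<open>LplusP\<close> at the origin.\<close>

definition relevant_data :: "loop \<Rightarrow> real \<Rightarrow> complex \<Rightarrow> bool" where
  "relevant_data h r \<beta> \<longleftrightarrow> r > 0 \<and>
     (\<forall>l\<in>circle. relevant_part h l = mat22 (of_real r) (\<beta> * l) 0 (inverse (of_real r)))"

lemma relevant_data_inverse:
  assumes "relevant_data h r \<beta>" "l \<in> circle"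
  shows "matrix_inv (relevant_part h l) = mat22 (inverse (of_real r)) (- \<beta> * l) 0 (of_real r)"
proof -
  have "r > 0" "relevant_part h l = mat22 (of_real r) (\<beta> * l) 0 (inverse (of_real r))"
    using assms by (auto simp: relevant_data_def)
  then show ?thesis by (simp add: matrix_inv_mat22)
qed

context
  fixes S R f a b z0
  assumes S: "open S" "connected S" "z0 \<in> S"
    and rep: "spinor_rep S R f a b" and norm: "normalized_at z0 a b"
begin

lemma normalized_nonzero: "a z0 \<noteq> 0" and normalized_b: "b z0 = 0"
  using norm by (auto simp: normalized_at_def)

lemma spinor_nonzero_cosparse: "\<forall>\<^sub>\<approx>z\<in>S. a z \<noteq> 0"
  using nonzero_cosparse[OF S spinor_rep_holomorphic(1)[OF S(1) rep] normalized_nonzero] .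

lemma spinor_derivs:
  assumes "z \<in> S"
  shows "(a has_field_derivative deriv a z) (at z)" "(b has_field_derivative deriv b z) (at z)"
  using spinor_rep_holomorphic[OF S(1) rep] S(1) assms by (auto intro: holomorphic_derivI)

lemma f_z_adapted:
  assumes z: "z \<in> S"
  shows "f_z (in_adapted_coords z0 f) z = spin (a z) (b z)"
  unfolding in_adapted_coords_def spinor_rep_coord_frame[OF S(1) rep S(3) norm]
    f_z_linear[OF minimal_differentiable(1)[OF S(1) spinor_rep_minimal[OF S(1) rep] z]]
    spinor_rep_f_z[OF S(1) rep z]
  by (rule cmat_inverse(2)[OF spinor_rep_orthogonal[OF S(1) rep]])

lemma spinor_weierstrass_data:
  "weierstrass_data S z0 (in_adapted_coords z0 f) (\<lambda>z. (a z)\<^sup>2) (\<lambda>z. b z / a z)"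
  unfolding weierstrass_data_def
proof (intro conjI)
  note hol = spinor_rep_holomorphic[OF S(1) rep]
  show "(\<lambda>z. (a z)\<^sup>2) holomorphic_on S" by (intro holomorphic_intros hol)
  show "(\<lambda>z. b z / a z) meromorphic_on S"
    using hol S(1) by (intro meromorphic_intros analytic_on_imp_meromorphic_on) (auto simp: analytic_on_open)
  show "(\<lambda>z. b z / a z) analytic_on {z0}"
    using hol S normalized_nonzero
    by (intro analytic_intros holomorphic_on_imp_analytic_at[OF _ S(1)]) auto
  show "b z0 / a z0 = 0" by (simp add: normalized_b)
  show "\<exists>m::real. m > 0 \<and> (a z0)\<^sup>2 = of_real m"
    using norm unfolding normalized_at_def by (metis of_real_power zero_less_power)
  show "\<forall>\<^sub>\<approx>z\<in>S. f_z (in_adapted_coords z0 f) z = vector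
      [(a z)\<^sup>2 * (1 - (b z / a z)\<^sup>2), - \<i> * (a z)\<^sup>2 * (1 + (b z / a z)\<^sup>2), - 2 * (a z)\<^sup>2 * (b z / a z)]"
    using spinor_nonzero_cosparse eventually_in_cosparse[OF subset_refl S(1)]
  proof eventually_elim
    case (elim z)
    then show ?case
      by (simp add: f_z_adapted spin_def vec_eq_iff forall_3 power2_eq_square field_simps)
  qed
qed

text \<open>The first component of the data formula plus \<open>\<i>\<close> times the second is
  \<open>2 * \<mu>\<close>, whatever \<open>\<nu>\<close> is. Thus \<open>\<mu>\<close> is
  determined off a sparse set and, being continuous, everywhere.\<close>

lemma weierstrass_data_unique:
  assumes w: "weierstrass_data S z0 (in_adapted_coords z0 f) \<mu> \<nu>" and z: "z \<in> S"
  shows "\<mu> z = (a z)\<^sup>2"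
proof (rule cosparse_eq_imp_eq[OF S(1) _ _ _ z])
  show "continuous_on S \<mu>" "continuous_on S (\<lambda>z. (a z)\<^sup>2)"
    using w spinor_rep_holomorphic[OF S(1) rep]
    by (auto simp: weierstrass_data_def intro!: holomorphic_on_imp_continuous_on holomorphic_intros)
  have "\<forall>\<^sub>\<approx>z\<in>S. f_z (in_adapted_coords z0 f) z =
        vector [\<mu> z * (1 - (\<nu> z)\<^sup>2), - \<i> * \<mu> z * (1 + (\<nu> z)\<^sup>2), - 2 * \<mu> z * \<nu> z]"
    using w by (simp add: weierstrass_data_def)
  then show "\<forall>\<^sub>\<approx>z\<in>S. \<mu> z = (a z)\<^sup>2"
    using eventually_in_cosparse[OF subset_refl S(1)]
  proof eventually_elim
    case (elim z)
    then have "spin (a z) (b z) = vector [\<mu> z * (1 - (\<nu> z)\<^sup>2), - \<i> * \<mu> z * (1 + (\<nu> z)\<^sup>2), - 2 * \<mu> z * \<nu> z]"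
      by (simp add: f_z_adapted)
    then have 1: "(a z)\<^sup>2 - (b z)\<^sup>2 = \<mu> z * (1 - (\<nu> z)\<^sup>2)" and 2: "\<i> * ((a z)\<^sup>2 + (b z)\<^sup>2) = \<i> * (\<mu> z * (1 + (\<nu> z)\<^sup>2))"
      by (simp_all add: spin_def vec_eq_iff[where 'b=3] forall_3)
    from 2 have "(a z)\<^sup>2 + (b z)\<^sup>2 = \<mu> z * (1 + (\<nu> z)\<^sup>2)" by simp
    with 1 show ?case by algebra
  qed
qed

lemma normalized_at_dressing:
  assumes h: "relevant_data h r \<beta>" and g: "spinor_rep S R g (\<lambda>z. of_real r * a z - \<beta> * b z) (\<lambda>z. b z / of_real r)"
  shows "normalized_at z0 (\<lambda>z. of_real r * a z - \<beta> * b z) (\<lambda>z. b z / of_real r)"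
proof -
  obtain m :: real where "m > 0" "a z0 = of_real m" "b z0 = 0" using norm by (auto simp: normalized_at_def)
  then have "r * m > 0" "of_real r * a z0 - \<beta> * b z0 = of_real (r * m)" "b z0 / of_real r = 0"
    using h by (auto simp: relevant_data_def)
  then show ?thesis unfolding normalized_at_def by blast
qed

end

text \<open>The system is solved by \<open>a0 = a / c\<close> with
  \<open>c = r a - \<beta> b\<close> and the constant \<open>b1 = - \<beta>\<close>: by the quotient
  rule the derivative of \<open>a / c\<close> is
  \<open>- \<beta> * hopf f z / (2 * (c z)\<^sup>2)\<close>, which is the equation for
  \<open>b1\<close>.\<close>

lemma immersion_dressing_spinor:
  assumes S: "open S" "connected S" "z0 \<in> S"
    and rep: "spinor_rep S R f a b" and norm: "normalized_at z0 a b" and h: "relevant_data h r \<beta>"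
    and g: "spinor_rep S R g (\<lambda>z. of_real r * a z - \<beta> * b z) (\<lambda>z. b z / of_real r)" "g z0 = f z0"
  shows "immersion_dressing S z0 h f g"
proof -
  define c where "c z = of_real r * a z - \<beta> * b z" for z
  \<comment> \<open>\<open>b'\<close> is the second component of the new spinor, not a derivative of
    \<open>b\<close>.\<close>
  define b' where "b' z = b z / of_real r" for z
  have r: "r > 0" using h by (simp add: relevant_data_def)
  have rep': "spinor_rep S R g c b'" using g(1) by (simp add: c_def[abs_def] b'_def[abs_def])
  have norm': "normalized_at z0 c b'"
    using normalized_at_dressing[OF S rep norm h g(1)] by (simp add: c_def[abs_def] b'_def[abs_def])
  have c0: "c z0 = of_real r * a z0" using normalized_b[OF S rep norm] by (simp add: c_def)
  note a0 = normalized_nonzero[OF S rep norm]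
  have Dc: "(c has_field_derivative of_real r * deriv a z - \<beta> * deriv b z) (at z)"
   and Db': "(b' has_field_derivative deriv b z / of_real r) (at z)" if "z \<in> S" for z
    using spinor_derivs[OF S rep norm that] r unfolding c_def[abs_def] b'_def[abs_def]
    by (auto intro!: derivative_eq_intros)
  have hopf_f: "hopf f z = 2 * (b z * deriv a z - a z * deriv b z)" if "z \<in> S" for z
    by (rule spinor_rep_hopf[OF S(1) rep that])
  have hopf_g: "hopf g z = hopf f z" if "z \<in> S" for z
    unfolding spinor_rep_hopf[OF S(1) rep' that] hopf_f[OF that] DERIV_imp_deriv[OF Dc[OF that]] DERIV_imp_deriv[OF Db'[OF that]]
    using r by (simp add: c_def b'_def field_simps)
  have hol: "a holomorphic_on S" "c holomorphic_on S" "b' holomorphic_on S"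
    using spinor_rep_holomorphic[OF S(1) rep] spinor_rep_holomorphic[OF S(1) rep'] by auto
  note nz = spinor_nonzero_cosparse[OF S rep' norm'] and inS = eventually_in_cosparse[OF subset_refl S(1)]
  show ?thesis
    unfolding immersion_dressing_def
  proof (intro conjI ballI)
    show "\<exists>\<mu> \<nu> \<mu>' \<nu>' aa a' a0 b1. weierstrass_data S z0 (in_adapted_coords z0 f) \<mu> \<nu> \<and>
        weierstrass_data S z0 (in_adapted_coords z0 g) \<mu>' \<nu>' \<and>
        aa = (\<lambda>z. 2 * \<mu> z) \<and> a' = (\<lambda>z. 2 * \<mu>' z) \<and>
        a0 meromorphic_on S \<and> a0 analytic_on {z0} \<and> b1 holomorphic_on S \<and>
        (\<forall>\<^sub>\<approx>z\<in>S. (a0 z)\<^sup>2 = aa z / a' z) \<and> (\<forall>\<^sub>\<approx>z\<in>S. b1 z * hopf f z = a' z * deriv a0 z) \<and>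
        (\<forall>z\<in>S. deriv b1 z = 0) \<and>
        (\<forall>l\<in>circle. mat22 (a0 z0) (b1 z0 * l) 0 (inverse (a0 z0)) = matrix_inv (relevant_part h l)) \<and>
        (\<forall>\<^sub>\<approx>z\<in>S. deriv \<nu>' z = - hopf f z / a' z)"
    proof (intro exI conjI ballI)
      show "weierstrass_data S z0 (in_adapted_coords z0 f) (\<lambda>z. (a z)\<^sup>2) (\<lambda>z. b z / a z)"
        by (rule spinor_weierstrass_data[OF S rep norm])
      show "weierstrass_data S z0 (in_adapted_coords z0 g) (\<lambda>z. (c z)\<^sup>2) (\<lambda>z. b' z / c z)"
        by (rule spinor_weierstrass_data[OF S rep' norm'])
      \<comment> \<open>As a quotient of spinors \<open>a0\<close> is a square root of
        \<open>a / a'\<close> without any choice of branch; its value \<open>1 / r\<close> at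
        \<open>z0\<close> has the required sign.\<close>
      show "(\<lambda>z. a z / c z) meromorphic_on S"
        using hol S(1) by (intro meromorphic_intros analytic_on_imp_meromorphic_on) (auto simp: analytic_on_open)
      show "(\<lambda>z. a z / c z) analytic_on {z0}"
        using hol S normalized_nonzero[OF S rep' norm']
        by (intro analytic_intros holomorphic_on_imp_analytic_at[OF _ S(1)]) auto
      show "(\<lambda>_. - \<beta>) holomorphic_on S" by simp
      show "deriv (\<lambda>_. - \<beta>) z = 0" for z by simp
      show "\<forall>\<^sub>\<approx>z\<in>S. (a z / c z)\<^sup>2 = 2 * (a z)\<^sup>2 / (2 * (c z)\<^sup>2)" by (simp add: power_divide)
      show "\<forall>\<^sub>\<approx>z\<in>S. - \<beta> * hopf f z = 2 * (c z)\<^sup>2 * deriv (\<lambda>z. a z / c z) z"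
        using nz inS
      proof eventually_elim
        case (elim z)
        have "((\<lambda>z. a z / c z) has_field_derivative (deriv a z * c z - a z * (of_real r * deriv a z - \<beta> * deriv b z)) / (c z * c z)) (at z)"
          by (rule DERIV_divide[OF spinor_derivs(1)[OF S rep norm elim(2)] Dc[OF elim(2)] elim(1)])
        then show ?case
          using elim by (simp add: DERIV_imp_deriv hopf_f power2_eq_square) (simp add: c_def algebra_simps)
      qed
      show "mat22 (a z0 / c z0) (- \<beta> * l) 0 (inverse (a z0 / c z0)) = matrix_inv (relevant_part h l)"
        if "l \<in> circle" for l
        using r a0 by (simp add: relevant_data_inverse[OF h that] c0 mat22_eq_iff field_simps)
      show "\<forall>\<^sub>\<approx>z\<in>S. deriv (\<lambda>z. b' z / c z) z = - hopf f z / (2 * (c z)\<^sup>2)"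
        using nz inS
      proof eventually_elim
        case (elim z)
        have "((\<lambda>z. b' z / c z) has_field_derivative (deriv b z / of_real r * c z - b' z * (of_real r * deriv a z - \<beta> * deriv b z)) / (c z * c z)) (at z)"
          by (rule DERIV_divide[OF Db'[OF elim(2)] Dc[OF elim(2)] elim(1)])
        moreover have "deriv b z / of_real r * c z - b' z * (of_real r * deriv a z - \<beta> * deriv b z) = - hopf f z / 2"
          using r by (simp add: hopf_f elim b'_def c_def field_simps)
        ultimately show ?case by (simp add: DERIV_imp_deriv power2_eq_square)
      qed
    qed (rule refl)+
  qed (use g(2) hopf_g spinor_rep_coord_frame[OF S(1) rep S(3) norm] spinor_rep_coord_frame[OF S(1) rep' S(3) norm'] in auto)
qed

text \<open>
  The system for \<open>a0\<close> and \<open>b1\<close> says that \<open>1 / a0 + \<beta> \<nu>\<close> is constant, which makes it solvable in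
  closed form: \<open>a' = a (r - \<beta> \<nu>)\<^sup>2\<close>.
\<close>

lemma immersion_dressing_f_z:
  assumes S: "open S" "connected S" "z0 \<in> S"
    and rep: "spinor_rep S R f a b" and norm: "normalized_at z0 a b" and h: "relevant_data h r \<beta>"
    and g: "g \<in> minimal_immersions S" "immersion_dressing S z0 h f g" and z: "z \<in> S"
  shows "f_z g z = cmat R *v spin (of_real r * a z - \<beta> * b z) (b z / of_real r)"
proof -
  define c where "c z = of_real r * a z - \<beta> * b z" for z
  define b' where "b' z = b z / of_real r" for z
  have r: "r > 0" using h by (simp add: relevant_data_def)
  note hol = spinor_rep_holomorphic[OF S(1) rep]
  have Dc: "(c has_field_derivative of_real r * deriv a z - \<beta> * deriv b z) (at z)"
   and Db': "(b' has_field_derivative deriv b z / of_real r) (at z)" if "z \<in> S" for z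
    using spinor_derivs[OF S rep norm that] r unfolding c_def[abs_def] b'_def[abs_def]
    by (auto intro!: derivative_eq_intros)
  have hol': "c holomorphic_on S" "b' holomorphic_on S"
    unfolding c_def[abs_def] b'_def[abs_def] using hol r by (auto intro!: holomorphic_intros)
  note az0 = normalized_nonzero[OF S rep norm] normalized_b[OF S rep norm]
  have c0: "c z0 \<noteq> 0" "b' z0 = 0" using az0 r by (simp_all add: c_def b'_def)
  have hopf_f: "hopf f z = 2 * (b z * deriv a z - a z * deriv b z)" if "z \<in> S" for z
    by (rule spinor_rep_hopf[OF S(1) rep that])
  from g(2) obtain \<mu> \<nu> \<mu>' \<nu>' a0 b1 where fg: "coord_frame g z0 = coord_frame f z0"
    and w: "weierstrass_data S z0 (in_adapted_coords z0 f) \<mu> \<nu>"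
    and w': "weierstrass_data S z0 (in_adapted_coords z0 g) \<mu>' \<nu>'"
    and a0: "a0 meromorphic_on S" "a0 analytic_on {z0}" and b1: "b1 holomorphic_on S"
    and sq: "\<forall>\<^sub>\<approx>z\<in>S. (a0 z)\<^sup>2 = 2 * \<mu> z / (2 * \<mu>' z)"
    and ode: "\<forall>\<^sub>\<approx>z\<in>S. b1 z * hopf f z = 2 * \<mu>' z * deriv a0 z"
    and b1': "\<forall>z\<in>S. deriv b1 z = 0"
    and init: "\<forall>l\<in>circle. mat22 (a0 z0) (b1 z0 * l) 0 (inverse (a0 z0)) = matrix_inv (relevant_part h l)"
    and \<nu>': "\<forall>\<^sub>\<approx>z\<in>S. deriv \<nu>' z = - hopf f z / (2 * \<mu>' z)"
    unfolding immersion_dressing_def by blast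
  note inS = eventually_in_cosparse[OF subset_refl S(1)]
  \<comment> \<open>A single loop parameter suffices to read off both initial values.\<close>
  have "mat22 (a0 z0) (b1 z0 * 1) 0 (inverse (a0 z0)) = mat22 (inverse (of_real r)) (- \<beta> * 1) 0 (of_real r)"
    using bspec[OF init, of 1] relevant_data_inverse[OF h, of 1] by simp
  then have init: "a0 z0 = inverse (of_real r)" "b1 z0 = - \<beta>" by (simp_all add: mat22_eq_iff)
  have b1_const: "\<forall>\<^sub>\<approx>z\<in>S. b1 z = - \<beta>"
  proof (rule cosparse_constant[OF S])
    show "\<forall>\<^sub>\<approx>z\<in>S. (b1 has_field_derivative 0) (at z)"
      using inS by eventually_elim (use b1 b1' S(1) in \<open>metis holomorphic_derivI\<close>)
    have "isCont b1 z0"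
      using b1 S by (meson holomorphic_on_imp_continuous_on continuous_on_eq_continuous_at)
    then show "b1 \<midarrow>z0\<rightarrow> - \<beta>" using init(2) by (simp add: isCont_def)
  qed
  have \<mu>: "\<mu> z = (a z)\<^sup>2" if "z \<in> S" for z by (rule weierstrass_data_unique[OF S rep norm w that])
  have \<mu>'_hol: "\<mu>' holomorphic_on S" and "\<mu>' z0 \<noteq> 0" and \<nu>'_mero: "\<nu>' meromorphic_on S"
    and \<nu>'_z0: "\<nu>' analytic_on {z0}" "\<nu>' z0 = 0"
    and g_data: "\<forall>\<^sub>\<approx>z\<in>S. f_z (in_adapted_coords z0 g) z =
        vector [\<mu>' z * (1 - (\<nu>' z)\<^sup>2), - \<i> * \<mu>' z * (1 + (\<nu>' z)\<^sup>2), - 2 * \<mu>' z * \<nu>' z]"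
    using w' by (auto simp: weierstrass_data_def)
  have \<mu>'_nz: "\<forall>\<^sub>\<approx>z\<in>S. \<mu>' z \<noteq> 0" using nonzero_cosparse[OF S \<mu>'_hol \<open>\<mu>' z0 \<noteq> 0\<close>] .
  note a_nz = spinor_nonzero_cosparse[OF S rep norm]
  have cont_at: "isCont F z0" if "F holomorphic_on S" for F :: "complex \<Rightarrow> complex"
    using that S by (meson holomorphic_on_imp_continuous_on continuous_on_eq_continuous_at)
  have "\<forall>\<^sub>\<approx>z\<in>S. inverse (a0 z) + \<beta> * (b z / a z) = of_real r"
  proof (rule cosparse_constant[OF S])
    show "\<forall>\<^sub>\<approx>z\<in>S. ((\<lambda>z. inverse (a0 z) + \<beta> * (b z / a z)) has_field_derivative 0) (at z)"
      using inS b1_const \<mu>'_nz a_nz sq ode meromorphic_on_imp_analytic_cosparse[OF a0(1)]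
    proof eventually_elim
      case (elim z)
      have a0': "(a0 has_field_derivative deriv a0 z) (at z)"
        using elim by (metis analytic_on_imp_differentiable_at field_differentiable_derivI singletonI)
      have sq': "(a0 z)\<^sup>2 * \<mu>' z = (a z)\<^sup>2" using elim by (simp add: \<mu> field_simps)
      then have nz: "a0 z \<noteq> 0" using elim by auto
      have "((\<lambda>z. inverse (a0 z) + \<beta> * (b z / a z)) has_field_derivative
          - (inverse (a0 z) * deriv a0 z * inverse (a0 z))
          + \<beta> * ((deriv b z * a z - b z * deriv a z) / (a z * a z))) (at z)"
        by (intro DERIV_add DERIV_inverse' DERIV_cmult DERIV_divide a0' nz spinor_derivs[OF S rep norm] elim)
      also have "- (inverse (a0 z) * deriv a0 z * inverse (a0 z))
          + \<beta> * ((deriv b z * a z - b z * deriv a z) / (a z * a z)) = 0"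
      proof -
        \<comment> \<open>The equation for \<open>b1\<close> expresses \<open>deriv a0\<close>
          through the unknown \<open>\<mu>'\<close>; the relation \<open>a0^2 * \<mu>' = a^2\<close>
          then replaces \<open>\<mu>'\<close> by the known \<open>a^2\<close>, and the two summands
          cancel.\<close>
        have "deriv a0 z = - \<beta> * hopf f z / (2 * \<mu>' z)" using elim by (simp add: field_simps)
        then have "inverse (a0 z) * deriv a0 z * inverse (a0 z) = - \<beta> * hopf f z / (2 * ((a0 z)\<^sup>2 * \<mu>' z))"
          by (simp add: field_simps power2_eq_square)
        then have X: "inverse (a0 z) * deriv a0 z * inverse (a0 z) = - \<beta> * hopf f z / (2 * (a z)\<^sup>2)"
          unfolding sq' .
        have "z \<in> S" "a z \<noteq> 0" using elim by auto
        then show ?thesis unfolding X hopf_f[OF \<open>z \<in> S\<close>]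
          by (simp add: field_simps power2_eq_square)
      qed
      finally show ?case .
    qed
    have "isCont a0 z0" using a0(2) by (rule analytic_at_imp_isCont)
    then have "isCont (\<lambda>z. inverse (a0 z) + \<beta> * (b z / a z)) z0"
      using init(1) r az0 cont_at[OF hol(1)] cont_at[OF hol(2)] by (intro continuous_intros) auto
    then show "(\<lambda>z. inverse (a0 z) + \<beta> * (b z / a z)) \<midarrow>z0\<rightarrow> of_real r"
      using init(1) az0 by (simp add: isCont_def)
  qed
  then have "\<forall>\<^sub>\<approx>z\<in>S. \<mu>' z = (c z)\<^sup>2"
    using inS \<mu>'_nz a_nz sq
  proof eventually_elim
    case (elim z)
    then have sq': "(a0 z)\<^sup>2 * \<mu>' z = (a z)\<^sup>2" by (simp add: \<mu> field_simps)
    then have nz: "a0 z \<noteq> 0" using elim by auto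
    \<comment> \<open>The constancy relation multiplied by \<open>a0 z * a z\<close>; squaring it
      identifies \<open>\<mu>'\<close>.\<close>
    have "c z * a0 z = a z" using elim nz by (simp add: c_def field_simps)
    then have "(a0 z)\<^sup>2 * \<mu>' z = (a0 z)\<^sup>2 * (c z)\<^sup>2" using sq' by (metis power_mult_distrib mult.commute)
    then show ?case using nz by simp
  qed
  then have \<mu>'_eq: "\<mu>' z = (c z)\<^sup>2" if "z \<in> S" for z
    using that by (intro cosparse_eq_imp_eq[OF S(1)])
      (auto intro!: holomorphic_on_imp_continuous_on holomorphic_intros \<mu>'_hol hol')
  note c_nz = nonzero_cosparse[OF S hol'(1) c0(1)]
  \<comment> \<open>Now that \<open>\<mu>'\<close> is known, \<open>\<nu>'\<close> and
    \<open>b' / c\<close> have the same derivative off a sparse set, and both vanish at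
    \<open>z0\<close>.\<close>
  have "\<forall>\<^sub>\<approx>z\<in>S. \<nu>' z - b' z / c z = 0"
  proof (rule cosparse_constant[OF S])
    show "\<forall>\<^sub>\<approx>z\<in>S. ((\<lambda>z. \<nu>' z - b' z / c z) has_field_derivative 0) (at z)"
      using inS c_nz \<nu>' meromorphic_on_imp_analytic_cosparse[OF \<nu>'_mero]
    proof eventually_elim
      case (elim z)
      have \<nu>D: "(\<nu>' has_field_derivative deriv \<nu>' z) (at z)"
        using elim by (metis analytic_on_imp_differentiable_at field_differentiable_derivI singletonI)
      have "((\<lambda>z. \<nu>' z - b' z / c z) has_field_derivative deriv \<nu>' z -
          (deriv b z / of_real r * c z - b' z * (of_real r * deriv a z - \<beta> * deriv b z)) / (c z * c z)) (at z)"
        by (intro DERIV_diff DERIV_divide \<nu>D Db' Dc elim)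
      moreover have "deriv b z / of_real r * c z - b' z * (of_real r * deriv a z - \<beta> * deriv b z) = - hopf f z / 2"
        using r by (simp add: hopf_f elim b'_def c_def field_simps)
      ultimately show ?case using elim by (simp add: \<mu>'_eq power2_eq_square)
    qed
    have "isCont (\<lambda>z. \<nu>' z - b' z / c z) z0"
      using analytic_at_imp_isCont[OF \<nu>'_z0(1)] c0 cont_at[OF hol'(1)] cont_at[OF hol'(2)]
      by (intro continuous_intros) auto
    then show "(\<lambda>z. \<nu>' z - b' z / c z) \<midarrow>z0\<rightarrow> 0"
      using \<nu>'_z0(2) c0 by (simp add: isCont_def)
  qed
  then have ev: "\<forall>\<^sub>\<approx>z\<in>S. f_z (in_adapted_coords z0 g) z = spin (c z) (b' z)"
    using g_data inS c_nz
  proof eventually_elim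
    case (elim z)
    then have b'_eq: "b' z = c z * \<nu>' z" by simp
    show ?case unfolding elim(2) \<mu>'_eq[OF elim(3)] b'_eq
      by (simp add: spin_def vec_eq_iff forall_3 power2_eq_square algebra_simps)
  qed
  \<comment> \<open>Agreement of the frames at \<open>z0\<close> makes the adapted coordinates of
    \<open>g\<close> and \<open>f\<close> differ from the original ones by the same
    rotation.\<close>
  have R: "coord_frame g z0 = R"
    using fg spinor_rep_coord_frame[OF S(1) rep S(3) norm] by simp
  note orth = spinor_rep_orthogonal[OF S(1) rep]
  have adapted: "f_z (in_adapted_coords z0 g) z = cmat (transpose R) *v f_z g z" if "z \<in> S" for z
    unfolding in_adapted_coords_def R by (rule f_z_linear[OF minimal_differentiable(1)[OF S(1) g(1) that]])
  have "\<forall>\<^sub>\<approx>z\<in>S. f_z g z = cmat R *v spin (c z) (b' z)"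
    using ev inS
  proof eventually_elim
    case (elim z)
    then show ?case by (metis adapted cmat_inverse(1)[OF orth])
  qed
  then have ev': "\<forall>\<^sub>\<approx>z\<in>S. f_z g z $ k = (cmat R *v spin (c z) (b' z)) $ k" for k
    by (rule eventually_mono) simp
  have spin_hol: "(\<lambda>z. spin (c z) (b' z) $ k) holomorphic_on S" for k
    using exhaust_3[of k] hol' by (auto simp: spin_def intro!: holomorphic_intros)
  have "f_z g z $ k = (cmat R *v spin (c z) (b' z)) $ k" for k
  proof (rule cosparse_eq_imp_eq[OF S(1) _ _ ev' z])
    show "continuous_on S (\<lambda>z. f_z g z $ k)"
      by (rule holomorphic_on_imp_continuous_on[OF f_z_minimal_holomorphic[OF S(1) g(1)]])
    show "continuous_on S (\<lambda>z. (cmat R *v spin (c z) (b' z)) $ k)"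
      unfolding matrix_vector_mult_def
      by (auto intro!: holomorphic_on_imp_continuous_on holomorphic_intros spin_hol)
  qed
  then show ?thesis by (simp add: vec_eq_iff c_def b'_def)
qed

section \<open>Positive loops\<close>


text \<open>The disc algebra. Continuity up to the boundary is what allows Cauchy's formula on the
  unit circle itself, where the loops live.\<close>

definition disc_alg :: "(complex \<Rightarrow> complex) \<Rightarrow> bool" where
  "disc_alg f \<longleftrightarrow> continuous_on (cball 0 1) f \<and> f holomorphic_on ball 0 1"

lemma disc_alg_const: "disc_alg (\<lambda>_. c)"
  and disc_alg_ident: "disc_alg (\<lambda>l. l)"
  and disc_alg_add: "disc_alg f \<Longrightarrow> disc_alg g \<Longrightarrow> disc_alg (\<lambda>l. f l + g l)"
  and disc_alg_diff: "disc_alg f \<Longrightarrow> disc_alg g \<Longrightarrow> disc_alg (\<lambda>l. f l - g l)"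
  and disc_alg_mult: "disc_alg f \<Longrightarrow> disc_alg g \<Longrightarrow> disc_alg (\<lambda>l. f l * g l)"
  and disc_alg_minus: "disc_alg f \<Longrightarrow> disc_alg (\<lambda>l. - f l)"
  by (auto simp: disc_alg_def intro!: continuous_intros holomorphic_intros)

lemmas disc_alg_intros = disc_alg_const disc_alg_ident disc_alg_add disc_alg_diff disc_alg_mult disc_alg_minus

lemma disc_alg_reflect:
  assumes "disc_alg f"
  shows "disc_alg (\<lambda>l. f (- l))"
proof -
  have "continuous_on (cball 0 1) (\<lambda>l. f (- l))"
    by (rule continuous_on_compose2[of "cball 0 1" f]) (use assms in \<open>auto simp: disc_alg_def intro!: continuous_intros\<close>)
  moreover have "(f \<circ> uminus) holomorphic_on ball 0 1"
    by (rule holomorphic_on_compose_gen[of _ _ _ "ball 0 1"]) (use assms in \<open>auto simp: disc_alg_def intro!: holomorphic_intros\<close>)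
  ultimately show ?thesis by (simp add: disc_alg_def o_def)
qed

lemma disc_alg_integral:
  assumes "disc_alg f"
  shows "contour_integral (circlepath 0 1) (\<lambda>l. f l / l) = 2 * of_real pi * \<i> * f 0"
  using Cauchy_integral_circlepath[of 0 1 f 0] assms
  by (intro contour_integral_unique) (simp add: disc_alg_def)

lemma circle_integral_cong:
  assumes "\<And>l. l \<in> circle \<Longrightarrow> f l = g l"
  shows "contour_integral (circlepath 0 1) f = contour_integral (circlepath 0 1) g"
  by (rule contour_integral_cong) (use assms in \<open>auto simp: dist_norm\<close>)

lemma disc_alg_eq_0:
  assumes "disc_alg f" "\<And>l. l \<in> circle \<Longrightarrow> f l = 0"
  shows "f 0 = 0"
proof -
  have "contour_integral (circlepath 0 1) (\<lambda>l. f l / l) = contour_integral (circlepath 0 1) (\<lambda>l. 0)"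
    by (rule circle_integral_cong) (simp add: assms(2))
  then show ?thesis using disc_alg_integral[OF assms(1)] by simp
qed

text \<open>\<open>f l + f (- l)\<close> vanishes on the circle, hence at the centre, where it
  equals \<open>2 * f 0\<close>. So the twisting condition alone makes positive loops diagonal at
  the origin.\<close>

lemma disc_alg_odd:
  assumes "disc_alg f" "\<And>l. l \<in> circle \<Longrightarrow> f (- l) = - f l"
  shows "f 0 = 0"
proof -
  have "f 0 + f (- 0) = 0"
    by (rule disc_alg_eq_0[of "\<lambda>l. f l + f (- l)"])
       (use assms in \<open>auto intro!: disc_alg_intros disc_alg_reflect\<close>)
  then show ?thesis by simp
qed

text \<open>Inside the disc the quotient has a removable singularity; near the boundary it is an
  ordinary quotient of continuous functions. Continuity is glued along a smaller closed disc and the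
  complementary closed annulus.\<close>

lemma disc_alg_factor:
  assumes f: "disc_alg f" "f 0 = 0"
  obtains g where "disc_alg g" "\<And>l. f l = l * g l"
proof
  define g where "g l = (if l = 0 then deriv f 0 else (f l - f 0) / (l - 0))" for l
  have hol: "g holomorphic_on ball 0 1"
    unfolding g_def[abs_def] by (rule pole_lemma_open) (use f in \<open>auto simp: disc_alg_def\<close>)
  have "continuous_on (cball 0 (1/2)) g"
    by (rule holomorphic_on_imp_continuous_on[OF holomorphic_on_subset[OF hol]]) auto
  moreover have "continuous_on (cball 0 1 - ball 0 (1/2)) (\<lambda>l. f l / l)"
    using f by (intro continuous_intros) (auto simp: disc_alg_def intro: continuous_on_subset)
  then have "continuous_on (cball 0 1 - ball 0 (1/2)) g"
    by (rule continuous_on_eq) (auto simp: g_def f)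
  moreover have "cball 0 1 = cball 0 (1/2) \<union> (cball 0 1 - ball 0 (1/2 :: real) :: complex set)" by auto
  moreover have "closed (cball 0 1 - ball 0 (1/2 :: real) :: complex set)" by (simp add: closed_Diff)
  ultimately have "continuous_on (cball 0 1) g"
    by (metis closed_cball continuous_on_closed_Un)
  with hol show "disc_alg g" by (simp add: disc_alg_def)
  show "f l = l * g l" for l using f by (simp add: g_def)
qed

section \<open>Twisted and positive loops in terms of their entries\<close>

lemma continuous_on_matI:
  fixes f :: "'a::topological_space \<Rightarrow> 'b::topological_space^'n^'m"
  assumes "\<And>i j. continuous_on S (\<lambda>x. f x $ i $ j)"
  shows "continuous_on S f"
proof -
  have "continuous_on S (\<lambda>x. \<chi> i j. f x $ i $ j)"
    by (intro continuous_on_vec_lambda assms)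
  then show ?thesis by (simp add: vec_lambda_eta)
qed

lemma continuous_on_mat_entry:
  fixes f :: "'a::topological_space \<Rightarrow> 'b::topological_space^'n^'m"
  shows "continuous_on S f \<Longrightarrow> continuous_on S (\<lambda>x. f x $ i $ j)"
  by (intro continuous_intros)

lemma mat2_all: "(\<forall>i j. P (i :: 2) (j :: 2)) \<longleftrightarrow> P 1 1 \<and> P 1 2 \<and> P 2 1 \<and> P 2 2"
  by (auto simp: forall_2)

lemma mat22_eta: "(A :: mat2) = mat22 (A $ 1 $ 1) (A $ 1 $ 2) (A $ 2 $ 1) (A $ 2 $ 2)"
  by (rule mat22_eqI) simp_all

lemma minus_in_circle: "l \<in> circle \<Longrightarrow> - l \<in> (circle :: complex set)" by simp

lemma twisted_loopsI:
  fixes g :: loop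
  assumes "g \<in> extensional circle" "\<And>l. l \<in> circle \<Longrightarrow> g l = mat22 (A l) (B l) (C l) (D l)"
    and "continuous_on circle A" "continuous_on circle B" "continuous_on circle C" "continuous_on circle D"
    and "\<And>l. l \<in> circle \<Longrightarrow> A l * D l - B l * C l = 1"
    and "\<And>l. l \<in> circle \<Longrightarrow> A (- l) = A l" "\<And>l. l \<in> circle \<Longrightarrow> D (- l) = D l"
    and "\<And>l. l \<in> circle \<Longrightarrow> B (- l) = - B l" "\<And>l. l \<in> circle \<Longrightarrow> C (- l) = - C l"
  shows "g \<in> twisted_loops"
proof -
  have "continuous_on circle (\<lambda>l. mat22 (A l) (B l) (C l) (D l))"
  proof (rule continuous_on_matI)
    have "\<forall>i j. continuous_on circle (\<lambda>l. mat22 (A l) (B l) (C l) (D l) $ i $ j)"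
      unfolding mat2_all using assms by simp
    then show "continuous_on circle (\<lambda>l. mat22 (A l) (B l) (C l) (D l) $ i $ j)" for i j by blast
  qed
  then have "continuous_on circle g" by (rule continuous_on_eq) (simp add: assms(2))
  then show ?thesis
    using assms minus_in_circle by (simp add: twisted_loops_def det_2)
qed

lemma twisted_loopsD:
  assumes "g \<in> twisted_loops"
  shows "g \<in> extensional circle" "continuous_on circle (\<lambda>l. g l $ i $ j)"
    "l \<in> circle \<Longrightarrow> g l $ 1 $ 1 * g l $ 2 $ 2 - g l $ 1 $ 2 * g l $ 2 $ 1 = 1"
    "l \<in> circle \<Longrightarrow> g (- l) $ 1 $ 1 = g l $ 1 $ 1" "l \<in> circle \<Longrightarrow> g (- l) $ 2 $ 2 = g l $ 2 $ 2"
    "l \<in> circle \<Longrightarrow> g (- l) $ 1 $ 2 = - g l $ 1 $ 2" "l \<in> circle \<Longrightarrow> g (- l) $ 2 $ 1 = - g l $ 2 $ 1"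
    "continuous_on circle g"
  using assms by (auto simp: twisted_loops_def det_2 intro!: continuous_on_mat_entry)

lemma loop_mult_twisted:
  assumes "g \<in> twisted_loops" "h \<in> twisted_loops"
  shows "loop_mult g h \<in> twisted_loops"
proof (rule twisted_loopsI)
  note g = twisted_loopsD[OF assms(1)] and h = twisted_loopsD[OF assms(2)]
  show "loop_mult g h \<in> extensional circle" by (simp add: loop_mult_def)
  show "loop_mult g h l = mat22 (g l $ 1 $ 1 * h l $ 1 $ 1 + g l $ 1 $ 2 * h l $ 2 $ 1)
     (g l $ 1 $ 1 * h l $ 1 $ 2 + g l $ 1 $ 2 * h l $ 2 $ 2)
     (g l $ 2 $ 1 * h l $ 1 $ 1 + g l $ 2 $ 2 * h l $ 2 $ 1)
     (g l $ 2 $ 1 * h l $ 1 $ 2 + g l $ 2 $ 2 * h l $ 2 $ 2)" if "l \<in> circle" for l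
    using that by (intro mat22_eqI) (simp_all add: loop_mult_def matrix_matrix_mult_def sum_2)
  fix l :: complex assume l: "l \<in> circle"
  have "(g l $ 1 $ 1 * h l $ 1 $ 1 + g l $ 1 $ 2 * h l $ 2 $ 1) * (g l $ 2 $ 1 * h l $ 1 $ 2 + g l $ 2 $ 2 * h l $ 2 $ 2) -
         (g l $ 1 $ 1 * h l $ 1 $ 2 + g l $ 1 $ 2 * h l $ 2 $ 2) * (g l $ 2 $ 1 * h l $ 1 $ 1 + g l $ 2 $ 2 * h l $ 2 $ 1)
      = (g l $ 1 $ 1 * g l $ 2 $ 2 - g l $ 1 $ 2 * g l $ 2 $ 1) * (h l $ 1 $ 1 * h l $ 2 $ 2 - h l $ 1 $ 2 * h l $ 2 $ 1)"
    by algebra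
  then show "(g l $ 1 $ 1 * h l $ 1 $ 1 + g l $ 1 $ 2 * h l $ 2 $ 1) * (g l $ 2 $ 1 * h l $ 1 $ 2 + g l $ 2 $ 2 * h l $ 2 $ 2) -
         (g l $ 1 $ 1 * h l $ 1 $ 2 + g l $ 1 $ 2 * h l $ 2 $ 2) * (g l $ 2 $ 1 * h l $ 1 $ 1 + g l $ 2 $ 2 * h l $ 2 $ 1) = 1"
    by (simp add: g(3)[OF l] h(3)[OF l])
qed (use twisted_loopsD[OF assms(1)] twisted_loopsD[OF assms(2)] in \<open>auto intro!: continuous_intros\<close>)

text \<open>Only the upper left entry at 0 has to be known: the off-diagonal entries are odd and
  vanish there, and the determinant identity passes from the circle to the origin, which gives
  \<open>D 0\<close>.\<close>

lemma LplusPI: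
  assumes g: "g \<in> twisted_loops" and alg: "disc_alg A" "disc_alg B" "disc_alg C" "disc_alg D"
    and entries: "\<And>l. l \<in> circle \<Longrightarrow> g l = mat22 (A l) (B l) (C l) (D l)"
    and A0: "A 0 = of_real r" "r > 0"
  shows "g \<in> LplusP"
proof -
  note tw = twisted_loopsD[OF g]
  have "B 0 = 0" "C 0 = 0"
    by (rule disc_alg_odd, fact, use tw(6,7) entries minus_in_circle in \<open>fastforce\<close>)+
  have "A 0 * D 0 - B 0 * C 0 - 1 = 0"
    by (rule disc_alg_eq_0[of "\<lambda>l. A l * D l - B l * C l - 1"])
       (use tw(3) entries in \<open>auto intro!: disc_alg_intros alg\<close>)
  then have "D 0 = inverse (of_real r)" using A0 \<open>B 0 = 0\<close> by (simp add: field_simps)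
  define H where "H l = mat22 (A l) (B l) (C l) (D l)" for l
  have "\<forall>i j. disc_alg (\<lambda>l. H l $ i $ j)"
    unfolding mat2_all H_def using alg by simp
  then have "continuous_on (cball 0 1) H" "mat_holomorphic_on H (ball 0 1)"
    by (auto intro!: continuous_on_matI simp: disc_alg_def mat_holomorphic_on_def)
  then have "extends_inside g H" using entries by (simp add: extends_inside_def H_def)
  moreover have "H 0 = mat22 (of_real r) 0 0 (of_real (inverse r))"
    using A0 \<open>B 0 = 0\<close> \<open>C 0 = 0\<close> \<open>D 0 = _\<close> by (simp add: H_def)
  ultimately show ?thesis using g A0(2) unfolding LplusP_def by blast
qed

text \<open>The upper right entry is \<open>l * B l\<close>, so that \<open>\<beta>\<close> is its \<open>l^1\<close> coefficient.\<close>

definition plus_entries :: "loop \<Rightarrow> (complex \<Rightarrow> complex) \<Rightarrow> (complex \<Rightarrow> complex) \<Rightarrow>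
    (complex \<Rightarrow> complex) \<Rightarrow> (complex \<Rightarrow> complex) \<Rightarrow> real \<Rightarrow> complex \<Rightarrow> bool" where
  "plus_entries h A B C D r \<beta> \<longleftrightarrow> h \<in> twisted_loops \<and>
     disc_alg A \<and> disc_alg B \<and> disc_alg C \<and> disc_alg D \<and>
     (\<forall>l\<in>circle. h l = mat22 (A l) (l * B l) (C l) (D l)) \<and>
     r > 0 \<and> A 0 = of_real r \<and> B 0 = \<beta> \<and> C 0 = 0 \<and> D 0 = inverse (of_real r)"

lemma LplusP_entries:
  assumes "h \<in> LplusP"
  obtains A B C D r \<beta> where "plus_entries h A B C D r \<beta>"
proof -
  from assms obtain H r where h: "h \<in> twisted_loops" and H: "extends_inside h H" and r: "r > 0"
    and H0: "H 0 = mat22 (of_real r) 0 0 (of_real (inverse r))"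
    unfolding LplusP_def by auto
  have alg: "disc_alg (\<lambda>l. H l $ i $ j)" for i j
    using H by (auto simp: extends_inside_def disc_alg_def mat_holomorphic_on_def intro: continuous_on_mat_entry)
  obtain B where B: "disc_alg B" "\<And>l. H l $ 1 $ 2 = l * B l"
    using disc_alg_factor[OF alg[of 1 2]] by (auto simp: H0)
  have "h l = mat22 (H l $ 1 $ 1) (l * B l) (H l $ 2 $ 1) (H l $ 2 $ 2)" if "l \<in> circle" for l
    using H that unfolding extends_inside_def B(2)[symmetric] by (metis mat22_eta)
  then have "plus_entries h (\<lambda>l. H l $ 1 $ 1) B (\<lambda>l. H l $ 2 $ 1) (\<lambda>l. H l $ 2 $ 2) r (B 0)"
    unfolding plus_entries_def using h alg B r by (simp add: H0)
  then show ?thesis by (rule that)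
qed

lemma plus_entries_LplusP: "plus_entries h A B C D r \<beta> \<Longrightarrow> h \<in> LplusP"
  by (rule LplusPI[of h A "\<lambda>l. l * B l" C D r]) (auto simp: plus_entries_def intro!: disc_alg_intros)

text \<open>Cauchy's formula turns the Fourier coefficients into values at 0. For the upper right
  entry \<open>l * B l\<close> the division by \<open>l^2\<close> leaves
  \<open>B l / l\<close>.\<close>

lemma plus_entries_relevant_data:
  assumes "plus_entries h A B C D r \<beta>"
  shows "relevant_data h r \<beta>"
proof -
  have e: "h l = mat22 (A l) (l * B l) (C l) (D l)" if "l \<in> circle" for l
    using assms that by (auto simp: plus_entries_def)
  have alg: "disc_alg A" "disc_alg B" "disc_alg D" and v: "r > 0" "A 0 = of_real r" "B 0 = \<beta>" "D 0 = inverse (of_real r)"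
    using assms by (auto simp: plus_entries_def)
  have "loop_coeff h 0 1 1 = contour_integral (circlepath 0 1) (\<lambda>l. A l / l) / (2 * of_real pi * \<i>)"
       "loop_coeff h 0 2 2 = contour_integral (circlepath 0 1) (\<lambda>l. D l / l) / (2 * of_real pi * \<i>)"
       "loop_coeff h 1 1 2 = contour_integral (circlepath 0 1) (\<lambda>l. B l / l) / (2 * of_real pi * \<i>)"
    unfolding loop_coeff_def
    by (intro arg_cong[of _ _ "\<lambda>x. x / (2 * of_real pi * \<i>)"] circle_integral_cong; force simp: e)+
  then have "loop_coeff h 0 1 1 = of_real r" "loop_coeff h 0 2 2 = inverse (of_real r)" "loop_coeff h 1 1 2 = \<beta>"
    using v by (simp_all add: disc_alg_integral alg)
  then show ?thesis using v(1) by (simp add: relevant_data_def relevant_part_def)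
qed

text \<open>In the diagonal entries the mixed products carry a factor \<open>l\<close>, so at the
  origin the pairs \<open>(r, \<beta>)\<close> multiply like upper triangular matrices of
  determinant 1. This is why passing to the relevant part is compatible with the group law.\<close>

lemma plus_entries_mult:
  assumes "plus_entries g A B C D r \<beta>" "plus_entries h A' B' C' D' r' \<beta>'"
  shows "plus_entries (loop_mult g h) (\<lambda>l. A l * A' l + l * B l * C' l) (\<lambda>l. A l * B' l + B l * D' l)
     (\<lambda>l. C l * A' l + D l * C' l) (\<lambda>l. C l * (l * B' l) + D l * D' l) (r * r') (r * \<beta>' + \<beta> * inverse r')"
proof -
  have "loop_mult g h \<in> twisted_loops"
    using assms by (intro loop_mult_twisted) (auto simp: plus_entries_def)
  moreover have "loop_mult g h l = mat22 (A l * A' l + l * B l * C' l) (l * (A l * B' l + B l * D' l))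
     (C l * A' l + D l * C' l) (C l * (l * B' l) + D l * D' l)" if "l \<in> circle" for l
    using assms that by (simp add: plus_entries_def loop_mult_def mat22_mult mat22_eq_iff algebra_simps)
  ultimately show ?thesis using assms unfolding plus_entries_def by (auto intro!: disc_alg_intros)
qed

text \<open>The adjugate, an inverse because twisted loops have determinant 1. It only permutes
  entries and changes signs, so positivity and twisting are visibly preserved.\<close>

definition loop_inverse :: "loop \<Rightarrow> loop" where
  "loop_inverse h = (\<lambda>l\<in>circle. mat22 (h l $ 2 $ 2) (- h l $ 1 $ 2) (- h l $ 2 $ 1) (h l $ 1 $ 1))"

lemma loop_inverse_twisted:
  assumes "h \<in> twisted_loops"
  shows "loop_inverse h \<in> twisted_loops"
  by (rule twisted_loopsI[of _ "\<lambda>l. h l $ 2 $ 2" "\<lambda>l. - h l $ 1 $ 2" "\<lambda>l. - h l $ 2 $ 1" "\<lambda>l. h l $ 1 $ 1"])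
     (use twisted_loopsD[OF assms] in \<open>auto intro!: continuous_intros simp: loop_inverse_def mult.commute\<close>)

lemma loop_inverse_mult:
  assumes "h \<in> twisted_loops"
  shows "loop_mult (loop_inverse h) h = loop_one" "loop_mult h (loop_inverse h) = loop_one"
proof -
  have "loop_inverse h l ** h l = mat 1 \<and> h l ** loop_inverse h l = mat 1" if "l \<in> circle" for l
  proof -
    have "h l = mat22 (h l $ 1 $ 1) (h l $ 1 $ 2) (h l $ 2 $ 1) (h l $ 2 $ 2)" by (rule mat22_eta)
    then obtain a b c d where abcd: "h l = mat22 a b c d" by blast
    then have "a * d - b * c = 1" using twisted_loopsD(3)[OF assms that] by simp
    then show ?thesis using that by (simp add: loop_inverse_def abcd mat22_mult mat22_one mat22_eq_iff algebra_simps)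
  qed
  then show "loop_mult (loop_inverse h) h = loop_one" "loop_mult h (loop_inverse h) = loop_one"
    by (auto simp: loop_mult_def loop_one_def)
qed

lemma loop_inverse_LplusP:
  assumes "h \<in> LplusP"
  shows "loop_inverse h \<in> LplusP"
proof -
  obtain A B C D r \<beta> where h: "plus_entries h A B C D r \<beta>" using LplusP_entries[OF assms] .
  then have "h \<in> twisted_loops" by (simp add: plus_entries_def)
  then show ?thesis
    using h by (intro LplusPI[of _ D "\<lambda>l. - (l * B l)" "\<lambda>l. - C l" A "inverse r"] loop_inverse_twisted)
      (auto simp: plus_entries_def loop_inverse_def intro!: disc_alg_intros)
qed

lemma loop_mult_assoc: "loop_mult (loop_mult f g) h = loop_mult f (loop_mult g h)"
  by (auto simp: loop_mult_def matrix_mul_assoc)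

lemma loop_mult_one: "h \<in> extensional circle \<Longrightarrow> loop_mult loop_one h = h"
  by (auto simp: loop_mult_def loop_one_def fun_eq_iff extensional_def)

lemma plus_entries_one: "plus_entries loop_one (\<lambda>_. 1) (\<lambda>_. 0) (\<lambda>_. 0) (\<lambda>_. 1) 1 0"
proof -
  have "loop_one \<in> twisted_loops"
    by (rule twisted_loopsI[of _ "\<lambda>_. 1" "\<lambda>_. 0" "\<lambda>_. 0" "\<lambda>_. 1"]) (auto simp: loop_one_def mat22_one)
  then show ?thesis by (simp add: plus_entries_def loop_one_def mat22_one disc_alg_const)
qed

lemma group_LplusP: "group LplusP_group"
proof (rule groupI)
  fix x y z assume x: "x \<in> carrier LplusP_group" and y: "y \<in> carrier LplusP_group"
  show "x \<otimes>\<^bsub>LplusP_group\<^esub> y \<in> carrier LplusP_group"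
    using x y by (auto simp: LplusP_group_def elim!: LplusP_entries intro: plus_entries_LplusP[OF plus_entries_mult])
next
  fix x assume "x \<in> carrier LplusP_group"
  then have x: "x \<in> LplusP" "x \<in> twisted_loops" by (auto simp: LplusP_group_def LplusP_def)
  then show "\<one>\<^bsub>LplusP_group\<^esub> \<otimes>\<^bsub>LplusP_group\<^esub> x = x"
    by (simp add: LplusP_group_def loop_mult_one twisted_loopsD(1))
  show "\<exists>y\<in>carrier LplusP_group. y \<otimes>\<^bsub>LplusP_group\<^esub> x = \<one>\<^bsub>LplusP_group\<^esub>"
    using loop_inverse_LplusP[OF x(1)] loop_inverse_mult(1)[OF x(2)] by (auto simp: LplusP_group_def)
qed (auto simp: LplusP_group_def loop_mult_assoc plus_entries_LplusP[OF plus_entries_one])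

section \<open>Explicit unitary frames and their Iwasawa decomposition\<close>

definition frame_loop :: "complex \<Rightarrow> complex \<Rightarrow> loop" where
  "frame_loop a b = (let s = of_real (inverse (sqrt ((norm a)\<^sup>2 + (norm b)\<^sup>2))) in
     (\<lambda>l\<in>circle. mat22 (s * a) (s * cnj b * l) (- s * b / l) (s * cnj a)))"

lemma frame_scale:
  assumes "a \<noteq> 0 \<or> b \<noteq> 0"
  defines "s \<equiv> inverse (sqrt ((norm a)\<^sup>2 + (norm b)\<^sup>2))"
  shows "s > 0" "complex_of_real s * s * (a * cnj a + b * cnj b) = 1"
proof -
  have pos: "(norm a)\<^sup>2 + (norm b)\<^sup>2 > 0" using assms(1) by (auto simp: add_pos_nonneg add_nonneg_pos)
  then show "s > 0" by (simp add: s_def)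
  have "s * s = inverse ((norm a)\<^sup>2 + (norm b)\<^sup>2)"
    using pos by (simp add: s_def flip: inverse_mult_distrib)
  then have "s * s * ((norm a)\<^sup>2 + (norm b)\<^sup>2) = 1"
    using pos by (metis left_inverse less_irrefl)
  then have "complex_of_real (s * s * ((norm a)\<^sup>2 + (norm b)\<^sup>2)) = 1" by simp
  then show "complex_of_real s * s * (a * cnj a + b * cnj b) = 1"
    by (simp only: complex_norm_square of_real_mult of_real_add)
qed

lemma circle_cnj: "l \<in> circle \<Longrightarrow> l \<noteq> 0 \<and> cnj l = inverse l"
proof -
  assume l: "l \<in> circle"
  then have "l * cnj l = 1" by (simp flip: complex_norm_square)
  then show ?thesis using inverse_unique l by fastforce
qed

lemma frame_loop_twisted:
  assumes "a \<noteq> 0 \<or> b \<noteq> 0"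
  shows "frame_loop a b \<in> twisted_loops"
proof -
  define s where "s = inverse (sqrt ((norm a)\<^sup>2 + (norm b)\<^sup>2))"
  have s: "complex_of_real s * s * (a * cnj a + b * cnj b) = 1"
    unfolding s_def by (rule frame_scale(2)[OF assms])
  show ?thesis
  proof (rule twisted_loopsI[of _ "\<lambda>_. s * a" "\<lambda>l. s * cnj b * l" "\<lambda>l. - s * b / l" "\<lambda>_. s * cnj a"])
    show "frame_loop a b l = mat22 (s * a) (s * cnj b * l) (- s * b / l) (s * cnj a)" if "l \<in> circle" for l
      using that by (simp add: frame_loop_def s_def Let_def)
    show "s * a * (s * cnj a) - s * cnj b * l * (- s * b / l) = 1" if "l \<in> circle" for l
      using s circle_cnj[OF that] by (simp add: algebra_simps)
  qed (auto simp: frame_loop_def Let_def intro!: continuous_intros)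
qed

text \<open>On the circle \<open>cnj l\<close> is \<open>1 / l\<close>, so the lower left entry is
  minus the conjugate of the upper right one; the scalar normalizes the determinant.\<close>

lemma frame_loop_LG:
  assumes "a \<noteq> 0 \<or> b \<noteq> 0"
  shows "frame_loop a b \<in> LG"
proof -
  define s where "s = inverse (sqrt ((norm a)\<^sup>2 + (norm b)\<^sup>2))"
  have s: "complex_of_real s * s * (a * cnj a + b * cnj b) = 1"
    unfolding s_def by (rule frame_scale(2)[OF assms])
  have "frame_loop a b l \<in> special_unitary" if l: "l \<in> circle" for l
  proof -
    define X where "X = frame_loop a b l"
    have X: "X = mat22 (s * a) (s * cnj b * l) (- s * b / l) (s * cnj a)"
      using l by (simp add: X_def frame_loop_def s_def Let_def)
    have cX: "(\<chi> i j. cnj (X $ j $ i)) = mat22 (s * cnj a) (- s * cnj b * l) (s * b * inverse l) (s * a)"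
      by (rule mat22_eqI) (use circle_cnj[OF l] in \<open>simp_all add: X divide_inverse\<close>)
    have "det X = 1" using frame_loop_twisted[OF assms] l by (simp add: twisted_loops_def X_def)
    moreover have "(\<chi> i j. cnj (X $ j $ i)) ** X = mat 1"
      unfolding cX unfolding X mat22_mult mat22_one mat22_eq_iff
      using s circle_cnj[OF l] by (auto simp: field_simps)
    ultimately show ?thesis by (simp add: special_unitary_def X_def)
  qed
  then show ?thesis using frame_loop_twisted[OF assms] by (simp add: LG_def)
qed

text \<open>
  The Iwasawa decomposition of \<open>h F\<close> in closed form: the spinor of the new frame is chosen so that
  the pole at \<open>l = 0\<close> of the lower left entry of the positive factor cancels.
\<close>

lemma frame_loop_dressing:
  assumes h: "plus_entries h A B C D r \<beta>" and ab: "a \<noteq> 0 \<or> b \<noteq> 0"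
  defines "c \<equiv> of_real r * a - \<beta> * b" and "b' \<equiv> b / of_real r"
  shows "\<exists>G\<in>LplusP. loop_mult h (frame_loop a b) = loop_mult (frame_loop c b') G"
proof -
  have r: "r > 0" and tw: "h \<in> twisted_loops" using h by (auto simp: plus_entries_def)
  have alg: "disc_alg A" "disc_alg B" "disc_alg C" "disc_alg D" and e: "\<And>l. l \<in> circle \<Longrightarrow> h l = mat22 (A l) (l * B l) (C l) (D l)"
    and v: "A 0 = of_real r" "B 0 = \<beta>" "C 0 = 0" "D 0 = inverse (of_real r)"
    using h by (auto simp: plus_entries_def)
  have cb: "c \<noteq> 0 \<or> b' \<noteq> 0" using ab r by (auto simp: c_def b'_def)
  define s where "s = inverse (sqrt ((norm a)\<^sup>2 + (norm b)\<^sup>2))"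
  define s' where "s' = inverse (sqrt ((norm c)\<^sup>2 + (norm b')\<^sup>2))"
  have s: "s > 0" "s' > 0" using frame_scale(1)[OF ab] frame_scale(1)[OF cb] by (simp_all add: s_def s'_def)
  \<comment> \<open>The candidate is forced by the desired factorization; what needs proof is that
    it is a positive loop.\<close>
  define G where "G = loop_mult (loop_inverse (frame_loop c b')) (loop_mult h (frame_loop a b))"
  have G_tw: "G \<in> twisted_loops"
    unfolding G_def by (intro loop_mult_twisted loop_inverse_twisted frame_loop_twisted ab cb tw)
  have "loop_mult (frame_loop c b') G = loop_mult h (frame_loop a b)"
  proof -
    have "loop_mult (frame_loop c b') G = loop_mult loop_one (loop_mult h (frame_loop a b))"
      by (simp only: G_def loop_mult_assoc[symmetric] loop_inverse_mult(2)[OF frame_loop_twisted[OF cb]])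
    also have "\<dots> = loop_mult h (frame_loop a b)" by (rule loop_mult_one) (simp add: loop_mult_def)
    finally show ?thesis .
  qed
  moreover have "G \<in> LplusP"
  proof -
    \<comment> \<open>Up to the scale \<open>\<sigma>\<close>, the lower left entry of
      \<open>G\<close> is \<open>N l / l\<close> plus a term without pole. The choice of
      \<open>c\<close> and \<open>b'\<close> makes \<open>N 0 = b' * c - c * b'\<close>, which is
      zero.\<close>
    define N where "N l = b' * (A l * a - B l * b) - c * D l * b" for l
    have "disc_alg N" unfolding N_def[abs_def] by (intro disc_alg_intros alg)
    moreover have "N 0 = 0" using r by (simp add: N_def v b'_def c_def field_simps)
    ultimately obtain M where M: "disc_alg M" "\<And>l. N l = l * M l" using disc_alg_factor by blast
    define \<sigma> where "\<sigma> = complex_of_real (s * s')"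
    show ?thesis
    proof (rule LplusPI[OF G_tw])
      show "disc_alg (\<lambda>l. \<sigma> * (cnj c * (A l * a - B l * b) - cnj b' * (l * C l * a - D l * b)))"
        "disc_alg (\<lambda>l. \<sigma> * (l * (cnj c * (A l * cnj b + B l * cnj a) - cnj b' * (C l * cnj b * l + D l * cnj a))))"
        "disc_alg (\<lambda>l. \<sigma> * (M l + c * C l * a))"
        "disc_alg (\<lambda>l. \<sigma> * (b' * (A l * cnj b + B l * cnj a) + c * (C l * cnj b * l + D l * cnj a)))"
        by (intro disc_alg_intros alg M)+
      fix l :: complex assume l: "l \<in> circle"
      have l0: "l \<noteq> 0" using l by auto
      have F: "frame_loop a b l = mat22 (s * a) (s * cnj b * l) (- s * b / l) (s * cnj a)"
        using l by (simp add: frame_loop_def s_def Let_def)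
      have F': "loop_inverse (frame_loop c b') l = mat22 (s' * cnj c) (- s' * cnj b' * l) (s' * b' / l) (s' * c)"
        using l by (simp add: frame_loop_def s'_def Let_def loop_inverse_def)
      have Ml: "M l = (b' * (A l * a - B l * b) - c * D l * b) / l" using M(2)[of l] l0 by (simp add: N_def field_simps)
      show "G l = mat22 (\<sigma> * (cnj c * (A l * a - B l * b) - cnj b' * (l * C l * a - D l * b)))
         (\<sigma> * (l * (cnj c * (A l * cnj b + B l * cnj a) - cnj b' * (C l * cnj b * l + D l * cnj a))))
         (\<sigma> * (M l + c * C l * a))
         (\<sigma> * (b' * (A l * cnj b + B l * cnj a) + c * (C l * cnj b * l + D l * cnj a)))"
        unfolding Ml using l l0 by (simp add: G_def loop_mult_def F F' e mat22_mult mat22_eq_iff \<sigma>_def field_simps)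
    next
      \<comment> \<open>At the origin the upper left entry of \<open>G\<close> becomes a positive
        multiple of \<open>|c|^2 + |b'|^2\<close>, which gives the normalization of
        \<open>LplusP\<close>.\<close>
      have "D 0 * b = b'" by (simp add: v b'_def divide_inverse)
      then have "cnj c * (A 0 * a - B 0 * b) - cnj b' * (0 * C 0 * a - D 0 * b) = c * cnj c + b' * cnj b'"
        by (simp add: v c_def)
      also have "\<dots> = of_real ((norm c)\<^sup>2 + (norm b')\<^sup>2)"
        by (simp only: of_real_add complex_norm_square)
      finally show "\<sigma> * (cnj c * (A 0 * a - B 0 * b) - cnj b' * (0 * C 0 * a - D 0 * b))
          = of_real (s * s' * ((norm c)\<^sup>2 + (norm b')\<^sup>2))" by (simp add: \<sigma>_def)
      show "s * s' * ((norm c)\<^sup>2 + (norm b')\<^sup>2) > 0"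
        using s cb by (auto intro!: mult_pos_pos simp: add_pos_nonneg add_nonneg_pos)
    qed
  qed
  ultimately show ?thesis by metis
qed

section \<open>Extended frames and normalized potentials\<close>


text \<open>Real differentiability with differential \<open>p dz + q dzbar\<close>. Unlike the
  partial derivatives, this relation obeys a product rule and a conjugation rule without side
  conditions.\<close>

definition wirtinger :: "(complex \<Rightarrow> complex) \<Rightarrow> complex \<Rightarrow> complex \<Rightarrow> complex \<Rightarrow> bool" where
  "wirtinger g p q z \<longleftrightarrow> (g has_derivative (\<lambda>h. p * h + q * cnj h)) (at z)"

lemma wirtinger_dx_dy:
  assumes "wirtinger g p q z"
  shows "dx g z = p + q" "dy g z = \<i> * (p - q)"
  using dx_dy_if_has_derivative[OF assms[unfolded wirtinger_def]] by (simp_all add: algebra_simps)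

lemma wirtinger_d_z:
  assumes "wirtinger g p q z"
  shows "d_z g z = p" "d_zbar g z = q"
  by (simp_all add: d_z_def d_zbar_def wirtinger_dx_dy[OF assms] algebra_simps)

lemma wirtinger_const: "wirtinger (\<lambda>_. c) 0 0 z"
  by (simp add: wirtinger_def)

lemma wirtinger_holomorphic: "(g has_field_derivative c) (at z) \<Longrightarrow> wirtinger g c 0 z"
  by (simp add: wirtinger_def has_field_derivative_def)

lemma wirtinger_add: "wirtinger g p q z \<Longrightarrow> wirtinger g' p' q' z \<Longrightarrow> wirtinger (\<lambda>w. g w + g' w) (p + p') (q + q') z"
  unfolding wirtinger_def by (drule (1) has_derivative_add) (simp add: algebra_simps)

lemma wirtinger_mult:
  "wirtinger g p q z \<Longrightarrow> wirtinger g' p' q' z \<Longrightarrow>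
    wirtinger (\<lambda>w. g w * g' w) (p * g' z + g z * p') (q * g' z + g z * q') z"
  unfolding wirtinger_def by (drule (1) has_derivative_mult) (simp add: algebra_simps)

lemma wirtinger_cnj:
  assumes "wirtinger g p q z"
  shows "wirtinger (\<lambda>w. cnj (g w)) (cnj q) (cnj p) z"
  using bounded_linear.has_derivative[OF bounded_linear_cnj assms[unfolded wirtinger_def]]
  by (simp add: wirtinger_def add.commute)

lemma wirtinger_of_real_compose:
  fixes E :: "complex \<Rightarrow> real"
  assumes E: "wirtinger (\<lambda>w. of_real (E w)) e (cnj e) z" and \<phi>: "(\<phi> has_real_derivative \<phi>') (at (E z))"
  shows "wirtinger (\<lambda>w. of_real (\<phi> (E w))) (of_real \<phi>' * e) (of_real \<phi>' * cnj e) z"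
proof -
  have "(E has_derivative (\<lambda>h. Re (e * h + cnj e * cnj h))) (at z)"
    using has_derivative_Re[OF E[unfolded wirtinger_def]] by simp
  moreover have "(\<phi> has_derivative (\<lambda>h. h * \<phi>')) (at (E z))"
    using \<phi> by (simp add: has_field_derivative_def mult_commute_abs)
  ultimately have "((\<lambda>w. \<phi> (E w)) has_derivative (\<lambda>h. Re (e * h + cnj e * cnj h) * \<phi>')) (at z)"
    by (rule has_derivative_compose)
  from has_derivative_of_real[OF this]
  have "((\<lambda>w. complex_of_real (\<phi> (E w))) has_derivative (\<lambda>h. of_real (Re (e * h + cnj e * cnj h) * \<phi>'))) (at z)" .
  moreover have "(\<lambda>h. complex_of_real (Re (e * h + cnj e * cnj h) * \<phi>')) = (\<lambda>h. of_real \<phi>' * e * h + of_real \<phi>' * cnj e * cnj h)"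
    by (intro ext) (simp add: complex_eq_iff algebra_simps)
  ultimately show ?thesis by (simp add: wirtinger_def)
qed

lemma C1_on_matI:
  fixes X :: "complex \<Rightarrow> mat2"
  assumes W: "\<And>z. z \<in> S \<Longrightarrow> \<forall>i j. wirtinger (\<lambda>w. X w $ i $ j) (P z $ i $ j) (Q z $ i $ j) z"
    and cont: "\<forall>i j. continuous_on S (\<lambda>z. P z $ i $ j)" "\<forall>i j. continuous_on S (\<lambda>z. Q z $ i $ j)"
  shows "C1_on S X"
proof -
  have D: "(X has_derivative (\<lambda>h. \<chi> i j. P z $ i $ j * h + Q z $ i $ j * cnj h)) (at z)" if "z \<in> S" for z
  proof -
    have "((\<lambda>w. \<chi> i j. X w $ i $ j) has_derivative (\<lambda>h. \<chi> i j. P z $ i $ j * h + Q z $ i $ j * cnj h)) (at z)"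
      by (intro has_derivative_vec_lambda W[OF that, unfolded wirtinger_def, rule_format])
    then show ?thesis by (simp add: vec_lambda_eta)
  qed
  have dx: "dx X z = (\<chi> i j. P z $ i $ j + Q z $ i $ j)"
    and dy: "dy X z = (\<chi> i j. P z $ i $ j * \<i> + Q z $ i $ j * - \<i>)" if "z \<in> S" for z
    using dx_dy_if_has_derivative[OF D[OF that]] by simp_all
  have "continuous_on S (\<lambda>z. \<chi> i j. P z $ i $ j + Q z $ i $ j)"
    "continuous_on S (\<lambda>z. \<chi> i j. P z $ i $ j * \<i> + Q z $ i $ j * - \<i>)"
    by (intro continuous_on_vec_lambda continuous_on_add continuous_on_mult continuous_on_const cont[rule_format])+
  then have "continuous_on S (dx X)" "continuous_on S (dy X)"
    by (simp_all only: dx dy cong: continuous_on_cong)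
  then show ?thesis
    using D by (auto simp: C1_on_def differentiable_def)
qed

lemma frame_loop_z0:
  assumes "normalized_at z0 a b"
  shows "frame_loop (a z0) (b z0) = loop_one"
proof -
  obtain m :: real where "m > 0" "a z0 = of_real m" "b z0 = 0" using assms by (auto simp: normalized_at_def)
  then show ?thesis by (auto simp: frame_loop_def loop_one_def Let_def mat22_one mat22_eq_iff fun_eq_iff simp flip: of_real_mult)
qed

text \<open>With \<open>E = |a|^2 + |b|^2 = exp u\<close> and \<open>s = 1 / sqrt E\<close>, every
  entry is built from \<open>s\<close>, holomorphic functions and their conjugates, so both
  Wirtinger derivatives are explicit. The coefficient of \<open>1 / l\<close> is \<open>s^2\<close>
  times the Wronskian, that is, half of \<open>Q * exp (- u)\<close>.\<close>

lemma extended_frame_spinor: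
  assumes S: "open S" and rep: "spinor_rep S R f a b" and norm: "normalized_at z0 a b"
  shows "extended_frame S z0 f (\<lambda>z. frame_loop (a z) (b z))"
  unfolding extended_frame_def
proof (intro conjI ballI)
  show "frame_loop (a z) (b z) \<in> LG" if "z \<in> S" for z
    by (rule frame_loop_LG[OF spinor_rep_nonzero[OF S rep that]])
  show "frame_loop (a z0) (b z0) = loop_one" by (rule frame_loop_z0[OF norm])
next
  fix l :: complex assume l: "l \<in> circle"
  note lc = circle_cnj[OF l]
  define E where "E = spin_norm2 a b"
  define s where "s z = inverse (sqrt (E z))" for z
  \<comment> \<open>The \<open>z\<close>-derivative of \<open>u = ln E\<close>; the derivative of
    \<open>s\<close> is then \<open>- s * U / 2\<close>.\<close>
  define U where "U z = (deriv a z * cnj (a z) + deriv b z * cnj (b z)) / of_real (E z)" for z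
  have E: "E z > 0" if "z \<in> S" for z using spin_norm2_pos[OF S rep that] by (simp add: E_def)
  have Ec: "complex_of_real (E z) = a z * cnj (a z) + b z * cnj (b z)" for z
    by (simp only: E_def spin_norm2_def of_real_add complex_norm_square)
  note hol = spinor_rep_holomorphic[OF S rep]
  have Wa: "wirtinger a (deriv a z) 0 z" "wirtinger b (deriv b z) 0 z" if "z \<in> S" for z
    using hol S that by (auto intro!: wirtinger_holomorphic holomorphic_derivI)
  have WE: "wirtinger (\<lambda>w. of_real (E w)) (of_real (E z) * U z) (cnj (of_real (E z) * U z)) z" if z: "z \<in> S" for z
  proof -
    have "of_real (E z) * U z = deriv a z * cnj (a z) + deriv b z * cnj (b z)"
      using E[OF z] by (simp add: U_def)
    moreover have "wirtinger (\<lambda>w. a w * cnj (a w) + b w * cnj (b w))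
       ((deriv a z * cnj (a z) + a z * cnj 0) + (deriv b z * cnj (b z) + b z * cnj 0))
       ((0 * cnj (a z) + a z * cnj (deriv a z)) + (0 * cnj (b z) + b z * cnj (deriv b z))) z"
      by (intro wirtinger_add wirtinger_mult wirtinger_cnj Wa z)
    ultimately show ?thesis by (simp add: Ec mult.commute)
  qed
  have Wu: "wirtinger (\<lambda>w. of_real (ln (E w))) (U z) (cnj (U z)) z" if z: "z \<in> S" for z
    using wirtinger_of_real_compose[OF WE[OF z], of ln "inverse (E z)"] E[OF z] DERIV_ln[OF E[OF z]]
    by (simp add: mult.assoc[symmetric])
  have Ws: "wirtinger (\<lambda>w. of_real (s w)) (- (of_real (s z) * U z) / 2) (- (of_real (s z) * cnj (U z)) / 2) z" if z: "z \<in> S" for z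
  proof -
    have "((\<lambda>x. inverse (sqrt x)) has_real_derivative - (inverse (sqrt (E z)) * (inverse (sqrt (E z)) / 2) * inverse (sqrt (E z)))) (at (E z))"
      using E[OF z] by (intro DERIV_inverse' DERIV_real_sqrt) auto
    also have "inverse (sqrt (E z)) * (inverse (sqrt (E z)) / 2) * inverse (sqrt (E z)) = s z / (2 * E z)"
      using E[OF z] by (simp add: s_def field_simps)
    finally have "((\<lambda>x. inverse (sqrt x)) has_real_derivative - (s z / (2 * E z))) (at (E z))" .
    from wirtinger_of_real_compose[OF WE[OF z] this] E[OF z] show ?thesis by (simp add: s_def[abs_def])
  qed
  have s2: "complex_of_real (s z) * of_real (s z) = inverse (of_real (E z))" if "z \<in> S" for z
    using E[OF that] by (simp add: s_def flip: of_real_mult of_real_inverse inverse_mult_distrib)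
  define X where "X z = frame_loop (a z) (b z) l" for z
  have X: "X z = mat22 (of_real (s z) * a z) (of_real (s z) * cnj (b z) * l)
      (of_real (s z) * b z * (- inverse l)) (of_real (s z) * cnj (a z))" for z
    using l by (simp add: X_def frame_loop_def s_def E_def spin_norm2_def Let_def divide_inverse)
  have W: "wirtinger (\<lambda>w. X w $ 1 $ 1) (- (of_real (s z) * U z) / 2 * a z + of_real (s z) * deriv a z)
        (- (of_real (s z) * cnj (U z)) / 2 * a z) z"
      "wirtinger (\<lambda>w. X w $ 1 $ 2) (- (of_real (s z) * U z) / 2 * cnj (b z) * l)
        ((- (of_real (s z) * cnj (U z)) / 2 * cnj (b z) + of_real (s z) * cnj (deriv b z)) * l) z"
      "wirtinger (\<lambda>w. X w $ 2 $ 1) ((- (of_real (s z) * U z) / 2 * b z + of_real (s z) * deriv b z) * (- inverse l))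
        (- (of_real (s z) * cnj (U z)) / 2 * b z * (- inverse l)) z"
      "wirtinger (\<lambda>w. X w $ 2 $ 2) (- (of_real (s z) * U z) / 2 * cnj (a z))
        (- (of_real (s z) * cnj (U z)) / 2 * cnj (a z) + of_real (s z) * cnj (deriv a z)) z" if z: "z \<in> S" for z
  proof -
    note wa = Wa(1)[OF z] and wb = Wa(2)[OF z] and ws = Ws[OF z]
    show "wirtinger (\<lambda>w. X w $ 1 $ 1) (- (of_real (s z) * U z) / 2 * a z + of_real (s z) * deriv a z)
        (- (of_real (s z) * cnj (U z)) / 2 * a z) z"
      using wirtinger_mult[OF ws wa] by (simp add: X)
    show "wirtinger (\<lambda>w. X w $ 1 $ 2) (- (of_real (s z) * U z) / 2 * cnj (b z) * l)
        ((- (of_real (s z) * cnj (U z)) / 2 * cnj (b z) + of_real (s z) * cnj (deriv b z)) * l) z"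
      using wirtinger_mult[OF wirtinger_mult[OF ws wirtinger_cnj[OF wb]] wirtinger_const[of l]] by (simp add: X)
    show "wirtinger (\<lambda>w. X w $ 2 $ 1) ((- (of_real (s z) * U z) / 2 * b z + of_real (s z) * deriv b z) * (- inverse l))
        (- (of_real (s z) * cnj (U z)) / 2 * b z * (- inverse l)) z"
      using wirtinger_mult[OF wirtinger_mult[OF ws wb] wirtinger_const[of "- inverse l"]] by (simp add: X)
    show "wirtinger (\<lambda>w. X w $ 2 $ 2) (- (of_real (s z) * U z) / 2 * cnj (a z))
        (- (of_real (s z) * cnj (U z)) / 2 * cnj (a z) + of_real (s z) * cnj (deriv a z)) z"
      using wirtinger_mult[OF ws wirtinger_cnj[OF wa]] by (simp add: X)
  qed
  have cont: "continuous_on S a" "continuous_on S b" "continuous_on S (deriv a)" "continuous_on S (deriv b)"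
    using hol S by (auto intro!: holomorphic_on_imp_continuous_on holomorphic_deriv)
  have contE: "continuous_on S E"
    unfolding E_def spin_norm2_def by (intro continuous_intros cont)
  have conts: "continuous_on S (\<lambda>z. complex_of_real (s z))" and contU: "continuous_on S U"
    unfolding s_def[abs_def] U_def[abs_def] using E by (auto intro!: continuous_intros cont contE dest: E)
  show "C1_on S (\<lambda>z. frame_loop (a z) (b z) l)"
    unfolding X_def[symmetric]
  proof (rule C1_on_matI)
    let ?P = "\<lambda>z. mat22 (- (of_real (s z) * U z) / 2 * a z + of_real (s z) * deriv a z)
        (- (of_real (s z) * U z) / 2 * cnj (b z) * l)
        ((- (of_real (s z) * U z) / 2 * b z + of_real (s z) * deriv b z) * (- inverse l))
        (- (of_real (s z) * U z) / 2 * cnj (a z))"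
    let ?Q = "\<lambda>z. mat22 (- (of_real (s z) * cnj (U z)) / 2 * a z)
        ((- (of_real (s z) * cnj (U z)) / 2 * cnj (b z) + of_real (s z) * cnj (deriv b z)) * l)
        (- (of_real (s z) * cnj (U z)) / 2 * b z * (- inverse l))
        (- (of_real (s z) * cnj (U z)) / 2 * cnj (a z) + of_real (s z) * cnj (deriv a z))"
    show "\<forall>i j. wirtinger (\<lambda>w. X w $ i $ j) (?P z $ i $ j) (?Q z $ i $ j) z" if "z \<in> S" for z
      unfolding mat2_all vector_2 by (intro conjI W that)
    show "\<forall>i j. continuous_on S (\<lambda>z. ?P z $ i $ j)" "\<forall>i j. continuous_on S (\<lambda>z. ?Q z $ i $ j)"
      unfolding mat2_all vector_2 divide_inverse
      by (intro conjI continuous_on_mult continuous_on_add continuous_on_minus continuous_on_cnj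
          continuous_on_const conts contU cont)+
  qed
  fix z assume z: "z \<in> S"
  have u: "conf_u f w = ln (E w)" if "w \<in> S" for w using spinor_rep_conf_u[OF S rep that] by (simp add: E_def)
  have uz: "d_z (\<lambda>w. of_real (conf_u f w)) z = U z" "d_zbar (\<lambda>w. of_real (conf_u f w)) z = cnj (U z)"
    using d_z_cong[OF S z, of "\<lambda>w. complex_of_real (conf_u f w)" "\<lambda>w. of_real (ln (E w))"] wirtinger_d_z[OF Wu[OF z]] u
    by auto
  \<comment> \<open>The conformal factor in the Maurer-Cartan form is the square of the normalizing
    scalar of the frame.\<close>
  have eu: "complex_of_real (exp (- conf_u f z)) = of_real (s z) * of_real (s z)"
    using E[OF z] s2[OF z] by (simp add: u[OF z] exp_minus)
  define \<sigma> where "\<sigma> = complex_of_real (s z)"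
  have EU: "\<sigma> * \<sigma> * (deriv a z * cnj (a z) + deriv b z * cnj (b z)) = U z"
    unfolding \<sigma>_def s2[OF z] by (simp add: U_def divide_inverse mult.commute)
  have E1: "\<sigma> * \<sigma> * (a z * cnj (a z) + b z * cnj (b z)) = 1"
    unfolding \<sigma>_def s2[OF z] Ec[symmetric] using E[OF z] by simp
  have EU': "\<sigma> * \<sigma> * (cnj (deriv a z) * a z + cnj (deriv b z) * b z) = cnj (U z)"
    using arg_cong[OF EU, of cnj] by (simp add: \<sigma>_def)
  have l1: "l * inverse l = 1" using lc by simp
  have inv: "matrix_inv (X z) = mat22 (\<sigma> * cnj (a z)) (- \<sigma> * cnj (b z) * l) (\<sigma> * b z * inverse l) (\<sigma> * a z)"
  proof -
    have "\<sigma> * a z * (\<sigma> * cnj (a z)) - \<sigma> * cnj (b z) * l * (\<sigma> * b z * - inverse l) = 1"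
      using E1 l1 by algebra
    then show ?thesis unfolding X \<sigma>_def[symmetric] by (subst matrix_inv_mat22) simp_all
  qed
  have hopf: "hopf f z = 2 * (b z * deriv a z - a z * deriv b z)" by (rule spinor_rep_hopf[OF S rep z])
  have Dz: "mat_entrywise d_z X z = mat22 (- (\<sigma> * U z) / 2 * a z + \<sigma> * deriv a z) (- (\<sigma> * U z) / 2 * cnj (b z) * l)
      ((- (\<sigma> * U z) / 2 * b z + \<sigma> * deriv b z) * (- inverse l)) (- (\<sigma> * U z) / 2 * cnj (a z))"
    by (rule mat22_eqI) (simp_all add: mat_entrywise_def wirtinger_d_z[OF W(1)[OF z]] wirtinger_d_z[OF W(2)[OF z]]
       wirtinger_d_z[OF W(3)[OF z]] wirtinger_d_z[OF W(4)[OF z]] \<sigma>_def)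
  have Dzbar: "mat_entrywise d_zbar X z = mat22 (- (\<sigma> * cnj (U z)) / 2 * a z)
      ((- (\<sigma> * cnj (U z)) / 2 * cnj (b z) + \<sigma> * cnj (deriv b z)) * l)
      (- (\<sigma> * cnj (U z)) / 2 * b z * (- inverse l)) (- (\<sigma> * cnj (U z)) / 2 * cnj (a z) + \<sigma> * cnj (deriv a z))"
    by (rule mat22_eqI) (simp_all add: mat_entrywise_def wirtinger_d_z[OF W(1)[OF z]] wirtinger_d_z[OF W(2)[OF z]]
       wirtinger_d_z[OF W(3)[OF z]] wirtinger_d_z[OF W(4)[OF z]] \<sigma>_def)
  have "matrix_inv (X z) ** mat_entrywise d_z X z = mat22 (U z / 2) 0 (hopf f z * (\<sigma> * \<sigma>) * inverse l / 2) (- U z / 2)"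
    unfolding inv Dz mat22_mult mat22_eq_iff hopf
  proof (intro conjI)
    show "\<sigma> * cnj (a z) * (- (\<sigma> * U z) / 2 * a z + \<sigma> * deriv a z) +
      - \<sigma> * cnj (b z) * l * ((- (\<sigma> * U z) / 2 * b z + \<sigma> * deriv b z) * - inverse l) = U z / 2"
      using E1 EU l1 by algebra
    show "\<sigma> * b z * inverse l * (- (\<sigma> * U z) / 2 * cnj (b z) * l) + \<sigma> * a z * (- (\<sigma> * U z) / 2 * cnj (a z)) = - U z / 2"
      using E1 l1 by algebra
  qed (simp_all add: algebra_simps)
  moreover have "matrix_inv (X z) ** mat_entrywise d_zbar X z
      = mat22 (- cnj (U z) / 2) (- cnj (hopf f z) * (\<sigma> * \<sigma>) * l / 2) 0 (cnj (U z) / 2)"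
    unfolding inv Dzbar mat22_mult mat22_eq_iff hopf
  proof (intro conjI)
    show "\<sigma> * cnj (a z) * (- (\<sigma> * cnj (U z)) / 2 * a z) + - \<sigma> * cnj (b z) * l * (- (\<sigma> * cnj (U z)) / 2 * b z * - inverse l) = - cnj (U z) / 2"
      using E1 l1 by algebra
    show "\<sigma> * b z * inverse l * ((- (\<sigma> * cnj (U z)) / 2 * cnj (b z) + \<sigma> * cnj (deriv b z)) * l) +
      \<sigma> * a z * (- (\<sigma> * cnj (U z)) / 2 * cnj (a z) + \<sigma> * cnj (deriv a z)) = cnj (U z) / 2"
      using E1 EU' l1 by algebra
  qed (simp_all add: algebra_simps)
  ultimately show "let uz = d_z (\<lambda>w. of_real (conf_u f w)) z; uzbar = d_zbar (\<lambda>w. of_real (conf_u f w)) z;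
            e = complex_of_real (exp (- conf_u f z)); Q = hopf f z
        in matrix_inv (frame_loop (a z) (b z) l) ** mat_entrywise d_z (\<lambda>w. frame_loop (a w) (b w) l) z
             = mat22 (uz / 2) 0 (Q * e * inverse l / 2) (- uz / 2) \<and>
           matrix_inv (frame_loop (a z) (b z) l) ** mat_entrywise d_zbar (\<lambda>w. frame_loop (a w) (b w) l) z
             = mat22 (- uzbar / 2) (- cnj Q * e * l / 2) 0 (uzbar / 2)"
    unfolding Let_def uz eu X_def[symmetric] X_def[abs_def, symmetric] \<sigma>_def by blast
qed

section \<open>Uniqueness of the extended frame\<close>

definition adj2 :: "mat2 \<Rightarrow> mat2" where
  "adj2 A = mat22 (A $ 2 $ 2) (- A $ 1 $ 2) (- A $ 2 $ 1) (A $ 1 $ 1)"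

lemma adj2_inverse:
  assumes "det A = 1"
  shows "A ** adj2 A = mat 1" "adj2 A ** A = mat 1"
proof -
  obtain a b c d where A: "A = mat22 a b c d" using mat22_eta by blast
  show "A ** adj2 A = mat 1" "adj2 A ** A = mat 1"
    using assms by (simp_all add: A adj2_def mat22_mult mat22_one mat22_eq_iff det_2 algebra_simps)
qed

text \<open>A trace-free coefficient matrix leaves \<open>X adj2 Y\<close> constant.\<close>

lemma maurer_cartan_unique:
  fixes X Y :: "complex \<Rightarrow> mat2"
  assumes S: "open S" "connected S" "z0 \<in> S"
    and DX: "\<And>z. z \<in> S \<Longrightarrow> (X has_derivative (\<lambda>h. X z ** \<Gamma> z h)) (at z)"
    and DY: "\<And>z. z \<in> S \<Longrightarrow> (Y has_derivative (\<lambda>h. Y z ** \<Gamma> z h)) (at z)"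
    and tr: "\<And>z h. \<Gamma> z h $ 2 $ 2 = - \<Gamma> z h $ 1 $ 1"
    and det: "\<And>z. z \<in> S \<Longrightarrow> det (Y z) = 1" and init: "X z0 = Y z0" and z: "z \<in> S"
  shows "X z = Y z"
proof -
  have "X z ** adj2 (Y z) = X z0 ** adj2 (Y z0)"
  proof (rule has_derivative_zero_unique_connected[OF S(1,2) _ z S(3)])
    fix w assume w: "w \<in> S"
    have ent: "((\<lambda>z. X z $ i $ j) has_derivative (\<lambda>h. (X w ** \<Gamma> w h) $ i $ j)) (at w)"
              "((\<lambda>z. Y z $ i $ j) has_derivative (\<lambda>h. (Y w ** \<Gamma> w h) $ i $ j)) (at w)" for i j
      by (intro bounded_linear.has_derivative[OF bounded_linear_vec_nth] DX DY w)+
    have "((\<lambda>z. (X z ** adj2 (Y z)) $ i $ j) has_derivative (\<lambda>h. 0)) (at w)" for i j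
    proof -
      have e: "(X z ** adj2 (Y z)) $ 1 $ 1 = X z $ 1 $ 1 * Y z $ 2 $ 2 - X z $ 1 $ 2 * Y z $ 2 $ 1"
        "(X z ** adj2 (Y z)) $ 1 $ 2 = X z $ 1 $ 2 * Y z $ 1 $ 1 - X z $ 1 $ 1 * Y z $ 1 $ 2"
        "(X z ** adj2 (Y z)) $ 2 $ 1 = X z $ 2 $ 1 * Y z $ 2 $ 2 - X z $ 2 $ 2 * Y z $ 2 $ 1"
        "(X z ** adj2 (Y z)) $ 2 $ 2 = X z $ 2 $ 2 * Y z $ 1 $ 1 - X z $ 2 $ 1 * Y z $ 1 $ 2" for z
        by (simp_all add: adj2_def matrix_matrix_mult_def sum_2)
      have D: "((\<lambda>z. X z $ i $ p * Y z $ k $ m - X z $ i $ p' * Y z $ k' $ m') has_derivative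
          (\<lambda>h. (X w $ i $ p * (Y w ** \<Gamma> w h) $ k $ m + (X w ** \<Gamma> w h) $ i $ p * Y w $ k $ m)
            - (X w $ i $ p' * (Y w ** \<Gamma> w h) $ k' $ m' + (X w ** \<Gamma> w h) $ i $ p' * Y w $ k' $ m'))) (at w)"
        for i p k m p' k' m'
        by (intro has_derivative_diff has_derivative_mult ent)
      have "((\<lambda>z. (X z ** adj2 (Y z)) $ 1 $ 1) has_derivative (\<lambda>h. 0)) (at w)"
        unfolding e using D[of 1 1 2 2 2 2 1] by (simp add: matrix_matrix_mult_def sum_2 tr algebra_simps)
      moreover have "((\<lambda>z. (X z ** adj2 (Y z)) $ 1 $ 2) has_derivative (\<lambda>h. 0)) (at w)"
        unfolding e using D[of 1 2 1 1 1 1 2] by (simp add: matrix_matrix_mult_def sum_2 tr algebra_simps)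
      moreover have "((\<lambda>z. (X z ** adj2 (Y z)) $ 2 $ 1) has_derivative (\<lambda>h. 0)) (at w)"
        unfolding e using D[of 2 1 2 2 2 2 1] by (simp add: matrix_matrix_mult_def sum_2 tr algebra_simps)
      moreover have "((\<lambda>z. (X z ** adj2 (Y z)) $ 2 $ 2) has_derivative (\<lambda>h. 0)) (at w)"
        unfolding e using D[of 2 2 1 1 1 1 2] by (simp add: matrix_matrix_mult_def sum_2 tr algebra_simps)
      ultimately show ?thesis using exhaust_2[of i] exhaust_2[of j] by auto
    qed
    then have "((\<lambda>z. \<chi> i j. (X z ** adj2 (Y z)) $ i $ j) has_derivative (\<lambda>h. \<chi> i j. 0)) (at w)"
      by (intro has_derivative_vec_lambda)
    moreover have "(\<lambda>h::complex. \<chi> i j. (0 :: complex)) = (\<lambda>h. 0 :: mat2)" by (simp add: fun_eq_iff vec_eq_iff)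
    ultimately show "((\<lambda>z. X z ** adj2 (Y z)) has_derivative (\<lambda>h. 0)) (at w)"
      by (simp add: vec_lambda_eta)
  qed
  also have "\<dots> = mat 1" using adj2_inverse(1)[OF det[OF S(3)]] by (simp add: init)
  finally have "X z ** (adj2 (Y z) ** Y z) = Y z" by (simp add: matrix_mul_assoc)
  then show ?thesis by (simp add: adj2_inverse(2)[OF det[OF z]])
qed

lemma has_derivative_maurer_cartan:
  fixes X :: "complex \<Rightarrow> mat2"
  assumes X: "X differentiable (at z)" and det: "det (X z) = 1"
    and \<omega>: "matrix_inv (X z) ** mat_entrywise d_z X z = \<omega>" "matrix_inv (X z) ** mat_entrywise d_zbar X z = \<omega>'"
  shows "(X has_derivative (\<lambda>h. X z ** (\<chi> i j. h * \<omega> $ i $ j + cnj h * \<omega>' $ i $ j))) (at z)"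
proof -
  have inv: "X z ** matrix_inv (X z) = mat 1"
    using matrix_inv_eqI[OF adj2_inverse(1)[OF det]] adj2_inverse(1)[OF det] by simp
  have "mat_entrywise d_z X z = X z ** \<omega>" "mat_entrywise d_zbar X z = X z ** \<omega>'"
    by (simp_all add: inv matrix_mul_assoc flip: \<omega>)
  then have 1: "d_z (\<lambda>w. X w $ i $ j) z = (X z ** \<omega>) $ i $ j"
    and 2: "d_zbar (\<lambda>w. X w $ i $ j) z = (X z ** \<omega>') $ i $ j" for i j
    by (simp_all add: mat_entrywise_def vec_eq_iff)
  have "bounded_linear (\<lambda>A::mat2. A $ i $ j)" for i j
    by (intro bounded_linear_compose[OF bounded_linear_vec_nth] bounded_linear_vec_nth)
  from dx_dy_linear_comp[OF X this]
  have dxy: "dx (\<lambda>w. X w $ i $ j) z = dx X z $ i $ j" "dy (\<lambda>w. X w $ i $ j) z = dy X z $ i $ j" for i j .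
  have ent: "dx X z $ i $ j = (X z ** \<omega>) $ i $ j + (X z ** \<omega>') $ i $ j"
       "dy X z $ i $ j = \<i> * ((X z ** \<omega>) $ i $ j - (X z ** \<omega>') $ i $ j)" for i j
    unfolding 1[symmetric] 2[symmetric] d_z_def d_zbar_def dxy by (simp_all add: field_simps)
  have "Re h *\<^sub>R dx X z + Im h *\<^sub>R dy X z = X z ** (\<chi> i j. h * \<omega> $ i $ j + cnj h * \<omega>' $ i $ j)" for h
  proof -
    define x y where "x = Re h" and "y = Im h"
    have h: "h = of_real x + \<i> * of_real y" "cnj h = of_real x - \<i> * of_real y"
      by (simp_all add: complex_eq_iff x_def y_def)
    have "(Re h *\<^sub>R dx X z + Im h *\<^sub>R dy X z) $ i $ j = h * (X z ** \<omega>) $ i $ j + cnj h * (X z ** \<omega>') $ i $ j" for i j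
      unfolding h(2) x_def[symmetric] y_def[symmetric] unfolding h(1)
      unfolding vector_add_component vector_scaleR_component ent
      by (simp add: scaleR_conv_of_real algebra_simps)
    also have "h * (X z ** \<omega>) $ i $ j + cnj h * (X z ** \<omega>') $ i $ j
        = (X z ** (\<chi> i j. h * \<omega> $ i $ j + cnj h * \<omega>' $ i $ j)) $ i $ j" for i j
      by (simp add: matrix_matrix_mult_def sum_2 algebra_simps)
    finally show ?thesis by (simp add: vec_eq_iff)
  qed
  with has_derivative_dx_dy[OF X] show ?thesis by simp
qed

text \<open>For each fixed \<open>l\<close> on the circle two frames solve the same linear system
  with the same value at \<open>z0\<close>; off the circle both are extensional. This lets every
  statement about some frame of \<open>f\<close> be checked on \<open>frame_loop\<close>.\<close>

lemma extended_frame_unique: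
  assumes S: "open S" "connected S" "z0 \<in> S"
    and F: "extended_frame S z0 f F" and F': "extended_frame S z0 f F'" and z: "z \<in> S"
  shows "F z = F' z"
proof
  fix l
  have LG: "F w \<in> LG" "F' w \<in> LG" if "w \<in> S" for w using F F' that by (auto simp: extended_frame_def)
  show "F z l = F' z l"
  proof (cases "l \<in> circle")
    case False
    then show ?thesis using LG[OF z] by (simp add: LG_def twisted_loops_def extensional_def)
  next
    case l: True
    define \<omega> where "\<omega> w = mat22 (d_z (\<lambda>w. of_real (conf_u f w)) w / 2) 0
        (hopf f w * complex_of_real (exp (- conf_u f w)) * inverse l / 2) (- d_z (\<lambda>w. of_real (conf_u f w)) w / 2)" for w
    define \<omega>' where "\<omega>' w = mat22 (- d_zbar (\<lambda>w. of_real (conf_u f w)) w / 2)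
        (- cnj (hopf f w) * complex_of_real (exp (- conf_u f w)) * l / 2) 0 (d_zbar (\<lambda>w. of_real (conf_u f w)) w / 2)" for w
    have det: "det (F w l) = 1" "det (F' w l) = 1" if "w \<in> S" for w
      using LG[OF that] l by (auto simp: LG_def twisted_loops_def)
    have mc: "(\<lambda>w. H w l) differentiable (at w) \<and> matrix_inv (H w l) ** mat_entrywise d_z (\<lambda>w. H w l) w = \<omega> w \<and>
       matrix_inv (H w l) ** mat_entrywise d_zbar (\<lambda>w. H w l) w = \<omega>' w" if "extended_frame S z0 f H" "w \<in> S" for H w
      using that l unfolding extended_frame_def C1_on_def Let_def \<omega>_def \<omega>'_def by blast
    show ?thesis
    proof (rule maurer_cartan_unique[OF S, where X = "\<lambda>z. F z l" and Y = "\<lambda>z. F' z l"])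
      show "((\<lambda>z. F z l) has_derivative (\<lambda>h. F w l ** (\<chi> i j. h * \<omega> w $ i $ j + cnj h * \<omega>' w $ i $ j))) (at w)"
        "((\<lambda>z. F' z l) has_derivative (\<lambda>h. F' w l ** (\<chi> i j. h * \<omega> w $ i $ j + cnj h * \<omega>' w $ i $ j))) (at w)"
        if "w \<in> S" for w
        using mc[OF F that] mc[OF F' that] det[OF that] by (auto intro!: has_derivative_maurer_cartan)
      show "(\<chi> i j. h * \<omega> w $ i $ j + cnj h * \<omega>' w $ i $ j) $ 2 $ 2 = - (\<chi> i j. h * \<omega> w $ i $ j + cnj h * \<omega>' w $ i $ j) $ 1 $ 1" for w h
        by (simp add: \<omega>_def \<omega>'_def algebra_simps)
      show "F z0 l = F' z0 l" using F F' by (simp add: extended_frame_def)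
    qed (use det z in auto)
  qed
qed

text \<open>The Birkhoff splitting is elimination of the lower left entry: the negative factor is
  \<open>(1, 0; - \<nu> / l, 1)\<close> with \<open>\<nu> = b / a\<close>, and the remaining factor
  is upper triangular. It breaks down exactly at the zeros of \<open>a\<close>, and it yields
  \<open>p = - deriv \<nu>\<close>.\<close>

lemma frame_potential_spinor:
  assumes S: "open S" "connected S" "z0 \<in> S" and rep: "spinor_rep S R f a b" and norm: "normalized_at z0 a b"
  shows "frame_potential S (\<lambda>z. frame_loop (a z) (b z)) (remove_sings (\<lambda>z. - deriv (\<lambda>w. b w / a w) z))"
proof -
  define \<nu> where "\<nu> w = b w / a w" for w
  define X where "X = {z. a z = 0}"
  note hol = spinor_rep_holomorphic[OF S(1) rep]
  have X: "X sparse_in S" using spinor_nonzero_cosparse[OF S rep norm] by (simp add: eventually_cosparse X_def)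
  have opn: "open (S - X)" by (rule open_diff_sparse_pts[OF S(1) X])
  have \<nu>_hol: "\<nu> holomorphic_on S - X"
    unfolding \<nu>_def[abs_def] using hol by (intro holomorphic_intros) (auto simp: X_def intro: holomorphic_on_subset)
  have "\<nu> meromorphic_on S"
    unfolding \<nu>_def[abs_def] using hol S(1) by (intro meromorphic_intros analytic_on_imp_meromorphic_on) (auto simp: analytic_on_open)
  then have "(\<lambda>z. - deriv \<nu> z) meromorphic_on S" by (intro meromorphic_intros)
  \<comment> \<open>Removing singularities fixes the values of \<open>p\<close> on \<open>X\<close>;
    off \<open>X\<close> the derivative of \<open>\<nu>\<close> is analytic and nothing
    changes.\<close>
  note nice = remove_sings_nicely_meromorphic[OF this]
  have p: "remove_sings (\<lambda>z. - deriv \<nu> z) z = - deriv \<nu> z" if "z \<in> S - X" for z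
  proof (rule remove_sings_at_analytic)
    have "(\<lambda>z. - deriv \<nu> z) holomorphic_on S - X" by (intro holomorphic_intros \<nu>_hol opn)
    then show "(\<lambda>z. - deriv \<nu> z) analytic_on {z}" using opn that by (rule holomorphic_on_imp_analytic_at)
  qed
  define \<Phi> :: "complex \<Rightarrow> loop" where "\<Phi> z = (\<lambda>l\<in>circle. mat22 1 0 (- \<nu> z * inverse l) 1)" for z
  define s where "s z = complex_of_real (inverse (sqrt ((norm (a z))\<^sup>2 + (norm (b z))\<^sup>2)))" for z
  define G :: "complex \<Rightarrow> loop" where
    "G z = (\<lambda>l\<in>circle. mat22 (s z * a z) (s z * cnj (b z) * l) 0 (s z * (\<nu> z * cnj (b z) + cnj (a z))))" for z
  have \<Phi>: "\<Phi> z \<in> Lminus_star" for z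
  proof -
    have "\<Phi> z \<in> twisted_loops"
      by (rule twisted_loopsI[of _ "\<lambda>_. 1" "\<lambda>_. 0" "\<lambda>l. - \<nu> z * inverse l" "\<lambda>_. 1"])
         (auto simp: \<Phi>_def intro!: continuous_intros)
    define H :: loop where "H l = mat22 1 0 (- \<nu> z * inverse l) 1" for l
    have "\<forall>i j. continuous_on {l. 1 \<le> norm l} (\<lambda>l. H l $ i $ j)"
      unfolding mat2_all H_def by (auto intro!: continuous_intros)
    then have "continuous_on {l. 1 \<le> norm l} H" by (intro continuous_on_matI) blast
    moreover have "\<forall>i j. (\<lambda>l. H l $ i $ j) holomorphic_on {l. 1 < norm l}"
      unfolding mat2_all H_def by (auto intro!: holomorphic_intros)
    then have "mat_holomorphic_on H {l. 1 < norm l}" by (simp add: mat_holomorphic_on_def)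
    moreover have "((\<lambda>l. - \<nu> z * inverse l) \<longlongrightarrow> 0) at_infinity"
      by (rule tendsto_mult_right_zero[OF tendsto_inverse_0])
    then have "\<forall>i j. ((\<lambda>l. H l $ i $ j) \<longlongrightarrow> mat 1 $ i $ j) at_infinity"
      unfolding mat2_all H_def by (simp add: mat_def)
    then have "(H \<longlongrightarrow> mat 1) at_infinity" by (intro vec_tendstoI) blast
    moreover have "\<forall>l\<in>circle. H l = \<Phi> z l" by (simp add: H_def \<Phi>_def)
    ultimately show ?thesis
      using \<open>\<Phi> z \<in> twisted_loops\<close> unfolding Lminus_star_def extends_outside_def by blast
  qed
  have sc: "s z * s z * (a z * cnj (a z) + b z * cnj (b z)) = 1" if "z \<in> S" for z
    unfolding s_def by (rule frame_scale(2)[OF spinor_rep_nonzero[OF S(1) rep that]])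
  have G: "G z \<in> Lplus" if z: "z \<in> S - X" for z
  proof -
    have a: "a z \<noteq> 0" "z \<in> S" using z by (auto simp: X_def)
    have "G z \<in> twisted_loops"
      by (rule twisted_loopsI[of _ "\<lambda>_. s z * a z" "\<lambda>l. s z * cnj (b z) * l" "\<lambda>_. 0" "\<lambda>_. s z * (\<nu> z * cnj (b z) + cnj (a z))"])
         (use sc[OF a(2)] a(1) in \<open>auto simp: G_def \<nu>_def field_simps intro!: continuous_intros\<close>)
    define H :: loop where "H l = mat22 (s z * a z) (s z * cnj (b z) * l) 0 (s z * (\<nu> z * cnj (b z) + cnj (a z)))" for l
    have "\<forall>i j. continuous_on (cball 0 1) (\<lambda>l. H l $ i $ j)"
      unfolding mat2_all H_def by (auto intro!: continuous_intros)
    then have "continuous_on (cball 0 1) H" by (intro continuous_on_matI) blast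
    moreover have "\<forall>i j. (\<lambda>l. H l $ i $ j) holomorphic_on ball 0 1"
      unfolding mat2_all H_def by (auto intro!: holomorphic_intros)
    then have "mat_holomorphic_on H (ball 0 1)" by (simp add: mat_holomorphic_on_def)
    ultimately have "extends_inside (G z) H" by (simp add: extends_inside_def H_def G_def)
    with \<open>G z \<in> twisted_loops\<close> show ?thesis by (auto simp: Lplus_def)
  qed
  have FG: "frame_loop (a z) (b z) = loop_mult (\<Phi> z) (G z)" if z: "z \<in> S - X" for z
  proof
    fix l
    show "frame_loop (a z) (b z) l = loop_mult (\<Phi> z) (G z) l"
    proof (cases "l \<in> circle")
      case True
      then have "l \<noteq> 0" by auto
      moreover have "a z \<noteq> 0" using z by (simp add: X_def)
      moreover have "frame_loop (a z) (b z) l = mat22 (s z * a z) (s z * cnj (b z) * l) (- s z * b z / l) (s z * cnj (a z))"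
        using True by (simp add: frame_loop_def s_def Let_def)
      ultimately show ?thesis
        using True by (simp add: loop_mult_def \<Phi>_def G_def mat22_mult mat22_eq_iff \<nu>_def field_simps)
    qed (simp add: frame_loop_def loop_mult_def Let_def)
  qed
  have "\<forall>i j. (\<lambda>z. \<Phi> z l $ i $ j) holomorphic_on S - X" if "l \<in> circle" for l
    unfolding mat2_all \<Phi>_def using that by (auto intro!: holomorphic_intros \<nu>_hol)
  then have \<Phi>_hol: "mat_holomorphic_on (\<lambda>z. \<Phi> z l) (S - X)" if "l \<in> circle" for l
    using that by (simp add: mat_holomorphic_on_def)
  have "matrix_inv (\<Phi> z l) ** mat_entrywise deriv (\<lambda>w. \<Phi> w l) z
      = mat22 0 0 (remove_sings (\<lambda>z. - deriv \<nu> z) z * inverse l) 0" if z: "z \<in> S - X" and l: "l \<in> circle" for z l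
  proof -
    have "(\<nu> has_field_derivative deriv \<nu> z) (at z)" by (rule holomorphic_derivI[OF \<nu>_hol opn z])
    then have "((\<lambda>w. - \<nu> w * inverse l) has_field_derivative - deriv \<nu> z * inverse l) (at z)"
      by (auto intro!: derivative_eq_intros)
    then have "deriv (\<lambda>w. - (\<nu> w * inverse l)) z = - (deriv \<nu> z * inverse l)" by (simp add: DERIV_imp_deriv)
    then have D: "mat_entrywise deriv (\<lambda>w. \<Phi> w l) z = mat22 0 0 (- (deriv \<nu> z * inverse l)) 0"
      by (intro mat22_eqI) (use l in \<open>simp_all add: mat_entrywise_def \<Phi>_def\<close>)
    have "matrix_inv (\<Phi> z l) = mat22 1 0 (\<nu> z * inverse l) 1"
      using l by (simp add: \<Phi>_def matrix_inv_mat22)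
    then show ?thesis unfolding D p[OF z] by (simp add: mat22_mult mat22_eq_iff)
  qed
  then show ?thesis
    unfolding frame_potential_def using nice X \<Phi> G FG \<Phi>_hol unfolding \<nu>_def[abs_def]
    by (intro conjI exI[of _ X] exI[of _ \<Phi>] exI[of _ G]) auto
qed

section \<open>The group action\<close>


context
  fixes S :: "complex set" and z0 :: complex
  assumes S: "open S" "connected S" "simply_connected S" "z0 \<in> S"
begin

text \<open>Since the linear map on spinors is invertible, the new pair again has no common zero and
  therefore integrates to an immersion with the same \<open>R\<close> and the same value at
  \<open>z0\<close>.\<close>

lemma exists_dressing:
  assumes rep: "spinor_rep S R f a b" and norm: "normalized_at z0 a b" and h: "relevant_data h r \<beta>"
  obtains g where "spinor_rep S R g (\<lambda>z. of_real r * a z - \<beta> * b z) (\<lambda>z. b z / of_real r)"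
    "g z0 = f z0" "immersion_dressing S z0 h f g"
    "normalized_at z0 (\<lambda>z. of_real r * a z - \<beta> * b z) (\<lambda>z. b z / of_real r)"
proof -
  have r: "r > 0" using h by (simp add: relevant_data_def)
  note hol = spinor_rep_holomorphic[OF S(1) rep]
  have "(\<lambda>z. of_real r * a z - \<beta> * b z) holomorphic_on S" "(\<lambda>z. b z / of_real r) holomorphic_on S"
    using r by (auto intro!: holomorphic_intros hol)
  moreover have "of_real r * a z - \<beta> * b z \<noteq> 0 \<or> b z / of_real r \<noteq> 0" if "z \<in> S" for z
    using spinor_rep_nonzero[OF S(1) rep that] r by auto
  ultimately obtain g where g: "spinor_rep S R g (\<lambda>z. of_real r * a z - \<beta> * b z) (\<lambda>z. b z / of_real r)" "g z0 = f z0"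
    using exists_spinor_immersion[OF S(1,3,4) spinor_rep_rotation[OF S(1) rep]] by blast
  show ?thesis
    by (rule that[OF g immersion_dressing_spinor[OF S(1,2,4) rep norm h g] normalized_at_dressing[OF S(1,2,4) rep norm h g(1)]])
qed

text \<open>Any solution of the system has the \<open>f_z\<close> computed from the spinor of
  \<open>f\<close>; with the prescribed value at \<open>z0\<close> and extensionality nothing is
  left to choose.\<close>

lemma dressing_unique:
  assumes f: "f \<in> minimal_immersions S" and h: "relevant_data h r \<beta>"
    and g: "g \<in> minimal_immersions S" "immersion_dressing S z0 h f g"
    and g': "g' \<in> minimal_immersions S" "immersion_dressing S z0 h f g'"
  shows "g = g'"
proof -
  obtain a b where rep: "spinor_rep S (coord_frame f z0) f a b" and norm: "normalized_at z0 a b"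
    using exists_spinor_rep[OF S(1,3,4) f] by blast
  note f_z = immersion_dressing_f_z[OF S(1,2,4) rep norm h]
  have "g z = g' z" if "z \<in> S" for z
  proof (rule eq_if_f_z_eq[OF S(1,2,4) minimal_differentiable(1)[OF S(1) g(1)] minimal_differentiable(1)[OF S(1) g'(1)] _ _ that])
    show "f_z g w = f_z g' w" if "w \<in> S" for w using f_z[OF g that] f_z[OF g' that] by simp
    show "g z0 = g' z0" using g(2) g'(2) by (simp add: immersion_dressing_def)
  qed
  moreover have "g z = g' z" if "z \<notin> S" for z
    using g(1) g'(1) that by (auto simp: minimal_immersions_def extensional_def)
  ultimately show ?thesis by blast
qed

lemma ex1_dressing:
  assumes f: "f \<in> minimal_immersions S" and h: "relevant_data h r \<beta>"
  shows "\<exists>!g. g \<in> minimal_immersions S \<and> immersion_dressing S z0 h f g"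
proof -
  obtain a b where rep: "spinor_rep S (coord_frame f z0) f a b" and norm: "normalized_at z0 a b"
    using exists_spinor_rep[OF S(1,3,4) f] by blast
  obtain g where g: "spinor_rep S (coord_frame f z0) g (\<lambda>z. of_real r * a z - \<beta> * b z) (\<lambda>z. b z / of_real r)"
    "immersion_dressing S z0 h f g"
    using exists_dressing[OF rep norm h] by blast
  show ?thesis
    using g(2) spinor_rep_minimal[OF S(1) g(1)] dressing_unique[OF f h] by blast
qed

lemma dress_eqI:
  assumes "f \<in> minimal_immersions S" "relevant_data h r \<beta>"
    "g \<in> minimal_immersions S" "immersion_dressing S z0 h f g"
  shows "dress S z0 h f = g"
  using assms the1_equality[OF ex1_dressing[OF assms(1,2)], of g] by (simp add: dress_def)

lemma dress_minimal:
  assumes "f \<in> minimal_immersions S" "relevant_data h r \<beta>"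
  shows "dress S z0 h f \<in> minimal_immersions S"
  using theI'[OF ex1_dressing[OF assms]] assms(1) by (simp add: dress_def)

lemma dress_spinor:
  assumes rep: "spinor_rep S R f a b" and norm: "normalized_at z0 a b" and h: "relevant_data h r \<beta>"
  shows "spinor_rep S R (dress S z0 h f) (\<lambda>z. of_real r * a z - \<beta> * b z) (\<lambda>z. b z / of_real r)"
    "normalized_at z0 (\<lambda>z. of_real r * a z - \<beta> * b z) (\<lambda>z. b z / of_real r)"
    "dress S z0 h f z0 = f z0"
proof -
  obtain g where g: "spinor_rep S R g (\<lambda>z. of_real r * a z - \<beta> * b z) (\<lambda>z. b z / of_real r)"
    "g z0 = f z0" "immersion_dressing S z0 h f g"
    "normalized_at z0 (\<lambda>z. of_real r * a z - \<beta> * b z) (\<lambda>z. b z / of_real r)"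
    using exists_dressing[OF rep norm h] by blast
  have "dress S z0 h f = g"
    by (rule dress_eqI[OF spinor_rep_minimal[OF S(1) rep] h spinor_rep_minimal[OF S(1) g(1)] g(3)])
  with g show "spinor_rep S R (dress S z0 h f) (\<lambda>z. of_real r * a z - \<beta> * b z) (\<lambda>z. b z / of_real r)"
    "normalized_at z0 (\<lambda>z. of_real r * a z - \<beta> * b z) (\<lambda>z. b z / of_real r)"
    "dress S z0 h f z0 = f z0" by simp_all
qed

lemma LplusP_relevant_data:
  assumes "h \<in> LplusP"
  obtains r \<beta> where "relevant_data h r \<beta>"
  using LplusP_entries[OF assms] plus_entries_relevant_data by metis

text \<open>Two successive linear maps on spinors compose to the map of the product, because the
  relevant data multiply in the same way. The immersion dressed twice thus solves the system for the
  product loop, and uniqueness identifies it.\<close>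

lemma dress_mult:
  assumes h: "h1 \<in> LplusP" "h2 \<in> LplusP" and f: "f \<in> minimal_immersions S"
  shows "dress S z0 (loop_mult h1 h2) f = dress S z0 h1 (dress S z0 h2 f)"
proof -
  obtain A1 B1 C1 D1 r1 \<beta>1 where e1: "plus_entries h1 A1 B1 C1 D1 r1 \<beta>1" using LplusP_entries[OF h(1)] .
  obtain A2 B2 C2 D2 r2 \<beta>2 where e2: "plus_entries h2 A2 B2 C2 D2 r2 \<beta>2" using LplusP_entries[OF h(2)] .
  have r: "r1 > 0" "r2 > 0" using e1 e2 by (auto simp: plus_entries_def)
  obtain a b where rep: "spinor_rep S (coord_frame f z0) f a b" and norm: "normalized_at z0 a b"
    using exists_spinor_rep[OF S(1,3,4) f] by blast
  note d2 = dress_spinor[OF rep norm plus_entries_relevant_data[OF e2]]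
  note d1 = dress_spinor[OF d2(1,2) plus_entries_relevant_data[OF e1]]
  note h12 = plus_entries_relevant_data[OF plus_entries_mult[OF e1 e2]]
  have eq: "(\<lambda>z. of_real r1 * (of_real r2 * a z - \<beta>2 * b z) - \<beta>1 * (b z / of_real r2))
      = (\<lambda>z. of_real (r1 * r2) * a z - (of_real r1 * \<beta>2 + \<beta>1 * inverse (of_real r2)) * b z)"
    "(\<lambda>z. b z / of_real r2 / of_real r1) = (\<lambda>z. b z / of_real (r1 * r2))"
    using r by (auto simp: fun_eq_iff field_simps)
  have rep12: "spinor_rep S (coord_frame f z0) (dress S z0 h1 (dress S z0 h2 f))
     (\<lambda>z. of_real (r1 * r2) * a z - (of_real r1 * \<beta>2 + \<beta>1 * inverse (of_real r2)) * b z) (\<lambda>z. b z / of_real (r1 * r2))"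
    using d1(1) unfolding eq .
  show ?thesis
  proof (rule dress_eqI[OF f h12 spinor_rep_minimal[OF S(1) d1(1)]])
    show "immersion_dressing S z0 (loop_mult h1 h2) f (dress S z0 h1 (dress S z0 h2 f))"
      by (rule immersion_dressing_spinor[OF S(1,2,4) rep norm h12 rep12]) (simp add: d1(3) d2(3))
  qed
qed

lemma dress_one:
  assumes f: "f \<in> minimal_immersions S"
  shows "dress S z0 loop_one f = f"
proof -
  obtain a b where rep: "spinor_rep S (coord_frame f z0) f a b" and norm: "normalized_at z0 a b"
    using exists_spinor_rep[OF S(1,3,4) f] by blast
  note one = plus_entries_relevant_data[OF plus_entries_one]
  have "immersion_dressing S z0 loop_one f f"
    by (rule immersion_dressing_spinor[OF S(1,2,4) rep norm one]) (use rep in simp_all)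
  then show ?thesis by (rule dress_eqI[OF f one f])
qed

lemma dress_Bij:
  assumes h: "h \<in> LplusP"
  shows "dress S z0 h \<in> Bij (minimal_immersions S)"
proof -
  have tw: "h \<in> twisted_loops" using h by (simp add: LplusP_def)
  have map: "dress S z0 h' f \<in> minimal_immersions S" if "h' \<in> LplusP" "f \<in> minimal_immersions S" for h' f
    using LplusP_relevant_data[OF that(1)] dress_minimal[OF that(2)] by blast
  note inv = loop_inverse_LplusP[OF h]
  have "bij_betw (dress S z0 h) (minimal_immersions S) (minimal_immersions S)"
  proof (rule bij_betwI[where g = "dress S z0 (loop_inverse h)"])
    show "dress S z0 (loop_inverse h) (dress S z0 h f) = f" "dress S z0 h (dress S z0 (loop_inverse h) f) = f"
      if "f \<in> minimal_immersions S" for f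
      using dress_mult[OF inv h that] dress_mult[OF h inv that] dress_one[OF that] loop_inverse_mult[OF tw] by simp_all
  qed (use map h inv in auto)
  then show ?thesis by (simp add: Bij_def dress_def)
qed

lemma group_action_dress: "group_action LplusP_group (minimal_immersions S) (dress S z0)"
proof (intro group_action.intro group_hom.intro group_hom_axioms.intro homI group_LplusP group_BijGroup)
  fix x y assume "x \<in> carrier LplusP_group" "y \<in> carrier LplusP_group"
  then have x: "x \<in> LplusP" and y: "y \<in> LplusP" by (simp_all add: LplusP_group_def)
  show "dress S z0 x \<in> carrier (BijGroup (minimal_immersions S))"
    using dress_Bij[OF x] by (simp add: BijGroup_def)
  \<comment> \<open>Composition in \<open>BijGroup\<close> is restricted to the carrier;
    \<open>dress\<close> is extensional there too, so the two sides agree as functions and not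
    merely on immersions.\<close>
  have "dress S z0 (loop_mult x y) = compose (minimal_immersions S) (dress S z0 x) (dress S z0 y)"
    using dress_mult[OF x y] by (auto simp: compose_def dress_def fun_eq_iff)
  then show "dress S z0 (x \<otimes>\<^bsub>LplusP_group\<^esub> y)
      = dress S z0 x \<otimes>\<^bsub>BijGroup (minimal_immersions S)\<^esub> dress S z0 y"
    using dress_Bij[OF x] dress_Bij[OF y] by (simp add: BijGroup_def LplusP_group_def)
qed

lemma exists_normalized_potential:
  assumes "f \<in> minimal_immersions S"
  shows "\<exists>p. normalized_potential S z0 f p"
proof -
  obtain a b where rep: "spinor_rep S (coord_frame f z0) f a b" and norm: "normalized_at z0 a b"
    using exists_spinor_rep[OF S(1,3,4) assms] by blast
  show ?thesis
    unfolding normalized_potential_def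
    using extended_frame_spinor[OF S(1) rep norm] frame_potential_spinor[OF S(1,2,4) rep norm] by blast
qed

text \<open>The given frames must be the explicit ones, and for these the Iwasawa decomposition is
  known at every point of \<open>S\<close>. The potentials themselves are carried along with their
  frames.\<close>

lemma dress_potential:
  assumes h: "h \<in> LplusP" and f: "f \<in> minimal_immersions S"
    and p: "normalized_potential S z0 f p" and q: "normalized_potential S z0 (dress S z0 h f) q"
  shows "potential_dressing S z0 h p q"
proof -
  obtain A B C D r \<beta> where e: "plus_entries h A B C D r \<beta>" using LplusP_entries[OF h] .
  obtain a b where rep: "spinor_rep S (coord_frame f z0) f a b" and norm: "normalized_at z0 a b"
    using exists_spinor_rep[OF S(1,3,4) f] by blast
  note d = dress_spinor[OF rep norm plus_entries_relevant_data[OF e]]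
  obtain F where F: "extended_frame S z0 f F" "frame_potential S F p"
    using p by (auto simp: normalized_potential_def)
  obtain F' where F': "extended_frame S z0 (dress S z0 h f) F'" "frame_potential S F' q"
    using q by (auto simp: normalized_potential_def)
  have "frame_dressing S h F F'"
    unfolding frame_dressing_def
  proof (intro ballI conjI)
    fix z assume z: "z \<in> S"
    show "F' z \<in> LG" using F'(1) z by (simp add: extended_frame_def)
    have Fz: "F z = frame_loop (a z) (b z)"
      by (rule extended_frame_unique[OF S(1,2,4) F(1) extended_frame_spinor[OF S(1) rep norm] z])
    have F'z: "F' z = frame_loop (of_real r * a z - \<beta> * b z) (b z / of_real r)"
      by (rule extended_frame_unique[OF S(1,2,4) F'(1) extended_frame_spinor[OF S(1) d(1,2)] z])
    show "\<exists>G\<in>LplusP. loop_mult h (F z) = loop_mult (F' z) G"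
      unfolding Fz F'z by (rule frame_loop_dressing[OF e spinor_rep_nonzero[OF S(1) rep z]])
  qed
  then show ?thesis unfolding potential_dressing_def using f F F'(2) by blast
qed

end

theorem theorem6p3:
  fixes \<Sigma> :: "complex set" and z\<^sub>0 :: complex
  assumes "open \<Sigma>" and "connected \<Sigma>" and "simply_connected \<Sigma>" and "z\<^sub>0 \<in> \<Sigma>"
  shows "(\<forall>h\<in>LplusP. \<forall>f\<in>minimal_immersions \<Sigma>.
            \<exists>!g. g \<in> minimal_immersions \<Sigma> \<and> immersion_dressing \<Sigma> z\<^sub>0 h f g) \<and>
         (\<forall>f\<in>minimal_immersions \<Sigma>. \<exists>p. normalized_potential \<Sigma> z\<^sub>0 f p) \<and>
         (\<forall>h\<in>LplusP. \<forall>f\<in>minimal_immersions \<Sigma>. \<forall>p q.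
            normalized_potential \<Sigma> z\<^sub>0 f p \<and> normalized_potential \<Sigma> z\<^sub>0 (dress \<Sigma> z\<^sub>0 h f) q \<longrightarrow>
            potential_dressing \<Sigma> z\<^sub>0 h p q) \<and>
         group_action LplusP_group (minimal_immersions \<Sigma>) (dress \<Sigma> z\<^sub>0)"
proof (intro conjI ballI allI impI)
  fix h f assume h: "h \<in> LplusP" and f: "f \<in> minimal_immersions \<Sigma>"
  obtain r \<beta> where "relevant_data h r \<beta>" using LplusP_relevant_data[OF assms h] .
  then show "\<exists>!g. g \<in> minimal_immersions \<Sigma> \<and> immersion_dressing \<Sigma> z\<^sub>0 h f g"
    by (rule ex1_dressing[OF assms f])
next
  fix f assume "f \<in> minimal_immersions \<Sigma>"
  then show "\<exists>p. normalized_potential \<Sigma> z\<^sub>0 f p" by (rule exists_normalized_potential[OF assms])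
next
  fix h f p q assume "h \<in> LplusP" "f \<in> minimal_immersions \<Sigma>"
    "normalized_potential \<Sigma> z\<^sub>0 f p \<and> normalized_potential \<Sigma> z\<^sub>0 (dress \<Sigma> z\<^sub>0 h f) q"
  then show "potential_dressing \<Sigma> z\<^sub>0 h p q" using dress_potential[OF assms] by blast
next
  show "group_action LplusP_group (minimal_immersions \<Sigma>) (dress \<Sigma> z\<^sub>0)"
    by (rule group_action_dress[OF assms])
qed

end
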